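(* There is an absolute constant $C$ such that the following holds. Let $2\le y\le x$ and let $T_1,\ldots,T_m$ be disjoint nonempty sets of primes contained in $[2,y]$. For each $1\le i\le m$, suppose that either $f_i(n)=\omega(n,T_i)$ and $Z_i\sim \mathrm{Pois}(H(T_i))$, or $f_i(n)=\Omega(n,T_i)$ and $Z_i\sim\mathrm{Pois}(H'(T_i))$, and assume $Z_1,\ldots,Z_m$ are independent. Then, with $n$ uniform on $\{1,\ldots,\lfloor x\rfloor\}$, \[ d_{TV}\big((f_1(n),\ldots,f_m(n)),(Z_1,\ldots,Z_m)\big)\le C\Big(\sum_{j=1}^m \frac{H''(T_j)}{1+H(T_j)} + u^{-u}\Big),\qquad u=\frac{\log x}{\log y}. \] The constant $C$ is independent of $m,x,y,T_1,\ldots,T_m$.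
   Context: $\mathbb P_x$ denotes probability with respect to an integer $n$ drawn uniformly at random from $[1,x]$. For a finite set $T$ of primes, $\omega(n,T)=\#\{p\mid n: p\in T\}$ and $\Omega(n,T)=\sum_{p\in T}v_p(n)$, where $v_p(n)$ is the exponent of $p$ in $n$. Define $H(T)=\sum_{p\in T}1/p$, $H'(T)=\sum_{p\in T}1/(p-1)$, $H''(T)=\sum_{p\in T}1/p^2$. $\mathrm{Pois}(\lambda)$ is a Poisson random variable with parameter $\lambda$. For random variables $X,Y$ on the same discrete space $\Omega$, $d_{TV}(X,Y)=\sup_{A\subset\Omega}|\mathbb P(X\in A)-\mathbb P(Y\in A)|$. *)

theory Defs
  imports "HOL-Probability.Probability" "HOL-Computational_Algebra.Primes"
begin

definition omegaT :: "nat \<Rightarrow> nat set \<Rightarrow> nat" where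
  "omegaT n T = card {p \<in> T. p dvd n}"

definition OmegaT :: "nat \<Rightarrow> nat set \<Rightarrow> nat" where
  "OmegaT n T = (\<Sum>p\<in>T. multiplicity p n)"

definition HT :: "nat set \<Rightarrow> real" where
  "HT T = (\<Sum>p\<in>T. 1 / real p)"

definition H1T :: "nat set \<Rightarrow> real" where
  "H1T T = (\<Sum>p\<in>T. 1 / (real p - 1))"

definition H2T :: "nat set \<Rightarrow> real" where
  "H2T T = (\<Sum>p\<in>T. 1 / (real p)^2)"

definition dTV :: "'a pmf \<Rightarrow> 'a pmf \<Rightarrow> real" where
  "dTV P Q = (SUP A. \<bar>measure_pmf.prob P A - measure_pmf.prob Q A\<bar>)"

end

theory Submission
  imports Defs "HOL-Real_Asymp.Real_Asymp"
begin

text \<open>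
  The prime factorisation of a random \<open>n \<le> x\<close>, restricted to the primes below \<open>y\<close>, is compared with
  independent geometric exponents (the Kubilius model); sums of functions of these exponents are then
  compared with Poisson variables by Stein's method, whose factor \<open>1 / (1 + \<lambda>)\<close> yields the first
  error term.

  The total variation distance to the model is the expected relative deficit, under the model, of
  the number of \<open>q\<close>-rough integers up to \<open>z = x / k\<close>, where \<open>k\<close> is the smooth number drawn from the
  model.  Only lower bounds for this count matter, and the deficit is at most \<open>1\<close>.  The sieve error
  \<open>R(z, q)\<close> satisfies Buchstab's identity \<open>R(z, q) = \<lfloor>z\<rfloor> - z - \<Sum>p<q. R(z/p, p)\<close>, and
  \<open>z / ln q * exp (- w ln w - w)\<close> with \<open>w = ln z / ln q\<close> is a supersolution of this recursion for
  large \<open>w\<close>; a crude upper bound sieve starts the induction, and Rankin's trick takes over when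
  \<open>w\<close> exceeds \<open>sqrt (ln q)\<close>.  Averaging over \<open>k\<close> costs less than the spare factor \<open>exp (- w)\<close>, so that
  the error \<open>u powr (- u)\<close> survives.

  This needs \<open>y\<close> to be large in terms of \<open>u\<close>.  If it is not, the argument runs with a larger \<open>y\<close> and
  gives an error \<open>1 / y\<^sup>2\<close>, which the first error term absorbs because no \<open>T\<^sub>j\<close> is empty.
\<close>

section \<open>Sums over primes\<close>

text \<open>A stray factor \<open>exp (c * u)\<close> with a large \<open>c\<close> would destroy
  \<open>u powr (- u)\<close>, yet the prime estimates used are only of Chebyshev's quality. Crude
  constants are made harmless in two ways. In Buchstab's recursion the sum over \<open>p\<close>
  carries a factor of order \<open>1 / ln w\<close> relative to the value at \<open>q\<close> (while
  \<open>w\<close> is small against \<open>ln q\<close>), so any constant is beaten once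
  \<open>w\<close> passes a fixed, huge bound. In Rankin's bound and in the average over
  \<open>k\<close> the cost is the exponential of a multiple of
  \<open>\<Sum>p<q. (p powr \<alpha> - 1) / p\<close>. With
  \<open>\<alpha> = \<lambda> / ln q\<close> this sum has order at most
  \<open>exp \<lambda> / \<lambda>\<close> for large \<open>\<lambda>\<close>, so it stays below
  \<open>\<eta> * exp \<lambda> + C\<close> for every \<open>\<eta> > 0\<close>; a slope
  \<open>\<lambda>\<close> close to \<open>ln u\<close> makes that a small multiple of
  \<open>u\<close>.

  Largeness of \<open>y\<close> enters because the sieve error keeps an additive
  \<open>z powr (7 / 8)\<close>, left by roundings and by Rankin's bound with its shift capped. It
  is dominated by \<open>z * exp (- \<lambda> * w)\<close> only if \<open>\<lambda>\<close> is a
  small fraction of \<open>ln q\<close>.\<close>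

lemma finite_primes_le [simp]: "finite {p::nat. prime p \<and> p \<le> n}"
  by (rule finite_subset[of _ "{..n}"]) auto

lemma finite_primes_less [simp]: "finite {p::nat. prime p \<and> p < n}"
  by (rule finite_subset[of _ "{..n}"]) auto

lemma no_primes_le_1:
  assumes "n < 2"
  shows "{p::nat. prime p \<and> p \<le> n} = {}"
proof -
  have "\<not> (prime p \<and> p \<le> n)" for p :: nat
    using prime_ge_2_nat[of p] assms by linarith
  then show ?thesis by blast
qed

section \<open>Chebyshev's upper bounds\<close>

lemma prod_distinct_primes_dvd:
  fixes b :: nat
  assumes "finite A" "\<And>p. p \<in> A \<Longrightarrow> prime p \<and> p dvd b"
  shows "\<Prod>A dvd b"
  using assms
proof (induction A rule: finite_induct)
  case (insert p A)
  have "coprime p (\<Prod>A)"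
    using insert.hyps(2) insert.prems by (intro prod_coprime_right primes_coprime) auto
  then show ?case
    using insert by (simp add: divides_mult)
qed simp

text \<open>Such a prime divides \<open>(2 * m + 1)!\<close> but neither \<open>m!\<close> nor
  \<open>(m + 1)!\<close>, so the product divides the middle binomial coefficient. That coefficient
  occurs twice in a row with sum \<open>2 * 4 ^ m\<close>.\<close>

lemma prod_primes_le_binomial:
  "\<Prod>{p::nat. prime p \<and> m + 1 < p \<and> p \<le> 2 * m + 1} \<le> 4 ^ m"
proof -
  have "\<Prod>{p::nat. prime p \<and> m + 1 < p \<and> p \<le> 2 * m + 1} dvd ((2 * m + 1) choose m)"
  proof (rule prod_distinct_primes_dvd)
    show "finite {p::nat. prime p \<and> m + 1 < p \<and> p \<le> 2 * m + 1}"
      by (rule finite_subset[of _ "{..2 * m + 1}"]) auto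
  next
    fix p :: nat
    assume "p \<in> {p. prime p \<and> m + 1 < p \<and> p \<le> 2 * m + 1}"
    then have p: "prime p" "m + 1 < p" "p \<le> 2 * m + 1" by auto
    have "p dvd fact (2 * m + 1)"
      using p by (simp add: prime_dvd_fact_iff del: fact_Suc)
    moreover have "fact m * fact (m + 1) * ((2 * m + 1) choose m) = (fact (2 * m + 1) :: nat)"
      using binomial_fact_lemma[of m "2 * m + 1"] by simp
    ultimately have "p dvd fact m * fact (m + 1) * ((2 * m + 1) choose m)" by metis
    moreover have "\<not> p dvd fact m" "\<not> p dvd fact (m + 1)"
      using p by (auto simp: prime_dvd_fact_iff simp del: fact_Suc)
    ultimately show "prime p \<and> p dvd ((2 * m + 1) choose m)"
      using p(1) by (simp add: prime_dvd_mult_iff)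
  qed
  then have "\<Prod>{p::nat. prime p \<and> m + 1 < p \<and> p \<le> 2 * m + 1} \<le> ((2 * m + 1) choose m)"
    by (rule dvd_imp_le) simp
  also have "\<dots> \<le> 4 ^ m"
  proof -
    have sym: "(2 * m + 1) choose m = (2 * m + 1) choose (m + 1)"
      using binomial_symmetric[of m "2 * m + 1"] by simp
    have "(\<Sum>k\<in>{m, m + 1}. (2 * m + 1) choose k) \<le> (\<Sum>k\<le>2 * m + 1. (2 * m + 1) choose k)"
      by (rule sum_mono2) auto
    also have "\<dots> = 2 ^ (2 * m + 1)" by (rule choose_row_sum)
    finally have "2 * ((2 * m + 1) choose m) \<le> 2 * 4 ^ m"
      using sym by (simp add: power_mult)
    then show ?thesis by simp
  qed
  finally show ?thesis .
qed

text \<open>Erdos's induction: an even \<open>n > 2\<close> adds no prime, and for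
  \<open>n = 2 * m + 1\<close> the primes beyond \<open>m + 1\<close> contribute at most
  \<open>m * ln 4\<close>.\<close>

lemma chebyshev_theta:
  "(\<Sum>p | prime p \<and> p \<le> n. ln (real p)) \<le> real n * ln 4"
proof (induction n rule: less_induct)
  case (less n)
  consider "n < 2" | "n = 2" | m where "n = 2 * m" "m \<ge> 2" | m where "n = 2 * m + 1" "m \<ge> 1"
  proof (cases "n \<le> 2")
    case False
    then show ?thesis using that by (cases "even n") (auto elim!: evenE oddE)
  qed (use that in linarith)
  then show ?case
  proof cases
    case 1
    then show ?thesis by (simp only: no_primes_le_1) simp
  next
    case 2
    have "{p::nat. prime p \<and> p \<le> n} = {2}" unfolding 2 by (auto simp: two_is_prime_nat intro!: le_antisym prime_ge_2_nat)
    moreover have "ln (2::real) \<le> 2 * ln 4" by (rule order_trans[of _ "ln 4"]) simp_all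
    ultimately show ?thesis by (simp add: 2)
  next
    case 3
    have "{p. prime p \<and> p \<le> n} = {p. prime p \<and> p \<le> n - 1}"
    proof -
      have "\<not> prime n" using 3 prime_odd_nat[of n] by auto
      then show ?thesis using 3 by (auto simp: le_less)
    qed
    then have "(\<Sum>p | prime p \<and> p \<le> n. ln (real p)) \<le> real (n - 1) * ln 4"
      using less.IH[of "n - 1"] 3 by simp
    also have "\<dots> \<le> real n * ln 4" by (intro mult_right_mono) auto
    finally show ?thesis .
  next
    case 4
    let ?B = "{p::nat. prime p \<and> m + 1 < p \<and> p \<le> 2 * m + 1}"
    have fB: "finite ?B" by (rule finite_subset[of _ "{..2 * m + 1}"]) auto
    have "{p. prime p \<and> p \<le> n} = {p. prime p \<and> p \<le> m + 1} \<union> ?B" using 4 by auto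
    then have "(\<Sum>p | prime p \<and> p \<le> n. ln (real p)) =
        (\<Sum>p | prime p \<and> p \<le> m + 1. ln (real p)) + (\<Sum>p\<in>?B. ln (real p))"
      using fB by (simp add: sum.union_disjoint disjoint_iff)
    also have "(\<Sum>p\<in>?B. ln (real p)) = ln (\<Prod>p\<in>?B. real p)"
      using fB by (subst ln_prod) (auto simp: prime_gt_0_nat)
    also have "\<dots> \<le> ln (4 ^ m)"
    proof -
      have "real (\<Prod>?B) \<le> real (4 ^ m)" using prod_primes_le_binomial[of m] by (simp only: of_nat_le_iff)
      then have "(\<Prod>p\<in>?B. real p) \<le> 4 ^ m" by simp
      moreover have "(\<Prod>p\<in>?B. real p) > 0" by (rule prod_pos) (auto simp: prime_gt_0_nat)
      ultimately show ?thesis by simp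
    qed
    also have "ln (4 ^ m :: real) = real m * ln 4" by (simp add: ln_realpow)
    also have "(\<Sum>p | prime p \<and> p \<le> m + 1. ln (real p)) \<le> real (m + 1) * ln 4"
      using less.IH[of "m + 1"] 4 by simp
    finally show ?thesis using 4 by (simp add: algebra_simps)
  qed
qed

lemma chebyshev_theta_2:
  "(\<Sum>p | prime p \<and> p \<le> n. ln (real p)) \<le> 2 * real n"
proof -
  have "ln (4::real) = 2 * ln 2" using ln_realpow[of 2 2] by simp
  also have "\<dots> \<le> 2" using ln_le_minus_one[of 2] by simp
  finally have "real n * ln 4 \<le> real n * 2" by (intro mult_left_mono) auto
  with chebyshev_theta[of n] show ?thesis by simp
qed

lemma ln_le_2_sqrt:
  assumes "(x::real) > 0"
  shows "ln x \<le> 2 * sqrt x"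
proof -
  have "ln (sqrt x) \<le> sqrt x" using ln_le_minus_one[of "sqrt x"] assms by simp
  then show ?thesis using assms by (simp add: ln_sqrt)
qed

text \<open>Primes above \<open>sqrt z\<close> weigh at least \<open>ln z / 2\<close> each in
  Chebyshev's sum; the others number at most \<open>sqrt z \<le> 2 * z / ln z\<close>.\<close>

lemma card_primes_le_bound:
  assumes "(z::real) \<ge> 2"
  shows "real (card {p::nat. prime p \<and> real p \<le> z}) \<le> 6 * z / ln z"
proof -
  let ?A = "{p::nat. prime p \<and> real p \<le> z}" and ?B = "{p::nat. prime p \<and> real p \<le> z \<and> real p > sqrt z}"
  have lz: "ln z > 0" using assms by simp
  have A: "?A = {p. prime p \<and> p \<le> nat \<lfloor>z\<rfloor>}" using assms by (auto simp: le_nat_floor) linarith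
  have fA: "finite ?A" unfolding A by simp
  have fB: "finite ?B" by (rule finite_subset[OF _ fA]) auto
  have "?A \<subseteq> {1..nat \<lfloor>sqrt z\<rfloor>} \<union> ?B"
  proof
    fix p assume p: "p \<in> ?A"
    show "p \<in> {1..nat \<lfloor>sqrt z\<rfloor>} \<union> ?B"
      using p prime_ge_1_nat[of p] by (cases "real p \<le> sqrt z") (auto simp: le_nat_floor)
  qed
  then have "card ?A \<le> card ({1..nat \<lfloor>sqrt z\<rfloor>} \<union> ?B)" using fB by (intro card_mono) auto
  also have "\<dots> \<le> nat \<lfloor>sqrt z\<rfloor> + card ?B" using card_Un_le[of "{1..nat \<lfloor>sqrt z\<rfloor>}" ?B] by simp
  finally have "real (card ?A) \<le> real (nat \<lfloor>sqrt z\<rfloor>) + real (card ?B)" by linarith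
  moreover have "real (nat \<lfloor>sqrt z\<rfloor>) \<le> sqrt z" using assms by simp
  moreover have "sqrt z \<le> 2 * z / ln z"
  proof -
    have "sqrt z * ln z \<le> sqrt z * (2 * sqrt z)" using assms by (intro mult_left_mono ln_le_2_sqrt) auto
    also have "\<dots> = 2 * z" using assms by simp
    finally show ?thesis using lz by (simp add: pos_le_divide_eq)
  qed
  moreover have "real (card ?B) \<le> 4 * z / ln z"
  proof -
    have "real (card ?B) * (ln z / 2) = (\<Sum>p\<in>?B. ln z / 2)" by simp
    also have "\<dots> \<le> (\<Sum>p\<in>?B. ln (real p))"
    proof (rule sum_mono)
      fix p assume "p \<in> ?B"
      then have "ln (sqrt z) \<le> ln (real p)" using assms by (subst ln_le_cancel_iff) (auto simp: prime_gt_0_nat)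
      then show "ln z / 2 \<le> ln (real p)" using assms by (simp add: ln_sqrt)
    qed
    also have "\<dots> \<le> (\<Sum>p\<in>?A. ln (real p))" using fA prime_ge_1_nat by (intro sum_mono2) auto
    also have "\<dots> \<le> 2 * real (nat \<lfloor>z\<rfloor>)" unfolding A by (rule chebyshev_theta_2)
    also have "\<dots> \<le> 2 * z" using assms by simp
    finally show ?thesis using lz by (simp add: field_simps)
  qed
  ultimately have "real (card ?A) \<le> 2 * z / ln z + 4 * z / ln z" by linarith
  then show ?thesis by (simp add: add_divide_distrib[symmetric])
qed

section \<open>Weighted sums over primes, by repeated halving instead of partial summation\<close>

lemma sum_primes_upper_half:
  fixes \<kappa> :: real
  assumes "\<kappa> \<ge> 0" "n \<ge> 2"
  shows "(\<Sum>p | prime p \<and> n div 2 < p \<and> p \<le> n. ln (real p) / real p * real p powr \<kappa>) \<le> 4 * real n powr \<kappa>"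
proof -
  let ?B = "{p::nat. prime p \<and> n div 2 < p \<and> p \<le> n}"
  have "(\<Sum>p\<in>?B. ln (real p) / real p * real p powr \<kappa>) \<le> (\<Sum>p\<in>?B. ln (real p) * (2 / real n * real n powr \<kappa>))"
  proof (rule sum_mono)
    fix p assume p: "p \<in> ?B"
    have "1 / real p \<le> 2 / real n" using p assms by (auto simp: field_simps)
    moreover have "real p powr \<kappa> \<le> real n powr \<kappa>" using p assms by (intro powr_mono2) auto
    ultimately have "1 / real p * real p powr \<kappa> \<le> 2 / real n * real n powr \<kappa>" by (intro mult_mono) auto
    then have "ln (real p) * (1 / real p * real p powr \<kappa>) \<le> ln (real p) * (2 / real n * real n powr \<kappa>)"
      using p prime_ge_1_nat by (intro mult_left_mono) auto
    then show "ln (real p) / real p * real p powr \<kappa> \<le> ln (real p) * (2 / real n * real n powr \<kappa>)" by simp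
  qed
  also have "\<dots> = (\<Sum>p\<in>?B. ln (real p)) * (2 / real n * real n powr \<kappa>)" by (rule sum_distrib_right[symmetric])
  also have "\<dots> \<le> (2 * real n) * (2 / real n * real n powr \<kappa>)"
  proof (rule mult_right_mono)
    have "(\<Sum>p\<in>?B. ln (real p)) \<le> (\<Sum>p | prime p \<and> p \<le> n. ln (real p))"
      using prime_ge_1_nat by (intro sum_mono2) auto
    then show "(\<Sum>p\<in>?B. ln (real p)) \<le> 2 * real n" using chebyshev_theta_2[of n] by linarith
  qed auto
  also have "\<dots> = 4 * real n powr \<kappa>" using assms by simp
  finally show ?thesis .
qed

lemma primes_le_split_half:
  fixes f :: "nat \<Rightarrow> real"
  shows "(\<Sum>p | prime p \<and> p \<le> n. f p) =
    (\<Sum>p | prime p \<and> p \<le> n div 2. f p) + (\<Sum>p | prime p \<and> n div 2 < p \<and> p \<le> n. f p)"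
proof -
  have "{p. prime p \<and> p \<le> n} = {p. prime p \<and> p \<le> n div 2} \<union> {p. prime p \<and> n div 2 < p \<and> p \<le> n}" by auto
  moreover have "finite {p. prime p \<and> n div 2 < p \<and> p \<le> n}" by (rule finite_subset[of _ "{..n}"]) auto
  ultimately show ?thesis by (simp add: sum.union_disjoint disjoint_iff)
qed

lemma half_le_ln_2: "1 / 2 \<le> ln (2::real)"
  using ln_ge_iff[of 2 "1/2"] exp_half_le2 by simp

lemma sum_primes_log_over_p:
  "n \<ge> 1 \<Longrightarrow> (\<Sum>p | prime p \<and> p \<le> n. ln (real p) / real p) \<le> 8 * (1 + ln (real n))"
proof (induction n rule: less_induct)
  case (less n)
  show ?case
  proof (cases "n < 2")
    case True
    then show ?thesis using less.prems by (simp only: no_primes_le_1) simp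
  next
    case False
    have "(\<Sum>p | prime p \<and> p \<le> n. ln (real p) / real p) \<le> 8 * (1 + ln (real (n div 2))) + 4"
    proof -
      have "(\<Sum>p | prime p \<and> n div 2 < p \<and> p \<le> n. ln (real p) / real p)
          = (\<Sum>p | prime p \<and> n div 2 < p \<and> p \<le> n. ln (real p) / real p * real p powr 0)"
        by (intro sum.cong) (auto simp: prime_gt_0_nat)
      also have "\<dots> \<le> 4" using sum_primes_upper_half[of 0 n] False by simp
      finally show ?thesis
        using less.IH[of "n div 2"] False by (subst primes_le_split_half) linarith
    qed
    also have "ln (real (n div 2)) \<le> ln (real n / 2)" using False by (subst ln_le_cancel_iff) auto
    also have "ln (real n / 2) = ln (real n) - ln 2" using False by (simp add: ln_div)
    finally show ?thesis using half_le_ln_2 by (simp add: algebra_simps)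
  qed
qed

text \<open>The blocks \<open>(n / 2, n]\<close> form a geometric series with ratio
  \<open>2 powr (- \<kappa>)\<close>, whose sum is of order \<open>1 + 1 / \<kappa>\<close>.
  Uniformity in \<open>\<kappa>\<close> matters: in Buchstab's recursion \<open>\<kappa>\<close>
  varies with \<open>w\<close> and \<open>q\<close>.\<close>

lemma sum_primes_log_over_p_powr:
  fixes \<kappa> :: real
  assumes "\<kappa> > 0"
  shows "(\<Sum>p | prime p \<and> p \<le> n. ln (real p) / real p * real p powr \<kappa>) \<le> 8 * (1 + 1 / \<kappa>) * real n powr \<kappa>"
proof (induction n rule: less_induct)
  case (less n)
  show ?case
  proof (cases "n < 2")
    case True
    then show ?thesis using assms by (simp only: no_primes_le_1) simp
  next
    case False
    have "(\<Sum>p | prime p \<and> p \<le> n. ln (real p) / real p * real p powr \<kappa>)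
        \<le> 8 * (1 + 1 / \<kappa>) * real (n div 2) powr \<kappa> + 4 * real n powr \<kappa>"
      using less.IH[of "n div 2"] False sum_primes_upper_half[of \<kappa> n] assms
      by (subst primes_le_split_half) auto
    also have "real (n div 2) powr \<kappa> \<le> (real n / 2) powr \<kappa>" using False assms by (intro powr_mono2) auto
    also have "(real n / 2) powr \<kappa> = real n powr \<kappa> * 2 powr (-\<kappa>)"
      by (simp add: powr_divide powr_minus_divide)
    also have "8 * (1 + 1 / \<kappa>) * (real n powr \<kappa> * 2 powr (-\<kappa>)) + 4 * real n powr \<kappa>
        = (8 * (1 + 1 / \<kappa>) * 2 powr (-\<kappa>) + 4) * real n powr \<kappa>" by (simp add: algebra_simps)
    also have "\<dots> \<le> (8 * (1 + 1 / \<kappa>)) * real n powr \<kappa>"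
    proof (rule mult_right_mono)
      \<comment> \<open>Halving \<open>n\<close> thus lowers the constant
        \<open>8 * (1 + 1 / \<kappa>)\<close> by at least 4, exactly the price of the top
        block.\<close>
      have "1 + \<kappa> / 2 \<le> 1 + \<kappa> * ln 2" using half_le_ln_2 assms by simp
      also have "\<dots> \<le> 2 powr \<kappa>" using exp_ge_add_one_self[of "\<kappa> * ln 2"] by (simp add: powr_def)
      finally have "2 powr (-\<kappa>) \<le> 1 / (1 + \<kappa> / 2)"
        using assms by (simp add: powr_minus_divide divide_left_mono field_simps)
      then have "8 * (1 + 1 / \<kappa>) * 2 powr (-\<kappa>) \<le> 8 * (1 + 1 / \<kappa>) * (1 / (1 + \<kappa> / 2))"
        using assms by (intro mult_left_mono) auto
      also have "\<dots> = 8 * (1 + 1 / \<kappa>) - 4 * (1 + \<kappa>) / (1 + \<kappa> / 2)"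
        using assms by (simp add: divide_simps) (simp add: algebra_simps)
      also have "\<dots> \<le> 8 * (1 + 1 / \<kappa>) - 4"
      proof -
        have "4 \<le> 4 * (1 + \<kappa>) / (1 + \<kappa> / 2)" using assms by (subst pos_le_divide_eq) auto
        then show ?thesis by linarith
      qed
      finally show "8 * (1 + 1 / \<kappa>) * 2 powr (-\<kappa>) + 4 \<le> 8 * (1 + 1 / \<kappa>)" by simp
    qed auto
    finally show ?thesis using assms by (simp add: mult_left_mono)
  qed
qed

text \<open>Up to the threshold \<open>D\<close> the first term suffices, beyond it the second. The
  point is the small coefficient \<open>1 / D\<close> of \<open>s * exp s\<close>, bought with a
  large multiple of \<open>s\<close> that is harmless after summation.\<close>

lemma exp_minus_one_le_split:
  fixes s D :: real
  assumes "s \<ge> 0" "D > 0"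
  shows "exp s - 1 \<le> s * exp D + s / D * exp s"
proof (cases "s \<le> D")
  case True
  have "1 - s \<le> exp (- s)" using exp_ge_add_one_self[of "-s"] by simp
  then have "(1 - s) * exp s \<le> exp (- s) * exp s" by (intro mult_right_mono) auto
  then have "exp s - 1 \<le> s * exp s" by (simp add: algebra_simps flip: exp_add)
  also have "\<dots> \<le> s * exp D" using True assms by (intro mult_left_mono) auto
  finally show ?thesis using assms by (simp add: add_increasing2)
next
  case False
  then have "1 * exp s \<le> s / D * exp s" using assms by (intro mult_right_mono) auto
  moreover have "s * exp D \<ge> 0" using assms by simp
  ultimately show ?thesis by simp
qed

text \<open>With \<open>s = \<alpha> * ln p\<close> in the preceding split, the first part sums to
  \<open>O(exp D * (1 + \<alpha> * ln q))\<close>, negligible against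
  \<open>q powr \<alpha>\<close>, and the second to at most \<open>16 / D * q powr \<alpha>\<close>;
  the factor \<open>1 / \<kappa>\<close> of the power sum cancels against
  \<open>\<alpha>\<close>.\<close>

lemma sum_primes_powr_minus_one:
  fixes \<eta> :: real
  assumes "\<eta> > 0"
  shows "\<exists>C. \<forall>q::nat. \<forall>\<alpha>::real. 2 \<le> q \<longrightarrow> 0 \<le> \<alpha> \<longrightarrow> \<alpha> \<le> 1 \<longrightarrow>
    (\<Sum>p | prime p \<and> p < q. (real p powr \<alpha> - 1) / real p) \<le> \<eta> * real q powr \<alpha> + C"
proof -
  \<comment> \<open>Makes \<open>16 / D = \<eta> / 2\<close>; the other half of
    \<open>\<eta>\<close> absorbs the linear part.\<close>
  define D where "D = 32 / \<eta>"
  have D: "D > 0" using assms by (simp add: D_def)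
  have "eventually (\<lambda>t::real. 8 * exp D * (1 + t) \<le> \<eta> / 2 * exp t) at_top"
    using assms by real_asymp
  then obtain t0 where t0: "\<And>t. t \<ge> t0 \<Longrightarrow> 8 * exp D * (1 + t) \<le> \<eta> / 2 * exp t"
    by (auto simp: eventually_at_top_linorder)
  define C where "C = 8 * exp D * (1 + max t0 0)"
  have C: "8 * exp D * (1 + t) \<le> \<eta> / 2 * exp t + C" if "t \<ge> 0" for t :: real
  proof (cases "t \<ge> t0")
    case True
    moreover have "C \<ge> 0" unfolding C_def by simp
    ultimately show ?thesis using t0[OF True] by linarith
  next
    case False
    then have "8 * exp D * (1 + t) \<le> C" unfolding C_def by (intro mult_left_mono) auto
    then show ?thesis using assms by (simp add: add_increasing)
  qed
  have "(\<Sum>p | prime p \<and> p < q. (real p powr \<alpha> - 1) / real p) \<le> \<eta> * real q powr \<alpha> + C"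
    if q: "2 \<le> q" and a: "0 \<le> \<alpha>" "\<alpha> \<le> 1" for q :: nat and \<alpha> :: real
  proof (cases "\<alpha> = 0")
    case True
    have "(\<Sum>p | prime p \<and> p < q. (real p powr \<alpha> - 1) / real p) = 0"
      using True by (intro sum.neutral) (auto simp: prime_gt_0_nat)
    then show ?thesis using assms q by (simp add: True C_def)
  next
    case False
    then have a0: "\<alpha> > 0" using a by simp
    let ?P = "{p. prime p \<and> p \<le> q}"
    have "(\<Sum>p | prime p \<and> p < q. (real p powr \<alpha> - 1) / real p) \<le> (\<Sum>p\<in>?P. (real p powr \<alpha> - 1) / real p)"
      using a prime_ge_1_nat by (intro sum_mono2) (auto intro!: divide_nonneg_nonneg ge_one_powr_ge_zero)
    also have "\<dots> \<le> (\<Sum>p\<in>?P. \<alpha> * exp D * (ln (real p) / real p)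
        + \<alpha> / D * (ln (real p) / real p * real p powr \<alpha>))"
    proof (rule sum_mono)
      fix p assume "p \<in> ?P"
      then have p: "p \<ge> 2" by (auto dest: prime_ge_2_nat)
      have "real p powr \<alpha> = exp (\<alpha> * ln (real p))" using p by (simp add: powr_def)
      moreover have "\<alpha> * ln (real p) \<ge> 0" using p a by simp
      ultimately have "real p powr \<alpha> - 1 \<le> \<alpha> * ln (real p) * exp D + \<alpha> * ln (real p) / D * real p powr \<alpha>"
        using exp_minus_one_le_split[of "\<alpha> * ln (real p)" D] D by simp
      then have "(real p powr \<alpha> - 1) / real p \<le> (\<alpha> * ln (real p) * exp D + \<alpha> * ln (real p) / D * real p powr \<alpha>) / real p"
        by (rule divide_right_mono) simp
      then show "(real p powr \<alpha> - 1) / real p \<le> \<alpha> * exp D * (ln (real p) / real p)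
        + \<alpha> / D * (ln (real p) / real p * real p powr \<alpha>)" by (simp add: add_divide_distrib mult.commute mult.left_commute)
    qed
    also have "\<dots> = \<alpha> * exp D * (\<Sum>p\<in>?P. ln (real p) / real p)
        + \<alpha> / D * (\<Sum>p\<in>?P. ln (real p) / real p * real p powr \<alpha>)"
      by (simp add: sum.distrib sum_distrib_left)
    also have "\<dots> \<le> \<alpha> * exp D * (8 * (1 + ln (real q))) + \<alpha> / D * (8 * (1 + 1 / \<alpha>) * real q powr \<alpha>)"
      using a a0 D q sum_primes_log_over_p[of q] sum_primes_log_over_p_powr[of \<alpha> q]
      by (intro add_mono mult_left_mono) auto
    also have "\<alpha> * exp D * (8 * (1 + ln (real q))) \<le> 8 * exp D * (1 + \<alpha> * ln (real q))"
      using a by (simp add: algebra_simps)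
    also have "\<dots> \<le> \<eta> / 2 * exp (\<alpha> * ln (real q)) + C" using a q by (intro C) auto
    also have "exp (\<alpha> * ln (real q)) = real q powr \<alpha>" using q by (simp add: powr_def)
    also have "\<alpha> / D * (8 * (1 + 1 / \<alpha>) * real q powr \<alpha>) = 8 * (\<alpha> + 1) / D * real q powr \<alpha>"
    proof -
      have "\<alpha> * (1 + 1 / \<alpha>) = \<alpha> + 1" using a0 by (simp add: distrib_left)
      then have "8 * (\<alpha> * (1 + 1 / \<alpha>)) / D * real q powr \<alpha> = 8 * (\<alpha> + 1) / D * real q powr \<alpha>" by simp
      then show ?thesis by (simp only: mult_ac times_divide_eq_right times_divide_eq_left)
    qed
    also have "8 * (\<alpha> + 1) / D * real q powr \<alpha> \<le> 16 / D * real q powr \<alpha>"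
      using a D by (intro mult_right_mono divide_right_mono) auto
    also have "16 / D = \<eta> / 2" using assms by (simp add: D_def)
    finally show ?thesis by (simp add: algebra_simps)
  qed
  then show ?thesis by blast
qed

section \<open>Sifting by small primes\<close>

definition rough :: "nat \<Rightarrow> nat \<Rightarrow> bool" where
  "rough q n \<longleftrightarrow> (\<forall>p. prime p \<and> p < q \<longrightarrow> \<not> p dvd n)"

definition rough_count :: "real \<Rightarrow> nat \<Rightarrow> nat" where
  "rough_count z q = card {n::nat. 1 \<le> n \<and> real n \<le> z \<and> rough q n}"

definition mertens_prod :: "nat \<Rightarrow> real" where
  "mertens_prod q = (\<Prod>p | prime p \<and> p < q. 1 - 1 / real p)"

definition sieve_error :: "real \<Rightarrow> nat \<Rightarrow> real" where
  "sieve_error z q = real (rough_count z q) - z * mertens_prod q"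

lemma finite_nat_le_real [simp]: "finite {n::nat. Suc 0 \<le> n \<and> real n \<le> z \<and> P n}"
  by (rule finite_subset[of _ "{..nat \<lfloor>z\<rfloor>}"]) (auto simp: le_nat_floor)

lemma primes_less_Suc:
  "{p. prime p \<and> p < Suc q} = (if prime q then insert q {p. prime p \<and> p < q} else {p. prime p \<and> p < q})"
  by (auto simp: less_Suc_eq)

lemma rough_Suc: "rough (Suc q) n \<longleftrightarrow> rough q n \<and> (prime q \<longrightarrow> \<not> q dvd n)"
  by (auto simp: rough_def less_Suc_eq)

lemma rough_prime_mult:
  assumes "prime q"
  shows "rough q (q * n) \<longleftrightarrow> rough q n"
  using assms by (auto simp: rough_def prime_dvd_mult_iff dest: primes_dvd_imp_eq)

lemma rough_count_Suc_prime:
  assumes "prime q"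
  shows "rough_count z q = rough_count z (Suc q) + rough_count (z / real q) q"
proof -
  have q: "q > 0" using assms by (rule prime_gt_0_nat)
  have "{n::nat. 1 \<le> n \<and> real n \<le> z \<and> rough q n} =
      {n. 1 \<le> n \<and> real n \<le> z \<and> rough (Suc q) n}
      \<union> (\<lambda>n. q * n) ` {n. 1 \<le> n \<and> real n \<le> z / real q \<and> rough q n}" (is "?A = ?B \<union> ?f ` ?C")
  proof (intro equalityI subsetI)
    fix n assume n: "n \<in> ?A"
    show "n \<in> ?B \<union> ?f ` ?C"
    proof (cases "q dvd n")
      case True
      then obtain k where k: "n = q * k" by auto
      then have "k \<in> ?C"
        using n q assms by (auto simp: rough_prime_mult pos_le_divide_eq mult.commute[of "real q"])
      then show ?thesis using k by blast
    qed (use n in \<open>auto simp: rough_Suc\<close>)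
  qed (use q assms in \<open>auto simp: rough_Suc rough_prime_mult pos_le_divide_eq mult.commute[of "real q"]\<close>)
  moreover have "?B \<inter> ?f ` ?C = {}" using assms by (auto simp: rough_Suc)
  ultimately have "card ?A = card ?B + card (?f ` ?C)"
    by (simp add: card_Un_disjoint)
  also have "card (?f ` ?C) = card ?C" using q by (intro card_image) (auto simp: inj_on_def)
  finally show ?thesis by (simp add: rough_count_def)
qed

lemma rough_count_Suc_nonprime: "\<not> prime q \<Longrightarrow> rough_count z (Suc q) = rough_count z q"
  by (simp add: rough_count_def rough_Suc)

lemma mertens_prod_Suc_prime: "prime q \<Longrightarrow> mertens_prod (Suc q) = mertens_prod q * (1 - 1 / real q)"
  by (simp add: mertens_prod_def primes_less_Suc)

lemma mertens_prod_Suc_nonprime: "\<not> prime q \<Longrightarrow> mertens_prod (Suc q) = mertens_prod q"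
  by (simp add: mertens_prod_def primes_less_Suc)

lemma mertens_prod_pos: "mertens_prod q > 0"
  unfolding mertens_prod_def by (intro prod_pos) (auto dest: prime_gt_1_nat)

lemma sieve_error_Suc_prime:
  "prime q \<Longrightarrow> sieve_error z (Suc q) = sieve_error z q - sieve_error (z / real q) q"
  by (simp add: sieve_error_def mertens_prod_Suc_prime rough_count_Suc_prime[of q z] algebra_simps)

lemma sieve_error_Suc_nonprime: "\<not> prime q \<Longrightarrow> sieve_error z (Suc q) = sieve_error z q"
  by (simp add: sieve_error_def mertens_prod_Suc_nonprime rough_count_Suc_nonprime)

lemma rough_0: "rough 0 n"
  by (simp add: rough_def)

lemma sieve_error_0:
  assumes "z \<ge> 0"
  shows "sieve_error z 0 = of_int \<lfloor>z\<rfloor> - z"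
proof -
  have "{n::nat. 1 \<le> n \<and> real n \<le> z} = {1..nat \<lfloor>z\<rfloor>}"
    using assms by (auto simp: le_nat_floor) linarith
  then show ?thesis using assms by (simp add: sieve_error_def rough_count_def rough_0 mertens_prod_def)
qed

text \<open>Legendre's formula with every fractional part \<open>{z/d}\<close> bounded by \<open>(z/d)\<^sup>a\<close>.\<close>

lemma sieve_error_rankin:
  assumes "0 \<le> a" "a \<le> 1" "z > 0"
  shows "\<bar>sieve_error z q\<bar> \<le> z powr a * (\<Prod>p | prime p \<and> p < q. 1 + real p powr (-a))"
  using assms(3)
proof (induction q arbitrary: z)
  case 0
  have "\<bar>of_int \<lfloor>z\<rfloor> - z\<bar> \<le> z powr a"
  proof (cases "z < 1")
    case True
    then have "\<lfloor>z\<rfloor> = 0" using 0 by (simp add: floor_eq_iff)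
    moreover have "z powr 1 \<le> z powr a" using True 0 assms by (intro powr_mono') auto
    ultimately show ?thesis using 0 by simp
  next
    case False
    have "\<bar>of_int \<lfloor>z\<rfloor> - z\<bar> \<le> 1" by linarith
    also have "1 \<le> z powr a" using False assms by (intro ge_one_powr_ge_zero) auto
    finally show ?thesis .
  qed
  then show ?case using 0 by (simp add: sieve_error_0)
next
  case (Suc q)
  show ?case
  proof (cases "prime q")
    case True
    let ?P = "\<Prod>p | prime p \<and> p < q. 1 + real p powr (-a)"
    have q: "real q > 0" using True prime_gt_0_nat by simp
    have "\<bar>sieve_error z (Suc q)\<bar> \<le> \<bar>sieve_error z q\<bar> + \<bar>sieve_error (z / real q) q\<bar>"
      using True by (simp add: sieve_error_Suc_prime)
    also have "\<dots> \<le> z powr a * ?P + (z / real q) powr a * ?P"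
      using Suc.prems q by (intro add_mono Suc.IH) auto
    also have "(z / real q) powr a = z powr a * real q powr (-a)"
      using Suc.prems q by (simp add: powr_divide powr_minus_divide)
    finally show ?thesis using True by (simp add: primes_less_Suc algebra_simps)
  next
    case False
    then show ?thesis using Suc by (simp add: sieve_error_Suc_nonprime primes_less_Suc)
  qed
qed

lemma sieve_error_buchstab:
  assumes "z \<ge> 0"
  shows "sieve_error z q = (of_int \<lfloor>z\<rfloor> - z) - (\<Sum>p | prime p \<and> p < q. sieve_error (z / real p) p)"
proof (induction q)
  case (Suc q)
  then show ?case
    by (cases "prime q") (simp_all add: sieve_error_Suc_prime sieve_error_Suc_nonprime primes_less_Suc)
qed (use assms in \<open>simp add: sieve_error_0\<close>)

section \<open>A crude upper bound sieve\<close>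

lemma rough_count_recursion:
  "rough_count z q \<le> 1 + (\<Sum>p | prime p \<and> q \<le> p \<and> real p \<le> z. rough_count (z / real p) q)"
proof -
  let ?P = "{p. prime p \<and> q \<le> p \<and> real p \<le> z}"
  let ?S = "\<lambda>z. {n::nat. 1 \<le> n \<and> real n \<le> z \<and> rough q n}"
  have fP: "finite ?P" by (rule finite_subset[of _ "{..nat \<lfloor>z\<rfloor>}"]) (auto simp: le_nat_floor)
  have "?S z \<subseteq> {1} \<union> (\<Union>p\<in>?P. (\<lambda>n. p * n) ` ?S (z / real p))"
  proof
    fix n assume n: "n \<in> ?S z"
    show "n \<in> {1} \<union> (\<Union>p\<in>?P. (\<lambda>n. p * n) ` ?S (z / real p))"
    proof (cases "n = 1")
      case False
      then obtain p where p: "prime p" "p dvd n" using prime_factor_nat by blast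
      then obtain k where k: "n = p * k" by auto
      have p0: "p > 0" using p prime_gt_0_nat by auto
      have "p \<le> n" using n p by (intro dvd_imp_le) auto
      then have "real p \<le> z" using n by simp
      moreover have "q \<le> p" using n p by (auto simp: rough_def not_less[symmetric])
      ultimately have "p \<in> ?P" using p by simp
      moreover have "k \<in> ?S (z / real p)" using n p0 by (auto simp: k rough_def field_simps)
      ultimately show ?thesis using k by blast
    qed simp
  qed
  then have "card (?S z) \<le> card ({1} \<union> (\<Union>p\<in>?P. (\<lambda>n. p * n) ` ?S (z / real p)))"
    using fP by (intro card_mono) auto
  also have "\<dots> \<le> card {1::nat} + card (\<Union>p\<in>?P. (\<lambda>n. p * n) ` ?S (z / real p))" by (rule card_Un_le)
  also have "card (\<Union>p\<in>?P. (\<lambda>n. p * n) ` ?S (z / real p)) \<le> (\<Sum>p\<in>?P. card ((\<lambda>n. p * n) ` ?S (z / real p)))"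
    using fP by (rule card_UN_le)
  also have "\<dots> \<le> (\<Sum>p\<in>?P. card (?S (z / real p)))" by (intro sum_mono card_image_le) auto
  finally show ?thesis by (simp add: rough_count_def)
qed

text \<open>A rough \<open>n > 1\<close> loses some prime factor \<open>p \<ge> q\<close>, not
  necessarily the least. The overcounting is harmless, and the sifting limit stays \<open>q\<close>
  while \<open>z\<close> drops below \<open>q ^ j\<close>, so induction on \<open>j\<close> works.
  The constant grows quickly with \<open>j\<close>, but only one fixed \<open>j\<close> is ever
  used.\<close>

lemma rough_count_upper:
  "\<exists>C\<ge>0. \<forall>q z. 2 \<le> q \<longrightarrow> 1 \<le> z \<longrightarrow> z \<le> real q ^ j \<longrightarrow> real (rough_count z q) \<le> 1 + C * z / ln (real q)"
proof (induction j)
  case 0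
  have "real (rough_count z q) \<le> 1" if "1 \<le> z" "z \<le> real q ^ 0" for z q
  proof -
    have "{n::nat. 1 \<le> n \<and> real n \<le> z \<and> rough q n} \<subseteq> {1}" using that by auto
    then have "rough_count z q \<le> card {1::nat}" unfolding rough_count_def by (intro card_mono) auto
    then show ?thesis by simp
  qed
  then show ?case by (intro exI[of _ 0]) auto
next
  case (Suc j)
  then obtain C where C: "C \<ge> 0" and
    IH: "\<And>q z. 2 \<le> q \<Longrightarrow> 1 \<le> z \<Longrightarrow> z \<le> real q ^ j \<Longrightarrow> real (rough_count z q) \<le> 1 + C * z / ln (real q)"
    by blast
  define C' where "C' = 6 + C * (8 * (2 + real (Suc j)))"
  have C': "C' \<ge> 0" using C by (simp add: C'_def)
  have "real (rough_count z q) \<le> 1 + C' * z / ln (real q)"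
    if q: "2 \<le> q" and z: "1 \<le> z" "z \<le> real q ^ Suc j" for q z
  proof -
    let ?P = "{p. prime p \<and> q \<le> p \<and> real p \<le> z}"
    have lq: "ln (real q) > 0" "ln (real q) \<ge> 1 / 2"
      using q half_le_ln_2 ln_mono[of 2 "real q"] by (simp, linarith)
    have fP: "finite ?P" by (rule finite_subset[of _ "{..nat \<lfloor>z\<rfloor>}"]) (auto simp: le_nat_floor)
    have "real (rough_count z q) \<le> 1 + (\<Sum>p\<in>?P. real (rough_count (z / real p) q))"
      using rough_count_recursion[of z q] by (simp flip: of_nat_sum of_nat_Suc)
    also have "(\<Sum>p\<in>?P. real (rough_count (z / real p) q)) \<le> (\<Sum>p\<in>?P. 1 + C * (z / real p) / ln (real q))"
    proof (intro sum_mono IH q)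
      fix p assume p: "p \<in> ?P"
      then have p0: "real p > 0" using prime_gt_0_nat by auto
      show "1 \<le> z / real p" using p p0 by (simp add: field_simps)
      have "z / real p \<le> real q ^ Suc j / real q"
        using p z q by (intro frac_le) auto
      then show "z / real p \<le> real q ^ j" using q by simp
    qed
    also have "\<dots> = real (card ?P) + C * z / ln (real q) * (\<Sum>p\<in>?P. 1 / real p)"
      by (simp add: sum.distrib sum_distrib_left mult.commute)
    also have "real (card ?P) \<le> 6 * z / ln (real q)"
    proof (cases "z < real q")
      case True
      then have "?P = {}" by auto
      then show ?thesis using lq z by (simp only:) simp
    next
      case False
      then have z2: "z \<ge> 2" using q by linarith
      have "finite {p::nat. prime p \<and> real p \<le> z}"
        by (rule finite_subset[of _ "{..nat \<lfloor>z\<rfloor>}"]) (auto simp: le_nat_floor)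
      then have "real (card ?P) \<le> real (card {p::nat. prime p \<and> real p \<le> z})"
        by (intro of_nat_mono card_mono) auto
      also have "\<dots> \<le> 6 * z / ln z" by (rule card_primes_le_bound[OF z2])
      also have "\<dots> \<le> 6 * z / ln (real q)" using False q lq by (intro divide_left_mono) auto
      finally show ?thesis .
    qed
    finally have F: "real (rough_count z q) \<le> 1 + (6 * z / ln (real q) + C * z / ln (real q) * (\<Sum>p\<in>?P. 1 / real p))"
      by simp
    \<comment> \<open>Since \<open>p \<ge> q\<close>, the bound
      \<open>1 / p \<le> ln p / (p * ln q)\<close> reduces this to the logarithmic sum up to
      \<open>z\<close>, of size \<open>O(j * ln q)\<close>.\<close>
    have "(\<Sum>p\<in>?P. 1 / real p) \<le> 8 * (2 + real (Suc j))"
    proof -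
      have zf: "nat \<lfloor>z\<rfloor> \<ge> 1" using z by (simp add: le_nat_floor)
      have "ln (real q) * (\<Sum>p\<in>?P. 1 / real p) \<le> (\<Sum>p\<in>?P. ln (real p) / real p)"
        unfolding sum_distrib_left using q by (intro sum_mono) (auto intro!: divide_right_mono)
      also have "\<dots> \<le> (\<Sum>p | prime p \<and> p \<le> nat \<lfloor>z\<rfloor>. ln (real p) / real p)"
        using prime_ge_1_nat by (intro sum_mono2) (auto simp: le_nat_floor)
      also have "\<dots> \<le> 8 * (1 + ln (real (nat \<lfloor>z\<rfloor>)))" by (rule sum_primes_log_over_p[OF zf])
      also have "ln (real (nat \<lfloor>z\<rfloor>)) \<le> ln z" using z zf by (subst ln_le_cancel_iff) auto
      also have "ln z \<le> ln (real q ^ Suc j)" using z q by (subst ln_le_cancel_iff) auto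
      also have "\<dots> = real (Suc j) * ln (real q)" using q by (subst ln_realpow) auto
      also have "8 * (1 + real (Suc j) * ln (real q)) \<le> 8 * (2 * ln (real q) + real (Suc j) * ln (real q))"
        using lq by simp
      also have "\<dots> = ln (real q) * (8 * (2 + real (Suc j)))" by (simp add: algebra_simps)
      finally show ?thesis using lq by simp
    qed
    then have "C * z / ln (real q) * (\<Sum>p\<in>?P. 1 / real p) \<le> C * z / ln (real q) * (8 * (2 + real (Suc j)))"
      using C z lq by (intro mult_left_mono) auto
    with F have "real (rough_count z q) \<le> 1 + (6 * z / ln (real q) + C * z / ln (real q) * (8 * (2 + real (Suc j))))"
      by linarith
    also have "\<dots> = 1 + C' * z / ln (real q)" by (simp add: C'_def add_divide_distrib algebra_simps)
    finally show ?thesis .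
  qed
  then show ?case using C' by blast
qed

section \<open>Independent geometric exponents\<close>

text \<open>Kubilius's model: exponent \<open>k\<close> at \<open>p\<close> has mass
  \<open>(1 - 1 / p) / p ^ k\<close>, the density of the integers exactly divisible by
  \<open>p ^ k\<close>. The default value 0 agrees with \<open>valuation_vector\<close>, so that
  both laws live on the same functions.\<close>

definition prime_model :: "nat \<Rightarrow> (nat \<Rightarrow> nat) pmf" where
  "prime_model q = Pi_pmf {p. prime p \<and> p < q} 0 (\<lambda>p. geometric_pmf (1 - 1 / real p))"

definition smooth_number :: "nat \<Rightarrow> (nat \<Rightarrow> nat) \<Rightarrow> nat" where
  "smooth_number q a = (\<Prod>p | prime p \<and> p < q. p ^ a p)"

definition valuation_vector :: "nat set \<Rightarrow> nat \<Rightarrow> nat \<Rightarrow> nat" where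
  "valuation_vector S n = (\<lambda>p. if p \<in> S then multiplicity p n else 0)"

lemma smooth_number_pos: "smooth_number q a > 0"
  unfolding smooth_number_def by (intro prod_pos) (auto simp: prime_gt_0_nat)

lemma multiplicity_smooth_number:
  "prime p \<Longrightarrow> multiplicity p (smooth_number q a) = (if p < q then a p else 0)"
  unfolding smooth_number_def by (subst multiplicity_prod_prime_powers) auto

lemma pmf_prime_model:
  assumes "\<And>p. \<not> (prime p \<and> p < q) \<Longrightarrow> a p = 0"
  shows "pmf (prime_model q) a = mertens_prod q / real (smooth_number q a)"
proof -
  have "pmf (prime_model q) a = (\<Prod>p | prime p \<and> p < q. pmf (geometric_pmf (1 - 1 / real p)) (a p))"
    unfolding prime_model_def using assms by (intro pmf_Pi') auto
  also have "\<dots> = (\<Prod>p | prime p \<and> p < q. (1 - 1 / real p) / real (p ^ a p))"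
  proof (intro prod.cong refl)
    fix p assume "p \<in> {p. prime p \<and> p < q}"
    then have "p > 1" using prime_gt_1_nat by blast
    then show "pmf (geometric_pmf (1 - 1 / real p)) (a p) = (1 - 1 / real p) / real (p ^ a p)"
      by (subst pmf_geometric) (auto simp: power_divide)
  qed
  also have "\<dots> = mertens_prod q / real (smooth_number q a)"
    by (simp add: mertens_prod_def smooth_number_def prod_dividef)
  finally show ?thesis .
qed

lemma set_prime_model: "a \<in> set_pmf (prime_model q) \<Longrightarrow> \<not> (prime p \<and> p < q) \<Longrightarrow> a p = 0"
  unfolding prime_model_def using set_Pi_pmf_subset[of "{p. prime p \<and> p < q}" 0] by auto

section \<open>Moments of the smooth number\<close>

lemma nn_integral_geometric_power:
  fixes s r :: real
  assumes "0 < s" "s \<le> 1" "0 \<le> r" "(1 - s) * r < 1"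
  shows "(\<integral>\<^sup>+n. ennreal (r ^ n) \<partial>measure_pmf (geometric_pmf s)) = ennreal (s / (1 - (1 - s) * r))"
proof -
  have "(\<integral>\<^sup>+n. ennreal (r ^ n) \<partial>measure_pmf (geometric_pmf s)) = (\<Sum>n. ennreal (s * ((1 - s) * r) ^ n))"
    using assms
    by (simp add: nn_integral_measure_pmf nn_integral_count_space_nat power_mult_distrib mult_ac flip: ennreal_mult)
  also have "\<dots> = ennreal (s * (1 / (1 - (1 - s) * r)))"
    using assms by (intro suminf_ennreal_eq sums_mult geometric_sums) auto
  finally show ?thesis by simp
qed

text \<open>With \<open>r = p powr \<alpha> / p\<close> the moment equals
  \<open>1 + (r - 1 / p) / (1 - r)\<close>. The bound \<open>\<alpha> \<le> 1 / 2\<close> keeps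
  \<open>r \<le> 3 / 4\<close> even at \<open>p = 2\<close>, whence the factor 4.\<close>

lemma geometric_moment_bound:
  assumes p: "prime p" and a: "0 \<le> \<alpha>" "\<alpha> \<le> 1 / 2"
  shows "(\<integral>\<^sup>+n. ennreal ((real p powr \<alpha>) ^ n) \<partial>measure_pmf (geometric_pmf (1 - 1 / real p)))
    \<le> ennreal (exp (4 * ((real p powr \<alpha> - 1) / real p)))"
proof -
  define r where "r = real p powr \<alpha> / real p"
  have p2: "real p \<ge> 2" using prime_ge_2_nat[OF p] by simp
  have "real p powr \<alpha> \<le> real p powr (1 / 2)" using a p2 by (intro powr_mono) auto
  also have "\<dots> = sqrt (real p)" using p2 by (simp add: powr_half_sqrt)
  finally have "r \<le> sqrt (real p) / real p" unfolding r_def by (rule divide_right_mono) simp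
  also have "\<dots> = 1 / sqrt (real p)" using p2 by (simp add: real_div_sqrt field_simps)
  also have "\<dots> \<le> 1 / (4 / 3)"
  proof (rule divide_left_mono)
    show "4 / 3 \<le> sqrt (real p)" using p2 by (intro real_le_rsqrt) (simp add: power2_eq_square)
  qed (use p2 in auto)
  finally have r: "r \<le> 3 / 4" by simp
  have r1: "r \<ge> 1 / real p"
    unfolding r_def using a p2 by (intro divide_right_mono ge_one_powr_ge_zero) auto
  have "(\<integral>\<^sup>+n. ennreal ((real p powr \<alpha>) ^ n) \<partial>measure_pmf (geometric_pmf (1 - 1 / real p)))
      = ennreal ((1 - 1 / real p) / (1 - (1 - (1 - 1 / real p)) * (real p powr \<alpha>)))"
  proof (rule nn_integral_geometric_power)
    have "(1 - (1 - 1 / real p)) * real p powr \<alpha> = r" by (simp add: r_def)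
    then show "(1 - (1 - 1 / real p)) * real p powr \<alpha> < 1" using r by linarith
  qed (use p2 in auto)
  also have "(1 - 1 / real p) / (1 - (1 - (1 - 1 / real p)) * (real p powr \<alpha>)) = (1 - 1 / real p) / (1 - r)"
    by (simp add: r_def)
  also have "\<dots> = 1 + (r - 1 / real p) / (1 - r)" using r by (simp add: field_simps)
  also have "(r - 1 / real p) / (1 - r) \<le> (r - 1 / real p) / (1 / 4)"
    using r r1 by (intro divide_left_mono) auto
  also have "1 + (r - 1 / real p) / (1 / 4) \<le> exp (4 * (r - 1 / real p))"
  proof -
    have "(r - 1 / real p) / (1 / 4) = 4 * (r - 1 / real p)" by simp
    then show ?thesis using exp_ge_add_one_self[of "4 * (r - 1 / real p)"] by (simp only:)
  qed
  also have "r - 1 / real p = (real p powr \<alpha> - 1) / real p" by (simp add: r_def diff_divide_distrib)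
  finally show ?thesis by (simp add: ennreal_leI)
qed

lemma prime_model_moment_bound:
  assumes a: "0 \<le> \<alpha>" "\<alpha> \<le> 1 / 2"
  shows "(\<integral>\<^sup>+v. ennreal (real (smooth_number q v) powr \<alpha>) \<partial>measure_pmf (prime_model q))
    \<le> ennreal (exp (4 * (\<Sum>p | prime p \<and> p < q. (real p powr \<alpha> - 1) / real p)))"
proof -
  let ?P = "{p. prime p \<and> p < q}"
  have "ennreal (real (smooth_number q v) powr \<alpha>) = (\<Prod>p\<in>?P. ennreal ((real p powr \<alpha>) ^ v p))" for v
  proof -
    have "real (smooth_number q v) powr \<alpha> = (\<Prod>p\<in>?P. (real p powr \<alpha>) ^ v p)"
      unfolding smooth_number_def of_nat_prod
      by (subst prod_powr_distrib) (auto intro!: prod.cong simp: powr_power powr_powr mult.commute prime_gt_0_nat simp flip: powr_realpow)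
    then show ?thesis by (simp add: prod_ennreal)
  qed
  then have "(\<integral>\<^sup>+v. ennreal (real (smooth_number q v) powr \<alpha>) \<partial>measure_pmf (prime_model q))
      = (\<integral>\<^sup>+v. (\<Prod>p\<in>?P. ennreal ((real p powr \<alpha>) ^ v p)) \<partial>measure_pmf (prime_model q))" by simp
  also have "\<dots> = (\<Prod>p\<in>?P. \<integral>\<^sup>+n. ennreal ((real p powr \<alpha>) ^ n) \<partial>measure_pmf (geometric_pmf (1 - 1 / real p)))"
    unfolding prime_model_def by (rule nn_integral_prod_Pi_pmf) simp
  also have "\<dots> \<le> (\<Prod>p\<in>?P. ennreal (exp (4 * ((real p powr \<alpha> - 1) / real p))))"
    using a by (intro prod_mono_ennreal geometric_moment_bound) auto
  also have "\<dots> = ennreal (exp (4 * (\<Sum>p\<in>?P. (real p powr \<alpha> - 1) / real p)))"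
    by (simp add: prod_ennreal exp_sum sum_distrib_left)
  finally show ?thesis .
qed

section \<open>The order of Mertens's product, from the model\<close>

lemma smooth_number_valuation_vector:
  assumes "0 < n" "n < q"
  shows "smooth_number q (valuation_vector {p. prime p \<and> p < q} n) = n"
proof -
  have "smooth_number q (valuation_vector {p. prime p \<and> p < q} n) = (\<Prod>p | prime p \<and> p < q. p ^ multiplicity p n)"
    unfolding smooth_number_def valuation_vector_def by (intro prod.cong) auto
  also have "\<dots> = (\<Prod>p\<in>prime_factors n. p ^ multiplicity p n)"
  proof (rule prod.mono_neutral_right)
    show "prime_factors n \<subseteq> {p. prime p \<and> p < q}"
      using assms by (auto simp: prime_factors_dvd dest!: dvd_imp_le)
    show "\<forall>p\<in>{p. prime p \<and> p < q} - prime_factors n. p ^ multiplicity p n = 1"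
      using assms by (auto simp: prime_factors_dvd not_dvd_imp_multiplicity_0)
  qed simp
  also have "\<dots> = n" using prime_factorization_nat[of n] assms by simp
  finally show ?thesis .
qed

text \<open>The model gives the factorisation of each \<open>n < q\<close> the mass
  \<open>mertens_prod q / n\<close>; these masses add up to at most 1, and the harmonic sum is at
  least \<open>ln q\<close>.\<close>

lemma mertens_prod_upper:
  assumes "q \<ge> 2"
  shows "mertens_prod q \<le> 1 / ln (real q)"
proof -
  let ?v = "valuation_vector {p. prime p \<and> p < q}"
  have lq: "ln (real q) > 0" using assms by simp
  have inj: "inj_on ?v {1..q - 1}"
  proof (rule inj_on_inverseI)
    fix n assume "n \<in> {1..q - 1}"
    then show "smooth_number q (?v n) = n" using assms by (intro smooth_number_valuation_vector) auto
  qed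
  have "mertens_prod q * ln (real q) = mertens_prod q * ln (real (q - 1) + 1)" using assms by simp
  also have "\<dots> \<le> mertens_prod q * harm (q - 1)"
    using ln_le_harm[of "q - 1"] mertens_prod_pos[of q] by (intro mult_left_mono) auto
  also have "\<dots> = (\<Sum>n=1..q - 1. mertens_prod q / real n)"
    by (simp add: harm_def sum_distrib_left divide_inverse)
  also have "\<dots> = (\<Sum>n=1..q - 1. pmf (prime_model q) (?v n))"
  proof (intro sum.cong refl)
    fix n assume n: "n \<in> {1..q - 1}"
    have "pmf (prime_model q) (?v n) = mertens_prod q / real (smooth_number q (?v n))"
      by (intro pmf_prime_model) (auto simp: valuation_vector_def)
    also have "smooth_number q (?v n) = n" using n assms by (intro smooth_number_valuation_vector) auto
    finally show "mertens_prod q / real n = pmf (prime_model q) (?v n)" by simp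
  qed
  also have "\<dots> = (\<Sum>a\<in>?v ` {1..q - 1}. pmf (prime_model q) a)" by (subst sum.reindex[OF inj]) simp
  also have "\<dots> = measure_pmf.prob (prime_model q) (?v ` {1..q - 1})" by (simp add: measure_measure_pmf_finite)
  also have "\<dots> \<le> 1" by simp
  finally show ?thesis using lq by (simp add: pos_le_divide_eq)
qed

lemma harm_upper: "n \<ge> 1 \<Longrightarrow> (\<Sum>k=1..n. 1 / real k) \<le> 1 + ln (real n)"
proof (induction n rule: nat_induct_at_least)
  case (Suc n)
  have "ln (real n / real (Suc n)) \<le> real n / real (Suc n) - 1"
    using Suc.hyps by (intro ln_le_minus_one) auto
  then have "1 / real (Suc n) \<le> ln (real (Suc n)) - ln (real n)"
    using Suc.hyps by (simp add: ln_div field_simps)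
  then show ?case using Suc.IH by (simp add: algebra_simps)
qed simp

text \<open>By Markov's inequality half of the mass of the model sits on smooth numbers below a fixed
  power of \<open>q\<close>, where its density is \<open>mertens_prod q / k\<close>.\<close>

lemma mertens_prod_lower: "\<exists>C>0. \<forall>q\<ge>2. 1 / ln (real q) \<le> C * mertens_prod q"
proof -
  obtain C1 where C1: "\<And>q \<alpha>. 2 \<le> q \<Longrightarrow> 0 \<le> \<alpha> \<Longrightarrow> \<alpha> \<le> 1 \<Longrightarrow>
      (\<Sum>p | prime p \<and> p < q. (real p powr \<alpha> - 1) / real p) \<le> 1 * real q powr \<alpha> + C1"
    using sum_primes_powr_minus_one[of 1] by auto
  define E where "E = exp (4 * (exp (1 / 4) + C1))"
  obtain B :: nat where B: "real B \<ge> 4 * ln (2 * E)" using real_arch_simple by blast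
  have E: "E > 0" by (simp add: E_def)
  have "1 / ln (real q) \<le> (2 * (2 + real B)) * mertens_prod q" if q: "q \<ge> 2" for q
  proof -
    define L where "L = ln (real q)"
    \<comment> \<open>Then \<open>q powr \<alpha> = exp (1 / 4)\<close> for every \<open>q\<close>,
      so the moment is at most the constant \<open>E\<close>; the 4 ensures
      \<open>\<alpha> \<le> 1 / 2\<close> when \<open>L\<close> is only known to be at least
      \<open>1 / 2\<close>. The choice of \<open>B\<close> gives
      \<open>Z powr \<alpha> = exp (B / 4) \<ge> 2 * E\<close>, which leaves at most half of the
      mass above \<open>Z\<close>.\<close>
    define \<alpha> where "\<alpha> = 1 / (4 * L)"
    define Z where "Z = q ^ B"
    have L: "L \<ge> 1 / 2" using half_le_ln_2 ln_mono[of 2 "real q"] q unfolding L_def by (simp, linarith)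
    have a: "0 \<le> \<alpha>" "\<alpha> \<le> 1 / 2" using L by (auto simp: \<alpha>_def field_simps)
    have Z: "Z > 0" using q by (simp add: Z_def)
    have qa: "real q powr \<alpha> = exp (1 / 4)" using q L by (simp add: powr_def \<alpha>_def L_def)
    have Za: "real Z powr \<alpha> = exp (real B / 4)"
      using q L by (simp add: Z_def powr_def \<alpha>_def L_def ln_realpow)
    have Za2: "real Z powr \<alpha> \<ge> 2 * E"
    proof -
      have "exp (ln (2 * E)) \<le> exp (real B / 4)" using B by simp
      then show ?thesis using E by (simp add: Za)
    qed
    let ?M = "prime_model q" and ?A = "{a. smooth_number q a \<le> Z}"
    have "emeasure ?M (- ?A) = (\<integral>\<^sup>+a. indicator (- ?A) a \<partial>?M)" by simp
    also have "\<dots> \<le> (\<integral>\<^sup>+a. ennreal (1 / (2 * E)) * ennreal (real (smooth_number q a) powr \<alpha>) \<partial>?M)"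
    proof (intro nn_integral_mono)
      fix a
      show "indicator (- ?A) a \<le> ennreal (1 / (2 * E)) * ennreal (real (smooth_number q a) powr \<alpha>)"
      proof (cases "a \<in> ?A")
        case False
        then have "real Z powr \<alpha> \<le> real (smooth_number q a) powr \<alpha>" using a by (intro powr_mono2) auto
        with Za2 have "1 \<le> 1 / (2 * E) * real (smooth_number q a) powr \<alpha>" using E by (simp add: field_simps)
        then have "ennreal 1 \<le> ennreal (1 / (2 * E) * real (smooth_number q a) powr \<alpha>)" by (rule ennreal_leI)
        then have "1 \<le> ennreal (1 / (2 * E)) * ennreal (real (smooth_number q a) powr \<alpha>)"
          using E by (subst ennreal_mult[symmetric]) auto
        then show ?thesis using False by simp
      qed simp
    qed
    also have "\<dots> = ennreal (1 / (2 * E)) * (\<integral>\<^sup>+a. ennreal (real (smooth_number q a) powr \<alpha>) \<partial>?M)"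
      by (rule nn_integral_cmult) simp
    also have "\<dots> \<le> ennreal (1 / (2 * E)) * ennreal E"
    proof (rule mult_left_mono)
      have "4 * (\<Sum>p | prime p \<and> p < q. (real p powr \<alpha> - 1) / real p) \<le> 4 * (exp (1 / 4) + C1)"
        using C1[of q \<alpha>] q a qa by simp
      then have "exp (4 * (\<Sum>p | prime p \<and> p < q. (real p powr \<alpha> - 1) / real p)) \<le> E"
        unfolding E_def by simp
      then show "(\<integral>\<^sup>+a. ennreal (real (smooth_number q a) powr \<alpha>) \<partial>?M) \<le> ennreal E"
        using prime_model_moment_bound[OF a, of q] order_trans ennreal_leI by blast
    qed simp
    also have "\<dots> = ennreal (1 / 2)" using E by (simp flip: ennreal_mult)
    finally have "measure_pmf.prob ?M (- ?A) \<le> 1 / 2"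
      unfolding measure_pmf.emeasure_eq_measure by (subst (asm) ennreal_le_iff) auto
    then have half: "1 / 2 \<le> measure_pmf.prob ?M ?A"
      using measure_pmf.prob_compl[of ?A ?M] by (simp add: Compl_eq_Diff_UNIV)
    let ?B = "{a\<in>set_pmf ?M. smooth_number q a \<le> Z}"
    have inj: "inj_on (smooth_number q) ?B"
    proof (rule inj_onI, rule ext)
      fix a b p assume ab: "a \<in> ?B" "b \<in> ?B" "smooth_number q a = smooth_number q b"
      show "a p = b p"
      proof (cases "prime p \<and> p < q")
        case True
        then show ?thesis using multiplicity_smooth_number[of p q a] multiplicity_smooth_number[of p q b] ab by simp
      next
        case False
        then show ?thesis using set_prime_model[of a q p] set_prime_model[of b q p] ab by simp
      qed
    qed
    have img: "smooth_number q ` ?B \<subseteq> {1..Z}" using smooth_number_pos[of q] by (auto simp: Suc_le_eq)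
    then have fB: "finite ?B" using inj by (meson finite_atLeastAtMost finite_imageD finite_subset)
    have "measure_pmf.prob ?M ?A = measure_pmf.prob ?M ?B"
      by (intro measure_prob_cong_0) (auto simp: set_pmf_iff)
    also have "\<dots> = (\<Sum>a\<in>?B. pmf ?M a)" using fB by (rule measure_measure_pmf_finite)
    also have "\<dots> = (\<Sum>a\<in>?B. mertens_prod q / real (smooth_number q a))"
      using set_prime_model by (intro sum.cong refl pmf_prime_model) blast
    also have "\<dots> = (\<Sum>k\<in>smooth_number q ` ?B. mertens_prod q / real k)" by (simp add: sum.reindex[OF inj])
    also have "\<dots> \<le> (\<Sum>k=1..Z. mertens_prod q / real k)"
      using img mertens_prod_pos[of q] by (intro sum_mono2) auto
    also have "\<dots> = mertens_prod q * (\<Sum>k=1..Z. 1 / real k)" by (simp add: sum_distrib_left)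
    also have "\<dots> \<le> mertens_prod q * (1 + ln (real Z))"
      using mertens_prod_pos[of q] Z harm_upper[of Z] by (intro mult_left_mono) auto
    also have "ln (real Z) = real B * L" using q by (simp add: Z_def L_def ln_realpow)
    also have "mertens_prod q * (1 + real B * L) \<le> mertens_prod q * ((2 + real B) * L)"
      using mertens_prod_pos[of q] L by (intro mult_left_mono) (auto simp: algebra_simps)
    finally have "1 / 2 \<le> mertens_prod q * ((2 + real B) * L)" using half by simp
    then show ?thesis using L by (simp add: field_simps L_def[symmetric])
  qed
  then show ?thesis by (intro exI[of _ "2 * (2 + real B)"]) auto
qed

text \<open>The upper half of Mertens's second theorem, obtained by taking logarithms in the lower
  bound for the product.\<close>

lemma sum_primes_reciprocal: "\<exists>C. \<forall>q\<ge>2. (\<Sum>p | prime p \<and> p < q. 1 / real p) \<le> ln (ln (real q)) + C"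
proof -
  obtain C where C: "C > 0" "\<And>q. q \<ge> 2 \<Longrightarrow> 1 / ln (real q) \<le> C * mertens_prod q"
    using mertens_prod_lower by auto
  have "(\<Sum>p | prime p \<and> p < q. 1 / real p) \<le> ln (ln (real q)) + ln C" if q: "q \<ge> 2" for q
  proof -
    have lq: "ln (real q) > 0" using q by simp
    have "(\<Sum>p | prime p \<and> p < q. 1 / real p) \<le> (\<Sum>p | prime p \<and> p < q. - ln (1 - 1 / real p))"
    proof (rule sum_mono)
      fix p assume "p \<in> {p. prime p \<and> p < q}"
      then have "p > 1" using prime_gt_1_nat by blast
      then have "ln (1 - 1 / real p) \<le> (1 - 1 / real p) - 1" by (intro ln_le_minus_one) auto
      then show "1 / real p \<le> - ln (1 - 1 / real p)" by simp
    qed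
    also have "\<dots> = - ln (mertens_prod q)"
      unfolding mertens_prod_def by (subst ln_prod) (auto simp: sum_negf prime_gt_1_nat)
    also have "\<dots> \<le> ln (ln (real q)) + ln C"
    proof -
      have "ln (1 / ln (real q)) \<le> ln (C * mertens_prod q)"
        using C(2)[OF q] lq C(1) mertens_prod_pos[of q] by (intro ln_mono) auto
      then show ?thesis using lq C(1) mertens_prod_pos[of q] by (simp add: ln_mult ln_div)
    qed
    finally show ?thesis .
  qed
  then show ?thesis by blast
qed

section \<open>The fundamental lemma\<close>

definition decay :: "real \<Rightarrow> real" where
  "decay w = exp (- (w * ln w) - w)"

lemma decay_pos: "decay w > 0"
  by (simp add: decay_def)

text \<open>The exponent \<open>- w * ln w - w\<close> is concave with derivative
  \<open>- (ln w + 2)\<close>, so it lies below its tangents. This serves twice: to compare the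
  terms of Buchstab's sum with the value at \<open>w\<close>, and, with tangent point
  \<open>exp (lam - 2)\<close>, to replace \<open>decay\<close> by an exponential of slope
  \<open>- lam\<close>.\<close>

lemma decay_tangent:
  assumes "s > 0" "w > 0"
  shows "decay s \<le> decay w * exp (- (ln w + 2) * (s - w))"
proof -
  have "ln (w / s) \<le> w / s - 1" using assms by (intro ln_le_minus_one) auto
  then have "s * ln (w / s) \<le> s * (w / s - 1)" using assms by (intro mult_left_mono) auto
  then have "s * (ln w - ln s) \<le> w - s" using assms by (simp add: ln_div algebra_simps)
  then show ?thesis by (simp add: decay_def algebra_simps flip: exp_add)
qed

lemma decay_antimono:
  assumes "1 \<le> w" "w \<le> s"
  shows "decay s \<le> decay w"
proof -
  have "w * ln w \<le> s * ln s" using assms by (intro mult_mono) auto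
  then show ?thesis using assms by (simp add: decay_def)
qed

text \<open>Here \<open>l = ln p\<close> and \<open>L = ln q\<close>. With \<open>t = L / l\<close>
  the new argument of \<open>decay\<close> is \<open>w * t - 1\<close>, and the tangent at
  \<open>w\<close> gives decay \<open>exp (- \<mu> * (t - 1))\<close>. Writing \<open>1 / l\<close>
  as \<open>l * t\<^sup>2 / L\<^sup>2\<close> and using \<open>t \<le> exp (t - 1)\<close> costs 2
  in \<open>\<mu>\<close>, but produces the weight \<open>ln p\<close> for which a prime sum is
  available. Finally \<open>t - 1 \<ge> (L - l) / L\<close> makes the bound a power of
  \<open>p\<close>.\<close>

lemma buchstab_term_bound:
  fixes L l w z :: real
  assumes l: "0 < l" "l \<le> L" and w: "w \<ge> 2" and z: "ln z = w * L"
  defines "\<mu> \<equiv> w * (ln w + 2)"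
  shows "1 / l * decay ((ln z - l) / l)
    \<le> decay w * w * exp 2 / L\<^sup>2 * (l * exp (- ((\<mu> - 2) / L * (L - l))))"
proof -
  define t where "t = L / l"
  have t: "t \<ge> 1" using l by (simp add: t_def)
  have L: "L > 0" using l by simp
  have mu: "\<mu> \<ge> 2"
  proof -
    have "2 * 2 \<le> \<mu>" unfolding \<mu>_def using w by (intro mult_mono) auto
    then show ?thesis by simp
  qed
  have wp: "(ln z - l) / l = w * t - 1" using l by (simp add: z t_def diff_divide_distrib)
  have "w * t \<ge> 2 * 1" using w t by (intro mult_mono) auto
  then have "decay (w * t - 1) \<le> decay w * exp (- (ln w + 2) * ((w * t - 1) - w))"
    using w by (intro decay_tangent) auto
  also have "- (ln w + 2) * ((w * t - 1) - w) = ln w + 2 - \<mu> * (t - 1)"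
    by (simp add: \<mu>_def algebra_simps)
  also have "exp (ln w + 2 - \<mu> * (t - 1)) = w * exp 2 * exp (- \<mu> * (t - 1))"
    using w by (simp add: exp_add exp_diff exp_minus field_simps)
  finally have 1: "decay ((ln z - l) / l) \<le> decay w * (w * exp 2 * exp (- \<mu> * (t - 1)))"
    unfolding wp .
  have "t \<le> exp (t - 1)" using exp_ge_add_one_self[of "t - 1"] by simp
  then have "t\<^sup>2 \<le> (exp (t - 1))\<^sup>2" using t by (intro power_mono) auto
  also have "\<dots> = exp (2 * (t - 1))" by (simp add: power2_eq_square flip: exp_add)
  finally have t2: "t\<^sup>2 \<le> exp (2 * (t - 1))" .
  have "1 / l = l * t\<^sup>2 / L\<^sup>2" using l L by (simp add: t_def power2_eq_square)
  also have "\<dots> \<le> l * exp (2 * (t - 1)) / L\<^sup>2" using l t2 by (intro divide_right_mono mult_left_mono) auto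
  finally have 2: "1 / l \<le> l * exp (2 * (t - 1)) / L\<^sup>2" .
  have "1 / l * decay ((ln z - l) / l)
      \<le> (l * exp (2 * (t - 1)) / L\<^sup>2) * (decay w * (w * exp 2 * exp (- \<mu> * (t - 1))))"
    using 1 2 l decay_pos[of "(ln z - l) / l"] by (intro mult_mono) auto
  also have "\<dots> = decay w * w * exp 2 / L\<^sup>2 * (l * (exp (2 * (t - 1)) * exp (- \<mu> * (t - 1))))" by simp
  also have "exp (2 * (t - 1)) * exp (- \<mu> * (t - 1)) = exp (- ((\<mu> - 2) * (t - 1)))"
    by (simp add: algebra_simps flip: exp_add)
  finally have 3: "1 / l * decay ((ln z - l) / l)
      \<le> decay w * w * exp 2 / L\<^sup>2 * (l * exp (- ((\<mu> - 2) * (t - 1))))" .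
  have "exp (- ((\<mu> - 2) * (t - 1))) \<le> exp (- ((\<mu> - 2) / L * (L - l)))"
  proof -
    have "(L - l) / L \<le> (L - l) / l" using l by (intro divide_left_mono) auto
    also have "\<dots> = t - 1" using l by (simp add: t_def diff_divide_distrib)
    finally have "(\<mu> - 2) * ((L - l) / L) \<le> (\<mu> - 2) * (t - 1)" using mu by (intro mult_left_mono) auto
    then show ?thesis by simp
  qed
  then have "decay w * w * exp 2 / L\<^sup>2 * (l * exp (- ((\<mu> - 2) * (t - 1))))
      \<le> decay w * w * exp 2 / L\<^sup>2 * (l * exp (- ((\<mu> - 2) / L * (L - l))))"
    using w l decay_pos[of w] by (intro mult_left_mono) auto
  with 3 show ?thesis by linarith
qed

text \<open>The terms are now multiples of \<open>ln p / p * (p / q) powr \<kappa>\<close>, whose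
  sum is \<open>O(1 + 1 / \<kappa>)\<close>. After normalisation the two parts become
  \<open>w / L\<close> and \<open>w / (\<mu> - 2)\<close>; the latter is about
  \<open>1 / ln w\<close>, the gain that makes the recursion contract.\<close>

lemma buchstab_sum_bound:
  fixes q :: nat
  assumes q: "q \<ge> 2" and w: "w \<ge> 2" and z: "z > 0" "ln z = w * ln (real q)"
  defines "L \<equiv> ln (real q)" and "\<mu> \<equiv> w * (ln w + 2)"
  shows "(\<Sum>p | prime p \<and> p < q. z / real p / ln (real p) * decay (ln (z / real p) / ln (real p)))
    \<le> z / L * decay w * (8 * exp 2 * (w / L + w / (\<mu> - 2)))"
proof -
  let ?P = "{p. prime p \<and> p < q}"
  define \<kappa> where "\<kappa> = (\<mu> - 2) / L"
  have L: "L > 0" using q by (simp add: L_def)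
  have mu: "\<mu> > 2"
  proof -
    have "2 * 2 \<le> \<mu>" unfolding \<mu>_def using w by (intro mult_mono) auto
    then show ?thesis by simp
  qed
  have k: "\<kappa> > 0" using mu L by (simp add: \<kappa>_def)
  define A where "A = z * (decay w * w * exp 2 / L\<^sup>2)"
  have A: "A \<ge> 0" using z w decay_pos[of w] by (simp add: A_def)
  have "(\<Sum>p\<in>?P. z / real p / ln (real p) * decay (ln (z / real p) / ln (real p)))
      \<le> (\<Sum>p\<in>?P. A * real q powr (-\<kappa>) * (ln (real p) / real p * real p powr \<kappa>))"
  proof (rule sum_mono)
    fix p assume p: "p \<in> ?P"
    then have p2: "p \<ge> 2" by (auto dest: prime_ge_2_nat)
    have lp: "0 < ln (real p)" "ln (real p) \<le> L" using p p2 by (auto simp: L_def)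
    have "1 / ln (real p) * decay ((ln z - ln (real p)) / ln (real p))
      \<le> decay w * w * exp 2 / L\<^sup>2 * (ln (real p) * exp (- ((\<mu> - 2) / L * (L - ln (real p)))))"
      unfolding \<mu>_def using lp w z by (intro buchstab_term_bound) (auto simp: L_def)
    then have "z / real p * (1 / ln (real p) * decay ((ln z - ln (real p)) / ln (real p)))
      \<le> z / real p * (decay w * w * exp 2 / L\<^sup>2 * (ln (real p) * exp (- ((\<mu> - 2) / L * (L - ln (real p))))))"
      using z by (intro mult_left_mono) auto
    moreover have "exp (- ((\<mu> - 2) / L * (L - ln (real p)))) = real q powr (-\<kappa>) * real p powr \<kappa>"
    proof -
      have "- ((\<mu> - 2) / L * (L - ln (real p))) = - \<kappa> * L + \<kappa> * ln (real p)"
        unfolding \<kappa>_def by (simp only: right_diff_distrib)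
      then show ?thesis using p2 q by (simp add: powr_def L_def flip: exp_add)
    qed
    moreover have "ln (z / real p) = ln z - ln (real p)" using z p2 by (simp add: ln_div)
    ultimately show "z / real p / ln (real p) * decay (ln (z / real p) / ln (real p))
      \<le> A * real q powr (-\<kappa>) * (ln (real p) / real p * real p powr \<kappa>)"
      by (simp add: A_def mult_ac)
  qed
  also have "\<dots> = A * real q powr (-\<kappa>) * (\<Sum>p\<in>?P. ln (real p) / real p * real p powr \<kappa>)"
    by (simp add: sum_distrib_left)
  also have "\<dots> \<le> A * real q powr (-\<kappa>) * (8 * (1 + 1 / \<kappa>) * real q powr \<kappa>)"
  proof (rule mult_left_mono)
    have "(\<Sum>p\<in>?P. ln (real p) / real p * real p powr \<kappa>)
        \<le> (\<Sum>p | prime p \<and> p \<le> q. ln (real p) / real p * real p powr \<kappa>)"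
      using prime_ge_1_nat by (intro sum_mono2) auto
    then show "(\<Sum>p\<in>?P. ln (real p) / real p * real p powr \<kappa>) \<le> 8 * (1 + 1 / \<kappa>) * real q powr \<kappa>"
      using sum_primes_log_over_p_powr[OF k, of q] by linarith
  qed (use A in auto)
  also have "\<dots> = A * (8 * (1 + 1 / \<kappa>))" using q by (simp add: powr_minus)
  also have "\<dots> = z / L * decay w * (8 * exp 2 * (w / L + w / (\<mu> - 2)))"
    using L mu by (simp add: A_def \<kappa>_def power2_eq_square field_simps)
  finally show ?thesis .
qed

lemma exp_2_le_8: "exp (2::real) \<le> 8"
proof -
  have "exp (2::real) = exp 1 * exp 1" by (simp flip: exp_add)
  also have "\<dots> \<le> (272/100) * (272/100)" using e_less_272 by (intro mult_mono) auto
  finally show ?thesis by simp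
qed

text \<open>The thresholds make each of \<open>w / L\<close> and \<open>w / (\<mu> - 2)\<close> at
  most \<open>1 / 512\<close>, and \<open>8 * exp 2 * 2 / 512 \<le> 1 / 4\<close> because
  \<open>exp 2 \<le> 8\<close>.\<close>

lemma buchstab_sum_quarter:
  fixes q :: nat
  assumes q: "q \<ge> 2" and w: "ln w \<ge> 512" "w \<le> sqrt (ln (real q))" and L: "ln (real q) \<ge> 512 ^ 2"
    and z: "z > 0" "ln z = w * ln (real q)" and w0: "w > 0"
  shows "(\<Sum>p | prime p \<and> p < q. z / real p / ln (real p) * decay (ln (z / real p) / ln (real p)))
    \<le> z / ln (real q) * decay w / 4"
proof -
  define L where "L = ln (real q)"
  have L0: "L > 0" using L by (simp add: L_def)
  have w2: "w \<ge> 2"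
  proof -
    have "2 \<le> exp (ln w)" using exp_ge_add_one_self[of "ln w"] w by linarith
    then show ?thesis using w0 by simp
  qed
  have "w / L \<le> sqrt L / L" using w L0 by (intro divide_right_mono) (auto simp: L_def)
  also have "\<dots> = 1 / sqrt L" using L0 by (simp add: real_div_sqrt field_simps)
  also have "\<dots> \<le> 1 / 512"
  proof (rule divide_left_mono)
    show "512 \<le> sqrt L" using L by (intro real_le_rsqrt) (simp add: L_def)
  qed (use L0 in auto)
  finally have 1: "w / L \<le> 1 / 512" .
  have "w * 512 \<le> w * (ln w + 2) - 2"
  proof -
    have "w * 512 \<le> w * ln w" using w w0 by (intro mult_left_mono) auto
    then show ?thesis unfolding distrib_left using w2 by linarith
  qed
  then have "w / (w * (ln w + 2) - 2) \<le> w / (w * 512)" using w0 by (intro divide_left_mono) auto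
  then have 2: "w / (w * (ln w + 2) - 2) \<le> 1 / 512" using w0 by simp
  have "8 * exp 2 * (w / L + w / (w * (ln w + 2) - 2)) \<le> 8 * 8 * (1 / 512 + 1 / 512)"
    using 1 2 exp_2_le_8 w0 L0 w2 \<open>w * 512 \<le> _\<close> by (intro mult_mono add_mono) (auto intro!: add_nonneg_nonneg divide_nonneg_nonneg)
  then have 3: "8 * exp 2 * (w / L + w / (w * (ln w + 2) - 2)) \<le> 1 / 4" by simp
  have "z / L * decay w * (8 * exp 2 * (w / L + w / (w * (ln w + 2) - 2))) \<le> z / L * decay w * (1 / 4)"
    using z L0 decay_pos[of w] by (intro mult_left_mono 3) auto
  then show ?thesis
    using buchstab_sum_bound[OF q w2 z] by (simp add: L_def)
qed

section \<open>Rankin's bound when the ratio is large\<close>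

lemma sieve_error_rankin_exp:
  assumes "0 \<le> \<alpha>" "\<alpha> \<le> 1" "z > 0"
  shows "\<bar>sieve_error z q\<bar> \<le> z powr (1 - \<alpha>) *
    exp ((\<Sum>p | prime p \<and> p < q. 1 / real p) + (\<Sum>p | prime p \<and> p < q. (real p powr \<alpha> - 1) / real p))"
proof -
  let ?P = "{p. prime p \<and> p < q}"
  have "\<bar>sieve_error z q\<bar> \<le> z powr (1 - \<alpha>) * (\<Prod>p\<in>?P. 1 + real p powr (- (1 - \<alpha>)))"
    using assms by (intro sieve_error_rankin) auto
  also have "(\<Prod>p\<in>?P. 1 + real p powr (- (1 - \<alpha>))) \<le> (\<Prod>p\<in>?P. exp (real p powr (- (1 - \<alpha>))))"
    by (intro prod_mono) (auto simp: add_nonneg_nonneg)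
  also have "\<dots> = exp (\<Sum>p\<in>?P. real p powr (- (1 - \<alpha>)))" by (simp add: exp_sum)
  also have "(\<Sum>p\<in>?P. real p powr (- (1 - \<alpha>))) = (\<Sum>p\<in>?P. 1 / real p + (real p powr \<alpha> - 1) / real p)"
  proof (intro sum.cong refl)
    fix p assume "p \<in> ?P"
    then have "p > 0" by (auto simp: prime_gt_0_nat)
    then have "real p powr (- (1 - \<alpha>)) = real p powr \<alpha> / real p" by (simp add: powr_diff)
    then show "real p powr (- (1 - \<alpha>)) = 1 / real p + (real p powr \<alpha> - 1) / real p"
      by (simp add: diff_divide_distrib)
  qed
  finally show ?thesis by (simp add: sum.distrib mult_left_mono)
qed

lemma sieve_error_large_ratio:
  "\<exists>L0. \<forall>(q::nat) (z::real). 2 \<le> q \<longrightarrow> real q \<le> z \<longrightarrow> L0 \<le> ln (real q) \<longrightarrow> sqrt (ln (real q)) \<le> ln z / ln (real q) \<longrightarrow>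
    \<bar>sieve_error z q\<bar> \<le> z / ln (real q) * decay (ln z / ln (real q)) + z powr (7 / 8)"
proof -
  obtain C1 where C1: "\<And>q \<alpha>. 2 \<le> q \<Longrightarrow> 0 \<le> \<alpha> \<Longrightarrow> \<alpha> \<le> 1 \<Longrightarrow>
      (\<Sum>p | prime p \<and> p < q. (real p powr \<alpha> - 1) / real p) \<le> exp (-3) / 4 * real q powr \<alpha> + C1"
    using sum_primes_powr_minus_one[of "exp (-3) / 4"] by auto
  obtain C2 where C2: "\<And>q. q \<ge> 2 \<Longrightarrow> (\<Sum>p | prime p \<and> p < q. 1 / real p) \<le> ln (ln (real q)) + C2"
    using sum_primes_reciprocal by auto
  define C where "C = C1 + C2"
  have "eventually (\<lambda>L::real. 2 * ln L + C \<le> sqrt L \<and> 16 * exp 3 \<le> L \<and> ln L + C \<le> sqrt L \<and> 16 \<le> L) at_top"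
    by (intro eventually_conj; real_asymp)
  then obtain L0 where L0: "\<And>L. L \<ge> L0 \<Longrightarrow> 2 * ln L + C \<le> sqrt L \<and> 16 * exp 3 \<le> L \<and> ln L + C \<le> sqrt L \<and> 16 \<le> L"
    by (auto simp: eventually_at_top_linorder)
  have "\<bar>sieve_error z q\<bar> \<le> z / ln (real q) * decay (ln z / ln (real q)) + z powr (7 / 8)"
    if q: "2 \<le> q" and zq: "real q \<le> z" and qL: "L0 \<le> ln (real q)" and rt: "sqrt (ln (real q)) \<le> ln z / ln (real q)" for q z
  proof -
    define L where "L = ln (real q)"
    define w where "w = ln z / L"
    have L: "2 * ln L + C \<le> sqrt L" "16 * exp 3 \<le> L" "ln L + C \<le> sqrt L" "16 \<le> L"
      using L0[OF qL] by (auto simp: L_def)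
    have w: "w \<ge> sqrt L" using rt by (simp add: w_def L_def)
    have w4: "w \<ge> 4"
    proof -
      have "4 \<le> sqrt L" using L by (intro real_le_rsqrt) simp
      then show ?thesis using w by simp
    qed
    have z: "z > 0" using q zq by simp
    have lz: "ln z = w * L" using L by (simp add: w_def)
    have zexp: "z powr b = exp (b * (w * L))" for b using z lz by (simp add: powr_def)
    have zexp1: "z = exp (w * L)" using z lz by (metis exp_ln)
    \<comment> \<open>The shift \<open>\<alpha> = lam / L\<close> saves
      \<open>exp (- w * ln w - 3 * w)\<close>, better than \<open>decay w\<close> by
      \<open>exp (- 2 * w)\<close>. This surplus pays for \<open>w / 4\<close> from the prime sum
      (hence the choice of \<open>exp (-3) / 4\<close> above) and, as \<open>w \<ge> sqrt L\<close>,
      for \<open>2 * ln L + C\<close>.\<close>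
    define lam where "lam = ln w + 3"
    have bound: "\<bar>sieve_error z q\<bar> \<le> exp ((1 - \<alpha>) * (w * L) + (ln L + C + exp (-3) / 4 * exp (\<alpha> * L)))"
      if a: "0 \<le> \<alpha>" "\<alpha> \<le> 1" for \<alpha>
    proof -
      have "\<bar>sieve_error z q\<bar> \<le> z powr (1 - \<alpha>) *
        exp ((\<Sum>p | prime p \<and> p < q. 1 / real p) + (\<Sum>p | prime p \<and> p < q. (real p powr \<alpha> - 1) / real p))"
        by (rule sieve_error_rankin_exp[OF a z])
      also have "\<dots> \<le> z powr (1 - \<alpha>) * exp ((ln (ln (real q)) + C2) + (exp (-3) / 4 * real q powr \<alpha> + C1))"
        using C1[OF q a] C2[OF q] by (intro mult_left_mono) auto
      also have "real q powr \<alpha> = exp (\<alpha> * L)" using q by (simp add: powr_def L_def)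
      finally show ?thesis by (simp add: zexp C_def L_def algebra_simps flip: exp_add)
    qed
    show ?thesis
    proof (cases "lam \<le> L / 4")
      case True
      have lam0: "lam \<ge> 0" using w4 by (simp add: lam_def)
      have "\<bar>sieve_error z q\<bar> \<le> exp ((1 - lam / L) * (w * L) + (ln L + C + exp (-3) / 4 * exp (lam / L * L)))"
        using True lam0 L by (intro bound) (auto simp: field_simps)
      also have "exp (lam / L * L) = exp 3 * w" using L w4 by (simp add: lam_def exp_add)
      also have "exp (-3) / 4 * (exp 3 * w) = w / 4" by (simp add: exp_minus)
      also have "(1 - lam / L) * (w * L) = w * L - lam * w" using L by (simp add: field_simps)
      also have "w * L - lam * w + (ln L + C + w / 4) \<le> w * L - ln L + (- (w * ln w) - w)"
        using L w w4 by (simp add: lam_def algebra_simps)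
      also have "exp (w * L - ln L + (- (w * ln w) - w)) = z / L * decay w"
        using L by (simp add: zexp1 decay_def exp_diff exp_add)
      finally have "\<bar>sieve_error z q\<bar> \<le> z / L * decay w" by simp
      then show ?thesis unfolding w_def L_def using powr_ge_zero[of z "7 / 8"] by linarith
    next
      case False
      \<comment> \<open>Here \<open>w\<close> is so large that the shift has to be capped. The fixed
        \<open>\<alpha> = 1 / 4\<close> gives \<open>z powr (3 / 4)\<close>, and all losses fit into
        \<open>z powr (1 / 8)\<close>.\<close>
      have "\<bar>sieve_error z q\<bar> \<le> exp ((1 - 1 / 4) * (w * L) + (ln L + C + exp (-3) / 4 * exp (1 / 4 * L)))"
        by (intro bound) auto
      also have "\<dots> \<le> exp (7 / 8 * (w * L))"
      proof -
        have "exp (1 / 4 * L) \<le> exp lam" using False by simp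
        also have "\<dots> = exp 3 * w" using w4 by (simp add: lam_def exp_add)
        finally have "exp (-3) / 4 * exp (1 / 4 * L) \<le> exp (-3) / 4 * (exp 3 * w)" by (intro mult_left_mono) auto
        also have "\<dots> = w / 4" by (simp add: exp_minus)
        finally have "exp (-3) / 4 * exp (1 / 4 * L) \<le> w / 4" .
        moreover have "16 * w \<le> L * w" using L w4 by (intro mult_right_mono) auto
        ultimately have "ln L + C + exp (-3) / 4 * exp (1 / 4 * L) \<le> 1 / 8 * (w * L)"
          using L w w4 unfolding mult.commute[of L w] by linarith
        from add_left_mono[OF this, of "(1 - 1 / 4) * (w * L)"] show ?thesis
          by (subst exp_le_cancel_iff) (simp add: algebra_simps)
      qed
      also have "\<dots> = z powr (7 / 8)" by (simp add: zexp)
      finally show ?thesis using z q decay_pos[of "ln z / ln (real q)"]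
        by (simp add: add_increasing)
    qed
  qed
  then show ?thesis by blast
qed

text \<open>In Buchstab's step fewer than \<open>q = exp L\<close> terms
  \<open>z powr (7 / 8)\<close> arise, and this lemma lets the main term absorb them. They save
  \<open>exp (w * L / 8)\<close>: half pays for the factor \<open>q\<close>, because
  \<open>w \<ge> 16\<close>, and half for \<open>decay w / L\<close>, because
  \<open>w \<le> sqrt L\<close>. The weight \<open>3 / 4\<close> is what the contracted sum
  leaves.\<close>

lemma buchstab_power_terms:
  "\<exists>L0. \<forall>L\<ge>L0. \<forall>w. 16 \<le> w \<longrightarrow> w \<le> sqrt L \<longrightarrow>
    2 * (exp (7 / 8 * (w * L)) * exp L) \<le> exp (w * L) / L * decay w * (3 / 4)"
proof -
  have "eventually (\<lambda>L::real. ln L + 2 \<le> L / 16 - ln L / 2 - 1 \<and> L \<ge> 1) at_top"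
    by (intro eventually_conj; real_asymp)
  then obtain L0 where L0: "\<And>L::real. L \<ge> L0 \<Longrightarrow> ln L + 2 \<le> L / 16 - ln L / 2 - 1 \<and> L \<ge> 1"
    by (auto simp: eventually_at_top_linorder)
  have "2 * (exp (7 / 8 * (w * L)) * exp L) \<le> exp (w * L) / L * decay w * (3 / 4)"
    if L: "L0 \<le> L" and w: "16 \<le> w" "w \<le> sqrt L" for L w
  proof -
    have L1: "ln L + 2 \<le> L / 16 - ln L / 2 - 1" "L \<ge> 1" using L0[OF L] by auto
    have "ln w \<le> ln (sqrt L)" using w by (intro ln_mono) auto
    also have "\<dots> = ln L / 2" using L1 by (simp add: ln_sqrt)
    finally have lw: "ln w \<le> ln L / 2" .
    have "ln L + 2 \<le> 1 * (L / 16 - ln w - 1)" using L1 lw by simp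
    also have "\<dots> \<le> w * (L / 16 - ln w - 1)"
    proof (rule mult_right_mono)
      have "ln L \<ge> 0" using L1 by simp
      then show "0 \<le> L / 16 - ln w - 1" using L1(1) lw by linarith
    qed (use w in simp)
    finally have 1: "ln L + 2 \<le> w * L / 16 - w * ln w - w" by (simp add: algebra_simps)
    have 2: "16 * L \<le> w * L" using w L1 by (intro mult_right_mono) auto
    have "exp (7 / 8 * (w * L)) * exp L * (8 / 3) \<le> exp (7 / 8 * (w * L)) * exp L * exp 2"
      using exp_ge_add_one_self[of 2] by (intro mult_left_mono) auto
    also have "\<dots> = exp (7 / 8 * (w * L) + L + 2)" by (simp add: exp_add)
    also have "\<dots> \<le> exp (w * L - ln L + (- (w * ln w) - w))" using 1 2 by simp
    also have "\<dots> = exp (w * L) / L * decay w" using L1 by (simp add: decay_def exp_diff exp_add)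
    finally have "exp (7 / 8 * (w * L)) * exp L * (8 / 3) \<le> exp (w * L) / L * decay w" .
    from mult_right_mono[OF this, of "3 / 4"] show ?thesis by (simp add: mult_ac)
  qed
  then show ?thesis by blast
qed

text \<open>The constant must reproduce itself in the induction on \<open>q\<close>. In the middle
  range the recursion returns a quarter of the main term, and the remaining three quarters absorb
  the power terms and the rounding error.\<close>

theorem sieve_error_bound:
  "\<exists>K>0. \<forall>(q::nat) (z::real). 2 \<le> q \<longrightarrow> real q \<le> z \<longrightarrow>
    \<bar>sieve_error z q\<bar> \<le> K * (z / ln (real q) * decay (ln z / ln (real q)) + z powr (7 / 8))"
proof -
  obtain L1 where L1: "\<And>q z. 2 \<le> q \<Longrightarrow> real q \<le> z \<Longrightarrow> L1 \<le> ln (real q) \<Longrightarrow>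
      sqrt (ln (real q)) \<le> ln z / ln (real q) \<Longrightarrow>
      \<bar>sieve_error z q\<bar> \<le> z / ln (real q) * decay (ln z / ln (real q)) + z powr (7 / 8)"
    using sieve_error_large_ratio by blast
  obtain L2 where L2: "\<And>L w. L2 \<le> L \<Longrightarrow> 16 \<le> w \<Longrightarrow> w \<le> sqrt L \<Longrightarrow>
      2 * (exp (7 / 8 * (w * L)) * exp L) \<le> exp (w * L) / L * decay w * (3 / 4)"
    using buchstab_power_terms by blast
  \<comment> \<open>Beyond \<open>j\<close> one has \<open>ln w \<ge> 512\<close>, as the
    contraction of Buchstab's sum requires; up to \<open>j\<close> the crude sieve is good
    enough.\<close>
  obtain j :: nat where j: "real j \<ge> exp 512" using real_arch_simple by blast
  obtain C where C: "C \<ge> 0" "\<And>q z. 2 \<le> q \<Longrightarrow> 1 \<le> z \<Longrightarrow> z \<le> real q ^ j \<Longrightarrow>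
      real (rough_count z q) \<le> 1 + C * z / ln (real q)"
    using rough_count_upper[of j] by blast
  define L0 where "L0 = max (max L1 L2) (512 ^ 2)"
  obtain q0 :: nat where q0: "real q0 \<ge> exp L0" using real_arch_simple by blast
  \<comment> \<open>\<open>2 ^ q0\<close> covers small \<open>q\<close> by Legendre's formula with
    trivial roundings; \<open>(C + 2) / decay (real j)\<close> turns the crude bound
    \<open>O(z / ln q)\<close> into a multiple of \<open>decay w\<close> for
    \<open>w \<le> j\<close>.\<close>
  define K where "K = max (max 1 (2 ^ q0)) ((C + 2) / decay (real j))"
  have K1: "K \<ge> 1" "K \<ge> 2 ^ q0" "K \<ge> (C + 2) / decay (real j)" unfolding K_def by linarith+
  have "\<bar>sieve_error z q\<bar> \<le> K * (z / ln (real q) * decay (ln z / ln (real q)) + z powr (7 / 8))"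
    if "2 \<le> q" "real q \<le> z" for q z
    using that
  proof (induction q arbitrary: z rule: less_induct)
    case (less q)
    note q = less.prems(1) and zq = less.prems(2)
    define L where "L = ln (real q)"
    define w where "w = ln z / L"
    have L: "L > 0" using q by (simp add: L_def)
    have z: "z \<ge> 2" using q zq by linarith
    have lz: "ln z = w * L" using L by (simp add: w_def)
    have zexp: "z powr b = exp (b * (w * L))" for b using z lz by (simp add: powr_def)
    have zexp1: "z = exp (w * L)" using z lz by (metis exp_ln less_le_trans zero_less_numeral)
    have w1: "w \<ge> 1" using L zq q by (simp add: w_def L_def)
    have D0: "z / L * decay w \<ge> 0" using z L decay_pos[of w] by simp
    let ?B = "z / L * decay w + z powr (7 / 8)"
    have B0: "?B \<ge> 0" using D0 by simp
    have goal: "\<bar>sieve_error z q\<bar> \<le> K * ?B"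
    proof -
      consider (small) "q < q0" | (crude) "w \<le> real j"
        | (large) "q \<ge> q0" "w > real j" "w \<ge> sqrt L" | (mid) "q \<ge> q0" "w > real j" "w \<le> sqrt L"
        by linarith
      then show ?thesis
      proof cases
        case small
        have "\<bar>sieve_error z q\<bar> \<le> z powr 0 * (\<Prod>p | prime p \<and> p < q. 1 + real p powr (-0))"
          using z by (intro sieve_error_rankin) auto
        also have "\<dots> = 2 ^ card {p. prime p \<and> p < q}" 
        proof -
          have "(\<Prod>p | prime p \<and> p < q. 1 + real p powr (-0)) = (\<Prod>p | prime p \<and> p < q. 2)"
            by (intro prod.cong) (auto simp: prime_gt_0_nat)
          then show ?thesis using z by simp
        qed
        also have "\<dots> \<le> 2 ^ q0"
        proof (rule power_increasing)
          have "card {p. prime p \<and> p < q} \<le> card {..<q}" by (intro card_mono) auto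
          then show "card {p. prime p \<and> p < q} \<le> q0" using small by simp
        qed simp
        also have "\<dots> \<le> K * 1" using K1 by simp
        also have "\<dots> \<le> K * ?B"
        proof (rule mult_left_mono)
          have "1 \<le> z powr (7 / 8)" using z by (intro ge_one_powr_ge_zero) auto
          then show "1 \<le> ?B" using D0 by linarith
        qed (use K1 in auto)
        finally show ?thesis .
      next
        case crude
        have "ln z \<le> ln (real q ^ j)" using crude q L by (simp add: lz ln_realpow L_def)
        then have zj: "z \<le> real q ^ j" using z q by (subst (asm) ln_le_cancel_iff) auto
        have one: "1 \<le> z / L"
          using zq ln_le_minus_one[of "real q"] q L by (simp add: L_def pos_le_divide_eq)
        have "\<bar>sieve_error z q\<bar> \<le> real (rough_count z q) + z * mertens_prod q"
          unfolding sieve_error_def using z mertens_prod_pos[of q] by (simp add: abs_le_iff add_nonneg_nonneg)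
        also have "\<dots> \<le> (1 + C * z / ln (real q)) + z * (1 / ln (real q))"
          using z q zj mertens_prod_upper[OF q] by (intro add_mono mult_left_mono C) auto
        also have "\<dots> \<le> (C + 2) * (z / L)" 
        proof -
          have "(C + 2) * (z / L) = C * z / L + z / L + z / L" by (simp add: distrib_right add_divide_distrib)
          then show ?thesis using one by (simp add: L_def)
        qed
        also have "\<dots> = (C + 2) / decay (real j) * (z / L * decay (real j))" using decay_pos[of "real j"] by simp
        also have "\<dots> \<le> K * (z / L * decay w)"
          using K1 z L decay_pos[of "real j"] crude w1 by (intro mult_mono decay_antimono) auto
        also have "\<dots> \<le> K * ?B" using K1 by (intro mult_left_mono) auto
        finally show ?thesis .
      next
        case large
        have "exp L0 \<le> real q" using q0 large by (meson of_nat_le_iff order_trans)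
        then have "ln (exp L0) \<le> ln (real q)" by (intro ln_mono) auto
        then have "\<bar>sieve_error z q\<bar> \<le> ?B"
          using L1[OF q zq] large by (simp add: L0_def L_def w_def)
        also have "\<dots> \<le> K * ?B" using mult_right_mono[OF K1(1) B0] by simp
        finally show ?thesis .
      next
        case mid
        let ?P = "{p. prime p \<and> p < q}"
        have "exp L0 \<le> real q" using q0 mid by (meson of_nat_le_iff order_trans)
        then have "ln (exp L0) \<le> ln (real q)" by (intro ln_mono) auto
        then have LL: "L2 \<le> L" "L \<ge> 512 ^ 2" by (auto simp: L0_def L_def)
        have wj: "w \<ge> exp 512" using j mid by linarith
        have lw: "ln w \<ge> 512" using wj w1 by (simp add: ln_ge_iff)
        have w16: "w \<ge> 16" using wj exp_ge_add_one_self[of 512] by linarith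
        have "\<bar>sieve_error z q\<bar> \<le> 1 + (\<Sum>p\<in>?P. \<bar>sieve_error (z / real p) p\<bar>)"
        proof -
          have "\<bar>sieve_error z q\<bar> \<le> \<bar>of_int \<lfloor>z\<rfloor> - z\<bar> + \<bar>\<Sum>p\<in>?P. sieve_error (z / real p) p\<bar>"
            using sieve_error_buchstab[of z q] z by linarith
          also have "\<bar>of_int \<lfloor>z\<rfloor> - z\<bar> \<le> 1" by linarith
          also have "\<bar>\<Sum>p\<in>?P. sieve_error (z / real p) p\<bar> \<le> (\<Sum>p\<in>?P. \<bar>sieve_error (z / real p) p\<bar>)"
            by (rule sum_abs)
          finally show ?thesis by simp
        qed
        also have "(\<Sum>p\<in>?P. \<bar>sieve_error (z / real p) p\<bar>)
          \<le> (\<Sum>p\<in>?P. K * (z / real p / ln (real p) * decay (ln (z / real p) / ln (real p)) + z powr (7 / 8)))"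
        proof (rule sum_mono)
          fix p assume p: "p \<in> ?P"
          then have p2: "2 \<le> p" by (auto dest: prime_ge_2_nat)
          \<comment> \<open>Needed for \<open>p \<le> z / p\<close>, the side condition of the
            induction hypothesis at \<open>p\<close>.\<close>
          have "real q powr 2 \<le> z"
            using q w16 L by (simp add: zexp1 powr_def L_def[symmetric])
          then have qz: "real q * real q \<le> z" using q by (simp add: power2_eq_square)
          have "real p * real p \<le> real q * real q" using p by (intro mult_mono) auto
          then have pz: "real p \<le> z / real p" using qz p2 by (simp add: pos_le_divide_eq)
          have "\<bar>sieve_error (z / real p) p\<bar>
            \<le> K * (z / real p / ln (real p) * decay (ln (z / real p) / ln (real p)) + (z / real p) powr (7 / 8))"
            using p p2 pz by (intro less.IH) auto
          also have "\<dots> \<le> K * (z / real p / ln (real p) * decay (ln (z / real p) / ln (real p)) + z powr (7 / 8))"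
            using K1 p2 z by (intro mult_left_mono add_left_mono powr_mono2) (auto simp: divide_le_eq)
          finally show "\<bar>sieve_error (z / real p) p\<bar>
            \<le> K * (z / real p / ln (real p) * decay (ln (z / real p) / ln (real p)) + z powr (7 / 8))" .
        qed
        also have "\<dots> = K * ((\<Sum>p\<in>?P. z / real p / ln (real p) * decay (ln (z / real p) / ln (real p)))
            + real (card ?P) * z powr (7 / 8))"
          by (simp add: sum.distrib flip: sum_distrib_left)
        also have "\<dots> \<le> K * (z / L * decay w / 4 + real q * z powr (7 / 8))"
        proof (intro mult_left_mono add_mono mult_right_mono)
          show "(\<Sum>p\<in>?P. z / real p / ln (real p) * decay (ln (z / real p) / ln (real p))) \<le> z / L * decay w / 4"
            unfolding L_def using q lw mid LL lz w1 z by (intro buchstab_sum_quarter) (auto simp: L_def)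
          have "card ?P \<le> card {..<q}" by (intro card_mono) auto
          then show "real (card ?P) \<le> real q" by simp
        qed (use K1 in auto)
        finally have main: "\<bar>sieve_error z q\<bar> \<le> 1 + K * (z / L * decay w / 4 + real q * z powr (7 / 8))" by simp
        have "1 * 1 \<le> real q * z powr (7 / 8)"
          using q z by (intro mult_mono ge_one_powr_ge_zero) auto
        then have "1 * 1 \<le> K * (real q * z powr (7 / 8))" using K1 by (intro mult_mono) auto
        \<comment> \<open>One copy bounds the power terms of the sum, the other the rounding error
          1.\<close>
        moreover have "2 * (real q * z powr (7 / 8)) \<le> z / L * decay w * (3 / 4)"
        proof -
          have "exp L = real q" using q by (simp add: L_def)
          then have "2 * (z powr (7 / 8) * real q) \<le> z / L * decay w * (3 / 4)"
            using L2[OF LL(1) w16 mid(3)] by (simp only: zexp zexp1[symmetric])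
          then show ?thesis by (simp only: mult.commute[of "real q"])
        qed
        then have "K * (2 * (real q * z powr (7 / 8))) \<le> K * (z / L * decay w * (3 / 4))"
          using K1 by (intro mult_left_mono) auto
        ultimately have "\<bar>sieve_error z q\<bar> \<le> K * (z / L * decay w)"
          using main by (simp add: algebra_simps)
        also have "\<dots> \<le> K * ?B" using K1 by (intro mult_left_mono) auto
        finally show ?thesis .
      qed
    qed
    then show ?case unfolding w_def L_def .
  qed
  then show ?thesis using K1 by (intro exI[of _ K]) auto
qed

section \<open>The Kubilius model\<close>

lemma dTV_bdd: "bdd_above (range (\<lambda>A. \<bar>measure_pmf.prob P A - measure_pmf.prob Q A\<bar>))"
proof (rule bdd_aboveI2)
  show "\<bar>measure_pmf.prob P A - measure_pmf.prob Q A\<bar> \<le> 1" for A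
    using measure_pmf.prob_le_1[of P A] measure_pmf.prob_le_1[of Q A]
      measure_nonneg[of P A] measure_nonneg[of Q A] by linarith
qed

lemma dTV_upper: "\<bar>measure_pmf.prob P A - measure_pmf.prob Q A\<bar> \<le> dTV P Q"
  unfolding dTV_def by (rule cSUP_upper[OF _ dTV_bdd]) simp

lemma dTV_leI: "(\<And>A. \<bar>measure_pmf.prob P A - measure_pmf.prob Q A\<bar> \<le> d) \<Longrightarrow> dTV P Q \<le> d"
  unfolding dTV_def by (rule cSUP_least) auto

lemma dTV_le_1: "dTV P Q \<le> 1"
proof (rule dTV_leI)
  show "\<bar>measure_pmf.prob P A - measure_pmf.prob Q A\<bar> \<le> 1" for A
    using measure_pmf.prob_le_1[of P A] measure_pmf.prob_le_1[of Q A]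
      measure_nonneg[of P A] measure_nonneg[of Q A] by linarith
qed

text \<open>Passing to the complement of \<open>A\<close> reverses the sign of the
  difference.\<close>

lemma dTV_leI_one_sided:
  assumes "\<And>A. measure_pmf.prob Q A - measure_pmf.prob P A \<le> d"
  shows "dTV P Q \<le> d"
proof (rule dTV_leI)
  fix A
  have "measure_pmf.prob P A - measure_pmf.prob Q A \<le> d"
    using assms[of "- A"] measure_pmf.prob_compl[of A P] measure_pmf.prob_compl[of A Q]
    by (simp add: Compl_eq_Diff_UNIV)
  with assms[of A] show "\<bar>measure_pmf.prob P A - measure_pmf.prob Q A\<bar> \<le> d" by linarith
qed

lemma dTV_le_density_deficit:
  assumes le: "\<And>a. a \<in> set_pmf Q \<Longrightarrow> pmf Q a \<le> pmf P a + \<psi> a * pmf Q a"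
    and nonneg: "\<And>a. \<psi> a \<ge> 0" and int: "(\<integral>\<^sup>+a. ennreal (\<psi> a) \<partial>measure_pmf Q) \<le> ennreal d" and d: "d \<ge> 0"
  shows "dTV P Q \<le> d"
proof (rule dTV_leI_one_sided)
  fix A
  have pt: "ennreal (pmf Q a) \<le> ennreal (pmf P a) + ennreal (pmf Q a) * ennreal (\<psi> a)" for a
  proof (cases "a \<in> set_pmf Q")
    case True
    have "ennreal (pmf Q a) \<le> ennreal (pmf P a + pmf Q a * \<psi> a)"
      using le[OF True] by (intro ennreal_leI) (simp add: mult.commute)
    then show ?thesis using nonneg[of a] by (simp add: ennreal_mult)
  qed (simp add: set_pmf_iff)
  have "ennreal (measure_pmf.prob Q A) = (\<integral>\<^sup>+a. ennreal (pmf Q a) \<partial>count_space A)"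
    by (simp add: nn_integral_pmf measure_pmf.emeasure_eq_measure)
  also have "\<dots> \<le> (\<integral>\<^sup>+a. ennreal (pmf P a) + ennreal (pmf Q a) * ennreal (\<psi> a) \<partial>count_space A)"
    by (intro nn_integral_mono pt)
  also have "\<dots> = (\<integral>\<^sup>+a. ennreal (pmf P a) \<partial>count_space A) + (\<integral>\<^sup>+a. ennreal (pmf Q a) * ennreal (\<psi> a) \<partial>count_space A)"
    by (rule nn_integral_add) auto
  also have "(\<integral>\<^sup>+a. ennreal (pmf P a) \<partial>count_space A) = ennreal (measure_pmf.prob P A)"
    by (simp add: nn_integral_pmf measure_pmf.emeasure_eq_measure)
  also have "(\<integral>\<^sup>+a. ennreal (pmf Q a) * ennreal (\<psi> a) \<partial>count_space A)
      \<le> (\<integral>\<^sup>+a. ennreal (pmf Q a) * ennreal (\<psi> a) \<partial>count_space UNIV)"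
  proof -
    have "(\<integral>\<^sup>+a. ennreal (pmf Q a) * ennreal (\<psi> a) \<partial>count_space A)
      = (\<integral>\<^sup>+a. ennreal (pmf Q a) * ennreal (\<psi> a) * indicator A a \<partial>count_space UNIV)"
      by (subst nn_integral_count_space_indicator) auto
    also have "\<dots> \<le> (\<integral>\<^sup>+a. ennreal (pmf Q a) * ennreal (\<psi> a) \<partial>count_space UNIV)"
      by (intro nn_integral_mono) (auto split: split_indicator)
    finally show ?thesis .
  qed
  also have "\<dots> = (\<integral>\<^sup>+a. ennreal (\<psi> a) \<partial>measure_pmf Q)" by (simp add: nn_integral_measure_pmf)
  also note int
  finally have "ennreal (measure_pmf.prob Q A) \<le> ennreal (measure_pmf.prob P A + d)"
    using d by (simp add: add_left_mono)
  then have "measure_pmf.prob Q A \<le> measure_pmf.prob P A + d" using d by (subst (asm) ennreal_le_iff) auto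
  then show "measure_pmf.prob Q A - measure_pmf.prob P A \<le> d" by simp
qed

section \<open>From the sieve error to the deficit of the density\<close>

lemma multiplicity_smooth_times_rough:
  assumes p: "prime p" "p < q" and m: "m > 0" "rough q m"
  shows "multiplicity p (smooth_number q a * m) = a p"
proof -
  have "multiplicity p (smooth_number q a * m) = multiplicity p (smooth_number q a) + multiplicity p m"
    using p m smooth_number_pos[of q a] by (intro prime_elem_multiplicity_mult_distrib) auto
  also have "multiplicity p m = 0" using p m by (intro not_dvd_imp_multiplicity_0) (auto simp: rough_def)
  finally show ?thesis using p by (simp add: multiplicity_smooth_number)
qed

text \<open>The products of the smooth number with a \<open>q\<close>-rough
  \<open>m \<le> N / k\<close> all have valuation vector \<open>a\<close>; only this inclusion is
  needed for a lower bound.\<close>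

lemma valuation_pmf_lower:
  assumes N: "N \<ge> 1" and a: "\<And>p. \<not> (prime p \<and> p < q) \<Longrightarrow> a p = 0"
  shows "real (rough_count (real N / real (smooth_number q a)) q) / real N
    \<le> pmf (map_pmf (valuation_vector {p. prime p \<and> p < q}) (pmf_of_set {1..N})) a"
proof -
  let ?k = "smooth_number q a"
  let ?S = "{n::nat. 1 \<le> n \<and> real n \<le> real N / real ?k \<and> rough q n}"
  let ?v = "valuation_vector {p. prime p \<and> p < q}"
  have k: "?k > 0" by (rule smooth_number_pos)
  have "(\<lambda>m. ?k * m) ` ?S \<subseteq> {1..N} \<inter> ?v -` {a}"
  proof
    fix n assume "n \<in> (\<lambda>m. ?k * m) ` ?S"
    then obtain m where m: "n = ?k * m" "1 \<le> m" "real m \<le> real N / real ?k" "rough q m" by auto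
    have "real (?k * m) \<le> real N" using m(3) k by (simp add: pos_le_divide_eq mult.commute)
    then have "n \<le> N" unfolding m(1) by (simp only: of_nat_le_iff)
    moreover have "1 \<le> n" using m k by simp
    moreover have "?v n = a"
    proof
      fix p
      show "?v n p = a p"
        using m a[of p] multiplicity_smooth_times_rough[of p q m a] by (auto simp: valuation_vector_def)
    qed
    ultimately show "n \<in> {1..N} \<inter> ?v -` {a}" by simp
  qed
  then have "card ((\<lambda>m. ?k * m) ` ?S) \<le> card ({1..N} \<inter> ?v -` {a})" by (intro card_mono) auto
  also have "card ((\<lambda>m. ?k * m) ` ?S) = rough_count (real N / real ?k) q"
    unfolding rough_count_def using k by (intro card_image) (auto simp: inj_on_def)
  finally have "real (rough_count (real N / real ?k) q) / real N \<le> real (card ({1..N} \<inter> ?v -` {a})) / real N"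
    by (intro divide_right_mono) auto
  also have "\<dots> = pmf (map_pmf ?v (pmf_of_set {1..N})) a"
    using N by (simp add: pmf_map measure_pmf_of_set)
  finally show ?thesis .
qed

lemma t_exp_minus_le: "(t::real) * exp (- t / 16) \<le> 16"
proof -
  have "t / 16 \<le> exp (t / 16)" using exp_ge_add_one_self[of "t / 16"] by linarith
  then have "t / 16 * exp (- t / 16) \<le> exp (t / 16) * exp (- t / 16)" by (intro mult_right_mono) auto
  then show ?thesis by (simp flip: exp_add)
qed

text \<open>The tangent at \<open>exp (lam - 2)\<close> replaces \<open>decay\<close> by a pure
  power of \<open>z\<close>, which can be averaged when \<open>z = N / k\<close>. The condition on
  \<open>lam\<close> brings \<open>z powr (7 / 8)\<close> below 16 times the same quantity, hence
  17; Mertens's lower bound makes the error relative.\<close>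

lemma sieve_error_relative:
  "\<exists>M\<ge>1. \<forall>(q::nat) (z::real) (lam::real). 2 \<le> q \<longrightarrow> real q \<le> z \<longrightarrow> 0 \<le> lam \<longrightarrow> lam \<le> ln (real q) / 16 \<longrightarrow>
    \<bar>sieve_error z q\<bar> \<le> z * mertens_prod q * (M * exp (exp (lam - 2)) * z powr (- lam / ln (real q)))"
proof -
  obtain K where K: "K > 0" "\<And>q z. 2 \<le> q \<Longrightarrow> real q \<le> z \<Longrightarrow>
    \<bar>sieve_error z q\<bar> \<le> K * (z / ln (real q) * decay (ln z / ln (real q)) + z powr (7 / 8))"
    using sieve_error_bound by blast
  obtain C where C: "C > 0" "\<And>q. q \<ge> 2 \<Longrightarrow> 1 / ln (real q) \<le> C * mertens_prod q"
    using mertens_prod_lower by auto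
  define M where "M = max 1 (17 * K * C)"
  have "\<bar>sieve_error z q\<bar> \<le> z * mertens_prod q * (M * exp (exp (lam - 2)) * z powr (- lam / ln (real q)))"
    if q: "2 \<le> q" and zq: "real q \<le> z" and lm: "0 \<le> lam" "lam \<le> ln (real q) / 16" for q z lam
  proof -
    define L where "L = ln (real q)"
    define w where "w = ln z / L"
    define X where "X = exp (exp (lam - 2)) * exp (- lam * w)"
    have L: "L > 0" using q by (simp add: L_def)
    have z: "z \<ge> 2" using q zq by linarith
    have lz: "ln z = w * L" using L by (simp add: w_def)
    have w1: "w \<ge> 1" using L zq q by (simp add: w_def L_def)
    have "decay w \<le> decay (exp (lam - 2)) * exp (- (ln (exp (lam - 2)) + 2) * (w - exp (lam - 2)))"
      using w1 by (intro decay_tangent) auto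
    also have "\<dots> = X" by (simp add: decay_def X_def algebra_simps flip: exp_add)
    finally have 1: "decay w \<le> X" .
    have zp: "z powr (7 / 8) = z / L * (L * exp (- (L * w) / 8))"
    proof -
      have "z = exp (w * L)" using z lz exp_ln[of z] by simp
      then have "z / L * (L * exp (- (L * w) / 8)) = exp (w * L) * exp (- (L * w) / 8)" using L by simp
      also have "\<dots> = exp (7 / 8 * (w * L))" by (simp add: algebra_simps flip: exp_add)
      finally show ?thesis using z lz by (simp add: powr_def)
    qed
    have "L * exp (- (L * w) / 8) \<le> 16 * X"
    proof -
      have "L * exp (- (L * w) / 8) = L * exp (- (L / 8 - lam) * w) * exp (- lam * w)"
        by (simp add: algebra_simps flip: exp_add)
      also have "\<dots> \<le> L * exp (- L / 16) * exp (- lam * w)"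
      proof -
        have "L / 16 * 1 \<le> (L / 8 - lam) * w" using lm w1 L by (intro mult_mono) (auto simp: L_def)
        then have "- (L / 8 - lam) * w \<le> - L / 16" by linarith
        then show ?thesis using L by (intro mult_right_mono mult_left_mono) (auto simp only: exp_le_cancel_iff, auto)
      qed
      also have "\<dots> \<le> 16 * exp (- lam * w)" using t_exp_minus_le[of L] by (intro mult_right_mono) auto
      also have "\<dots> \<le> 16 * X" unfolding X_def by simp
      finally show ?thesis .
    qed
    then have 2: "z powr (7 / 8) \<le> z / L * (16 * X)" unfolding zp using z L by (intro mult_left_mono) auto
    have X0: "X > 0" by (simp add: X_def)
    have "\<bar>sieve_error z q\<bar> \<le> K * (z / L * decay w + z powr (7 / 8))" using K(2)[OF q zq] by (simp add: L_def w_def)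
    also have "\<dots> \<le> K * (z / L * X + z / L * (16 * X))"
      using 1 2 K z L by (intro mult_left_mono add_mono) auto
    also have "\<dots> = 17 * K * z * X * (1 / L)" by (simp add: algebra_simps)
    also have "\<dots> \<le> 17 * K * z * X * (C * mertens_prod q)"
      using C(2)[OF q] K z X0 by (intro mult_left_mono) (auto simp: L_def)
    also have "\<dots> = z * mertens_prod q * (17 * K * C * X)" by simp
    also have "\<dots> \<le> z * mertens_prod q * (M * X)"
      using z X0 mertens_prod_pos[of q] by (intro mult_left_mono mult_right_mono) (auto simp: M_def)
    also have "M * X = M * exp (exp (lam - 2)) * z powr (- lam / L)"
      using z L by (simp add: X_def powr_def w_def)
    finally show ?thesis by (simp add: L_def)
  qed
  moreover have "M \<ge> 1" by (simp add: M_def)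
  ultimately show ?thesis by blast
qed

text \<open>The factor \<open>exp lam\<close> covers \<open>N / k < q\<close>, where the sieve says
  nothing: there the power is at least \<open>exp (- lam)\<close>, so the claimed relative deficit
  exceeds the trivial value 1.\<close>

lemma valuation_deficit:
  "\<exists>M\<ge>1. \<forall>(q::nat) (N::nat) (lam::real) a. 2 \<le> q \<longrightarrow> 1 \<le> N \<longrightarrow> 0 \<le> lam \<longrightarrow> lam \<le> ln (real q) / 16 \<longrightarrow>
    a \<in> set_pmf (prime_model q) \<longrightarrow>
    pmf (prime_model q) a \<le> pmf (map_pmf (valuation_vector {p. prime p \<and> p < q}) (pmf_of_set {1..N})) a
      + M * exp (lam + exp (lam - 2)) * (real (smooth_number q a) / real N) powr (lam / ln (real q)) * pmf (prime_model q) a"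
proof -
  obtain M where M: "M \<ge> 1" "\<And>q z lam. 2 \<le> q \<Longrightarrow> real q \<le> z \<Longrightarrow> 0 \<le> lam \<Longrightarrow> lam \<le> ln (real q) / 16 \<Longrightarrow>
    \<bar>sieve_error z q\<bar> \<le> z * mertens_prod q * (M * exp (exp (lam - 2)) * z powr (- lam / ln (real q)))"
    using sieve_error_relative by blast
  have "pmf (prime_model q) a \<le> pmf (map_pmf (valuation_vector {p. prime p \<and> p < q}) (pmf_of_set {1..N})) a
      + M * exp (lam + exp (lam - 2)) * (real (smooth_number q a) / real N) powr (lam / ln (real q)) * pmf (prime_model q) a"
    if q: "2 \<le> q" and N: "1 \<le> N" and lm: "0 \<le> lam" "lam \<le> ln (real q) / 16" and a: "a \<in> set_pmf (prime_model q)"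
    for q N lam a
  proof -
    let ?P = "map_pmf (valuation_vector {p. prime p \<and> p < q}) (pmf_of_set {1..N})" and ?Q = "prime_model q"
    define k where "k = real (smooth_number q a)"
    define z where "z = real N / k"
    define \<psi> where "\<psi> = M * exp (lam + exp (lam - 2)) * (k / real N) powr (lam / ln (real q))"
    have k: "k > 0" using smooth_number_pos[of q a] by (simp add: k_def)
    have N0: "real N > 0" using N by simp
    have z: "z > 0" using k N0 by (simp add: z_def)
    have Lq: "ln (real q) > 0" using q by simp
    have zk: "(k / real N) powr (lam / ln (real q)) = z powr (- lam / ln (real q))"
      using k N0 by (simp add: z_def powr_def ln_div algebra_simps)
    have Q: "pmf ?Q a = mertens_prod q / k"
      unfolding k_def using set_prime_model[OF a] by (intro pmf_prime_model) blast
    have "pmf ?Q a \<le> pmf ?P a + \<psi> * pmf ?Q a"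
    proof (cases "real q \<le> z")
      case True
      have "\<bar>sieve_error z q\<bar> \<le> z * mertens_prod q * (M * exp (exp (lam - 2)) * z powr (- lam / ln (real q)))"
        by (rule M(2)[OF q True lm])
      also have "M * exp (exp (lam - 2)) * z powr (- lam / ln (real q)) \<le> \<psi>"
        unfolding \<psi>_def zk using M(1) lm by (intro mult_right_mono mult_left_mono) auto
      finally have "\<bar>sieve_error z q\<bar> \<le> z * mertens_prod q * \<psi>"
        using z mertens_prod_pos[of q] by (simp add: mult_left_mono)
      then have "z * mertens_prod q \<le> real (rough_count z q) + \<psi> * (z * mertens_prod q)"
        unfolding sieve_error_def by (simp add: mult.commute)
      then have "z * mertens_prod q / real N \<le> (real (rough_count z q) + \<psi> * (z * mertens_prod q)) / real N"
        by (intro divide_right_mono) auto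
      moreover have "z * mertens_prod q / real N = mertens_prod q / k" using N0 by (simp add: z_def)
      ultimately have "mertens_prod q / k \<le> real (rough_count z q) / real N + \<psi> * (mertens_prod q / k)"
        by (simp add: add_divide_distrib flip: times_divide_eq_right)
      moreover have "real (rough_count z q) / real N \<le> pmf ?P a"
        unfolding z_def k_def using N set_prime_model[OF a] by (intro valuation_pmf_lower) blast+
      ultimately show ?thesis by (simp add: Q)
    next
      case False
      have "ln z \<le> ln (real q)" using False z by (intro ln_mono) auto
      then have "lam / ln (real q) * ln z \<le> lam / ln (real q) * ln (real q)"
        using lm Lq by (intro mult_left_mono) auto
      then have "lam + exp (lam - 2) + (- lam / ln (real q) * ln z) \<ge> 0" 
      proof -
        have "lam / ln (real q) * ln (real q) = lam" using Lq by simp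
        moreover have "- lam / ln (real q) * ln z = - (lam / ln (real q) * ln z)" by simp
        moreover have "exp (lam - 2) > 0" by simp
        ultimately show ?thesis using \<open>_ \<le> lam / ln (real q) * ln (real q)\<close> by linarith
      qed
      then have "1 * 1 \<le> M * exp (lam + exp (lam - 2) + (- lam / ln (real q) * ln z))"
        using M(1) by (intro mult_mono) auto
      also have "\<dots> = \<psi>" unfolding \<psi>_def zk using z by (simp add: powr_def mult.assoc flip: exp_add)
      finally have "1 * pmf ?Q a \<le> \<psi> * pmf ?Q a" by (intro mult_right_mono) auto
      then show ?thesis using pmf_nonneg[of ?P a] by linarith
    qed
    then show ?thesis by (simp add: \<psi>_def k_def)
  qed
  then show ?thesis using M(1) by blast
qed

section \<open>Averaging over the smooth number, and removing the restriction on the ratio\<close>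

lemma kubilius_core:
  "\<exists>C>0. \<forall>(q::nat) (N::nat). 2 \<le> q \<longrightarrow> 1 \<le> N \<longrightarrow> 1 \<le> ln (real N) / ln (real q) \<longrightarrow>
    ln (ln (real N) / ln (real q)) + 1 \<le> ln (real q) / 16 \<longrightarrow>
    dTV (map_pmf (valuation_vector {p. prime p \<and> p < q}) (pmf_of_set {1..N})) (prime_model q)
      \<le> C * exp (- (ln (real N) / ln (real q)) * ln (ln (real N) / ln (real q)) - ln (real N) / ln (real q) / 4)"
proof -
  obtain M where M: "M \<ge> 1" "\<And>q N lam a. 2 \<le> q \<Longrightarrow> 1 \<le> N \<Longrightarrow> 0 \<le> lam \<Longrightarrow> lam \<le> ln (real q) / 16 \<Longrightarrow>
    a \<in> set_pmf (prime_model q) \<Longrightarrow>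
    pmf (prime_model q) a \<le> pmf (map_pmf (valuation_vector {p. prime p \<and> p < q}) (pmf_of_set {1..N})) a
      + M * exp (lam + exp (lam - 2)) * (real (smooth_number q a) / real N) powr (lam / ln (real q)) * pmf (prime_model q) a"
    using valuation_deficit by blast
  define \<eta> :: real where "\<eta> = exp (-1) / 40"
  obtain C1 where C1: "\<And>q \<alpha>. 2 \<le> q \<Longrightarrow> 0 \<le> \<alpha> \<Longrightarrow> \<alpha> \<le> 1 \<Longrightarrow>
      (\<Sum>p | prime p \<and> p < q. (real p powr \<alpha> - 1) / real p) \<le> \<eta> * real q powr \<alpha> + C1"
    using sum_primes_powr_minus_one[of \<eta>] by (auto simp: \<eta>_def)
  define C where "C = M * exp (4 * C1 + ln 8)"
  have "dTV (map_pmf (valuation_vector {p. prime p \<and> p < q}) (pmf_of_set {1..N})) (prime_model q)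
      \<le> C * exp (- v * ln v - v / 4)"
    if q: "2 \<le> q" and N: "1 \<le> N" and vd: "v = ln (real N) / ln (real q)" and v1: "1 \<le> v" and v2: "ln v + 1 \<le> ln (real q) / 16"
    for q N v
  proof -
    define L where "L = ln (real q)"
    \<comment> \<open>This slope gives \<open>exp (- lam * v) = exp (- v * ln v - v)\<close>. Of the
      spare \<open>v\<close>, the tangent constant \<open>exp (lam - 2)\<close> uses at most
      \<open>v / 2\<close>, the factor \<open>exp lam\<close> uses \<open>v / 8\<close> up to a
      constant, and the moment uses \<open>v / 10\<close>: \<open>\<eta>\<close> was chosen to make
      \<open>\<eta> * q powr \<alpha> = v / 40\<close>. More than \<open>v / 4\<close>
      remains.\<close>
    define lam where "lam = ln v + 1"
    define \<alpha> where "\<alpha> = lam / L"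
    define E where "E = M * exp (lam + exp (lam - 2)) * exp (- lam * v)"
    have L: "L > 0" using q by (simp add: L_def)
    have lm: "0 \<le> lam" "lam \<le> L / 16" using v1 v2 by (auto simp: lam_def L_def)
    have a: "0 \<le> \<alpha>" "\<alpha> \<le> 1 / 16" using lm L by (auto simp: \<alpha>_def field_simps)
    have E0: "E > 0" using M(1) by (simp add: E_def)
    have Na: "(k / real N) powr \<alpha> = exp (- lam * v) * k powr \<alpha>" if "k > 0" for k
      using that N by (simp add: powr_def ln_div \<alpha>_def vd L_def algebra_simps diff_divide_distrib flip: exp_add)
    have "dTV (map_pmf (valuation_vector {p. prime p \<and> p < q}) (pmf_of_set {1..N})) (prime_model q)
      \<le> E * exp (4 * (v / 40 + C1))"
    proof (rule dTV_le_density_deficit)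
      fix v' assume "v' \<in> set_pmf (prime_model q)"
      from M(2)[OF q N lm(1) _ this] lm(2)
      show "pmf (prime_model q) v' \<le> pmf (map_pmf (valuation_vector {p. prime p \<and> p < q}) (pmf_of_set {1..N})) v'
        + (E * real (smooth_number q v') powr \<alpha>) * pmf (prime_model q) v'"
        using Na[of "real (smooth_number q v')"] smooth_number_pos[of q v']
        by (simp add: E_def L_def \<alpha>_def mult_ac)
    next
      have "(\<integral>\<^sup>+v'. ennreal (E * real (smooth_number q v') powr \<alpha>) \<partial>measure_pmf (prime_model q))
        = ennreal E * (\<integral>\<^sup>+v'. ennreal (real (smooth_number q v') powr \<alpha>) \<partial>measure_pmf (prime_model q))"
        using E0 by (simp add: ennreal_mult nn_integral_cmult)
      also have "\<dots> \<le> ennreal E * ennreal (exp (4 * (v / 40 + C1)))"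
      proof (rule mult_left_mono)
        have "real q powr \<alpha> = exp 1 * v" using q v1 L by (simp add: powr_def \<alpha>_def L_def lam_def exp_add)
        then have "\<eta> * real q powr \<alpha> = v / 40" by (simp add: \<eta>_def exp_minus)
        then have "(\<Sum>p | prime p \<and> p < q. (real p powr \<alpha> - 1) / real p) \<le> v / 40 + C1"
          using C1[OF q a(1)] a(2) by simp
        then have "ennreal (exp (4 * (\<Sum>p | prime p \<and> p < q. (real p powr \<alpha> - 1) / real p)))
            \<le> ennreal (exp (4 * (v / 40 + C1)))" by (intro ennreal_leI) simp
        then show "(\<integral>\<^sup>+v'. ennreal (real (smooth_number q v') powr \<alpha>) \<partial>measure_pmf (prime_model q))
          \<le> ennreal (exp (4 * (v / 40 + C1)))"
          using prime_model_moment_bound[of \<alpha> q] a by (auto intro: order_trans)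
      qed simp
      also have "\<dots> = ennreal (E * exp (4 * (v / 40 + C1)))" using E0 by (simp add: ennreal_mult)
      finally show "(\<integral>\<^sup>+v'. ennreal (E * real (smooth_number q v') powr \<alpha>) \<partial>measure_pmf (prime_model q))
        \<le> ennreal (E * exp (4 * (v / 40 + C1)))" .
    qed (use E0 in auto)
    also have "E * exp (4 * (v / 40 + C1)) = M * exp (lam + exp (lam - 2) - lam * v + 4 * (v / 40 + C1))"
      by (simp add: E_def mult.assoc flip: exp_add)
    also have "\<dots> \<le> M * exp (4 * C1 + ln 8 + (- v * ln v - v / 4))"
    proof -
      have "exp (lam - 2) = exp (-1) * v" 
      proof -
        have "exp (lam - 2) = exp (-1 + ln v)" by (simp add: lam_def)
        then show ?thesis using v1 by (simp only: exp_add) simp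
      qed
      also have "\<dots> \<le> 1 / 2 * v"
      proof (rule mult_right_mono)
        have "exp 1 \<ge> (2::real)" using exp_ge_add_one_self[of 1] by simp
        then show "exp (-1) \<le> (1 / 2 :: real)" by (simp add: exp_minus field_simps)
      qed (use v1 in auto)
      finally have 1: "exp (lam - 2) \<le> v / 2" by simp
      have "ln (v / 8) \<le> v / 8 - 1" using v1 by (intro ln_le_minus_one) auto
      then have 2: "ln v \<le> v / 8 - 1 + ln 8" using v1 by (simp add: ln_div)
      have 3: "lam * v = v * ln v + v" by (simp add: lam_def algebra_simps)
      have "lam + exp (lam - 2) - lam * v + 4 * (v / 40 + C1) \<le> 4 * C1 + ln 8 + (- v * ln v - v / 4)"
        unfolding 3 using 1 2 v1 by (simp add: lam_def)
      then show ?thesis using M(1) by (intro mult_left_mono) auto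
    qed
    also have "\<dots> = C * exp (- v * ln v - v / 4)" by (simp add: C_def exp_add exp_diff)
    finally show ?thesis .
  qed
  moreover have "C > 0" using M(1) by (simp add: C_def)
  ultimately show ?thesis by (intro exI[of _ C]) auto
qed

text \<open>Rounding \<open>x\<close> and \<open>y\<close> to integers may lower the ratio by up to
  1, which costs a factor of order \<open>u\<close>; the spare \<open>exp (- v / 4)\<close> pays for
  it.\<close>

lemma decay_shift:
  fixes u v :: real
  assumes u: "u \<ge> 3" and v: "u - 1 \<le> v"
  shows "exp (- v * ln v - v / 4) \<le> exp 3 * u powr (- u)"
proof -
  have "(u - 1) * ln (u - 1) \<le> v * ln v" using u v by (intro mult_mono ln_mono) auto
  moreover have "(u - 1) * ln u - 1 \<le> (u - 1) * ln (u - 1)"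
  proof -
    have "ln (u / (u - 1)) \<le> u / (u - 1) - 1" using u by (intro ln_le_minus_one) auto
    then have "ln u - ln (u - 1) \<le> 1 / (u - 1)" using u by (simp add: ln_div field_simps)
    then have "(u - 1) * (ln u - ln (u - 1)) \<le> (u - 1) * (1 / (u - 1))" using u by (intro mult_left_mono) auto
    then show ?thesis using u by (simp add: right_diff_distrib)
  qed
  moreover have "ln u \<le> u / 4 + 1"
  proof -
    have "ln (u / 4) \<le> u / 4 - 1" using u by (intro ln_le_minus_one) auto
    moreover have "ln (4::real) = 2 * ln 2" using ln_realpow[of 2 2] by simp
    moreover have "ln (2::real) \<le> 1" using ln_le_minus_one[of 2] by simp
    ultimately show ?thesis using u by (simp add: ln_div)
  qed
  moreover have "(u - 1) * ln u = u * ln u - ln u" by (simp add: algebra_simps)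
  ultimately have "- v * ln v - v / 4 \<le> 3 + (- u * ln u)" using v by simp
  then have "exp (- v * ln v - v / 4) \<le> exp (3 + (- u * ln u))" by simp
  also have "\<dots> = exp 3 * u powr (- u)" using u by (simp add: powr_def exp_add exp_diff exp_minus field_simps)
  finally show ?thesis .
qed

text \<open>The hypothesis \<open>ln x / ln y \<le> ln y\<close> makes the slope admissible:
  \<open>ln v + 1 \<le> ln (ln y) + 1 \<le> ln q / 16\<close> once \<open>ln y\<close> is
  large.\<close>

lemma kubilius_moderate:
  "\<exists>C>0. \<exists>l0\<ge>8. \<forall>x y::real. 0 < x \<longrightarrow> 0 < y \<longrightarrow> l0 \<le> ln y \<longrightarrow> 3 \<le> ln x / ln y \<longrightarrow> ln x / ln y \<le> ln y \<longrightarrow>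
    (\<exists>q. y < real q \<and> dTV (map_pmf (valuation_vector {p. prime p \<and> p < q}) (pmf_of_set {1..nat \<lfloor>x\<rfloor>})) (prime_model q)
      \<le> C * (ln x / ln y) powr (- (ln x / ln y)))"
proof -
  obtain C where C: "C > 0" "\<And>q N. 2 \<le> q \<Longrightarrow> 1 \<le> N \<Longrightarrow> 1 \<le> ln (real N) / ln (real q) \<Longrightarrow>
    ln (ln (real N) / ln (real q)) + 1 \<le> ln (real q) / 16 \<Longrightarrow>
    dTV (map_pmf (valuation_vector {p. prime p \<and> p < q}) (pmf_of_set {1..N})) (prime_model q)
      \<le> C * exp (- (ln (real N) / ln (real q)) * ln (ln (real N) / ln (real q)) - ln (real N) / ln (real q) / 4)"
    using kubilius_core by blast
  have "eventually (\<lambda>t::real. ln t + 1 \<le> t / 16) at_top" by real_asymp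
  then obtain t0 where t0: "\<And>t::real. t \<ge> t0 \<Longrightarrow> ln t + 1 \<le> t / 16"
    by (auto simp: eventually_at_top_linorder)
  define l0 where "l0 = max 8 t0"
  have "\<exists>q. y < real q \<and> dTV (map_pmf (valuation_vector {p. prime p \<and> p < q}) (pmf_of_set {1..nat \<lfloor>x\<rfloor>})) (prime_model q)
      \<le> (C * exp 3) * u powr (- u)"
    if x: "0 < x" and y: "0 < y" and ly: "l0 \<le> ln y" and ud: "u = ln x / ln y" and u: "3 \<le> u" "u \<le> ln y" for x y u :: real
  proof -
    define q where "q = nat \<lfloor>y\<rfloor> + 1"
    define N where "N = nat \<lfloor>x\<rfloor>"
    define v where "v = ln (real N) / ln (real q)"
    have ly8: "ln y \<ge> 8" "ln y \<ge> t0" using ly by (auto simp: l0_def)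
    have y9: "y \<ge> 9" using ly8 ln_le_minus_one[of y] y by linarith
    have lx: "ln x = u * ln y" using ly8 by (simp add: ud)
    have "3 * 8 \<le> ln x" unfolding lx using u ly8 by (intro mult_mono) auto
    then have x9: "x \<ge> 9" using ln_le_minus_one[of x] x by linarith
    have q: "y < real q" "real q \<le> 2 * y" "q \<ge> 2" using y9 unfolding q_def by linarith+
    have N: "x / 2 \<le> real N" "real N \<le> x" "N \<ge> 1" using x9 unfolding N_def by linarith+
    have lq: "ln y \<le> ln (real q)" "ln (real q) \<le> ln y + ln 2"
    proof -
      show "ln y \<le> ln (real q)" using q y by (intro ln_mono) auto
      have "ln (real q) \<le> ln (2 * y)" using q y by (intro ln_mono) auto
      then show "ln (real q) \<le> ln y + ln 2" using y by (simp add: ln_mult)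
    qed
    have lN: "ln x - ln 2 \<le> ln (real N)" "ln (real N) \<le> ln x"
    proof -
      have "ln (x / 2) \<le> ln (real N)" using N x by (intro ln_mono) auto
      then show "ln x - ln 2 \<le> ln (real N)" using x by (simp add: ln_div)
      show "ln (real N) \<le> ln x" using N x by (intro ln_mono) auto
    qed
    have lq0: "ln (real q) > 0" using lq ly8 by linarith
    have ln2: "ln (2::real) \<le> 1" "ln (2::real) \<ge> 0" using ln_le_minus_one[of 2] by auto
    have v: "u - 1 \<le> v"
    proof -
      have "(u - 1) * ln (real q) \<le> (u - 1) * (ln y + ln 2)" using u lq by (intro mult_left_mono) auto
      also have "\<dots> = ln x - ln y + u * ln 2 - ln 2" by (simp add: lx algebra_simps)
      also have "u * ln 2 \<le> u * 1" using u ln2 by (intro mult_left_mono) auto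
      finally have "(u - 1) * ln (real q) \<le> ln (real N)" using lN u by simp
      then show ?thesis using lq0 by (simp add: v_def pos_le_divide_eq)
    qed
    have vu: "v \<le> ln y"
    proof -
      have "v \<le> ln x / ln y" unfolding v_def using lN lq ly8 N by (intro frac_le) auto
      then show ?thesis using u ud by simp
    qed
    have "ln v + 1 \<le> ln (ln y) + 1" using v u vu by (simp add: ln_mono)
    also have "\<dots> \<le> ln y / 16" using t0 ly8 by simp
    also have "\<dots> \<le> ln (real q) / 16" using lq by simp
    finally have lv: "ln v + 1 \<le> ln (real q) / 16" .
    have "1 \<le> v" using v u by linarith
    from C(2)[OF q(3) N(3), folded v_def, OF this lv]
    have "dTV (map_pmf (valuation_vector {p. prime p \<and> p < q}) (pmf_of_set {1..N})) (prime_model q)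
      \<le> C * exp (- v * ln v - v / 4)" .
    also have "\<dots> \<le> C * (exp 3 * u powr (- u))" using C(1) u v by (intro mult_left_mono decay_shift) auto
    finally show ?thesis using q(1) by (intro exI[of _ q]) (simp add: N_def)
  qed
  moreover have "C * exp 3 > 0" "l0 \<ge> 8" using C(1) by (auto simp: l0_def)
  ultimately show ?thesis by blast
qed

theorem kubilius:
  "\<exists>C>0. \<forall>x y::real. 2 \<le> y \<longrightarrow> y \<le> x \<longrightarrow>
    (\<exists>q. y < real q \<and> dTV (map_pmf (valuation_vector {p. prime p \<and> p < q}) (pmf_of_set {1..nat \<lfloor>x\<rfloor>})) (prime_model q)
      \<le> C * ((ln x / ln y) powr (- (ln x / ln y)) + 1 / y\<^sup>2))"
proof -
  obtain C l0 where C: "C > 0" and l0: "l0 \<ge> 8" and *: "\<And>x y::real. 0 < x \<Longrightarrow> 0 < y \<Longrightarrow> l0 \<le> ln y \<Longrightarrow>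
    3 \<le> ln x / ln y \<Longrightarrow> ln x / ln y \<le> ln y \<Longrightarrow>
    (\<exists>q. y < real q \<and> dTV (map_pmf (valuation_vector {p. prime p \<and> p < q}) (pmf_of_set {1..nat \<lfloor>x\<rfloor>})) (prime_model q)
      \<le> C * (ln x / ln y) powr (- (ln x / ln y)))"
    using kubilius_moderate by blast
  \<comment> \<open>\<open>27 = 3 powr 3\<close> and \<open>exp (2 * l0)\<close> make the right-hand
    side at least 1 when \<open>u < 3\<close> or \<open>ln y < l0\<close>; the distance never
    exceeds 1.\<close>
  define D where "D = max C (max 27 (exp (2 * l0)))"
  have D: "D \<ge> C" "D \<ge> 27" "D \<ge> exp (2 * l0)" unfolding D_def by linarith+
  have "\<exists>q. y < real q \<and> dTV (map_pmf (valuation_vector {p. prime p \<and> p < q}) (pmf_of_set {1..nat \<lfloor>x\<rfloor>})) (prime_model q)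
      \<le> D * (u powr (- u) + 1 / y\<^sup>2)"
    if y: "2 \<le> y" and xy: "y \<le> x" and u: "u = ln x / ln y" for x y u :: real
  proof -
    have y0: "y > 0" and x0: "x > 0" using y xy by auto
    have ly: "ln y > 0" using y by simp
    have u1: "u \<ge> 1" unfolding u using ly xy y by simp
    have pw: "u powr (- u) \<ge> 0" by simp
    have y2: "1 / y\<^sup>2 = exp (- 2 * ln y)" 
    proof -
      have "exp (- 2 * ln y) = y powr (- 2)" using y0 by (simp add: powr_def)
      also have "\<dots> = 1 / y\<^sup>2" using y0 by (simp add: powr_minus_divide)
      finally show ?thesis by simp
    qed
    have triv: "\<exists>q. y < real q \<and> dTV (map_pmf (valuation_vector {p. prime p \<and> p < q}) (pmf_of_set {1..nat \<lfloor>x\<rfloor>})) (prime_model q)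
      \<le> D * (u powr (- u) + 1 / y\<^sup>2)" if "1 \<le> D * (u powr (- u) + 1 / y\<^sup>2)"
    proof -
      obtain q :: nat where "y < real q" using reals_Archimedean2 by blast
      then show ?thesis using order_trans[OF dTV_le_1 that] by blast
    qed
    consider "ln y < l0" | "u < 3" | "l0 \<le> ln y" "3 \<le> u" "u \<le> ln y" | "l0 \<le> ln y" "u > ln y" by linarith
    then show ?thesis
    proof cases
      case 1
      have "1 = exp (2 * l0) * exp (- 2 * l0)" by (simp flip: exp_add)
      also have "\<dots> \<le> D * (1 / y\<^sup>2)" unfolding y2 using 1 D by (intro mult_mono) auto
      also have "\<dots> \<le> D * (u powr (- u) + 1 / y\<^sup>2)" using D pw by (intro mult_left_mono) auto
      finally show ?thesis by (rule triv)
    next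
      case 2
      have "u powr u \<le> 3 powr u" using u1 2 by (intro powr_mono2) auto
      also have "\<dots> \<le> 3 powr 3" using 2 by (intro powr_mono) auto
      also have "\<dots> = 27" by simp
      finally have "1 / 27 \<le> u powr (- u)" using u1 by (simp add: powr_minus_divide field_simps)
      then have "27 * (1 / 27) \<le> D * (u powr (- u))" using D by (intro mult_mono) auto
      also have "\<dots> \<le> D * (u powr (- u) + 1 / y\<^sup>2)" using D by (intro mult_left_mono) auto
      finally show ?thesis by (intro triv) simp
    next
      case 3
      then obtain q where q: "y < real q"
        "dTV (map_pmf (valuation_vector {p. prime p \<and> p < q}) (pmf_of_set {1..nat \<lfloor>x\<rfloor>})) (prime_model q) \<le> C * u powr (- u)"
        using *[OF x0 y0] u by auto
      note q(2)
      also have "C * u powr (- u) \<le> D * (u powr (- u) + 1 / y\<^sup>2)" using D C by (intro mult_mono) auto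
      finally show ?thesis using q(1) by blast
    next
      case 4
      \<comment> \<open>Replacing \<open>y\<close> by \<open>exp s\<close> makes the ratio equal to
        \<open>s\<close> again, so the moderate case applies at its very boundary. Since
        \<open>s \<ge> ln y\<close> and \<open>ln s \<ge> 2\<close>, its error
        \<open>s powr (- s)\<close> is at most \<open>1 / y\<^sup>2\<close>.\<close>
      define s where "s = sqrt (ln x)"
      have lx: "ln x = u * ln y" using ly by (simp add: u)
      have "ln y * ln y \<le> u * ln y" using 4 ly by (intro mult_right_mono) auto
      then have s: "s \<ge> ln y" unfolding s_def by (intro real_le_rsqrt) (simp add: lx power2_eq_square)
      have s0: "s > 0" using s ly by linarith
      have "ln x / s = s" unfolding s_def using ly u1 by (simp add: lx real_div_sqrt)
      then have us: "ln x / ln (exp s) = s" by simp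
      obtain q where q: "exp s < real q"
        "dTV (map_pmf (valuation_vector {p. prime p \<and> p < q}) (pmf_of_set {1..nat \<lfloor>x\<rfloor>})) (prime_model q) \<le> C * s powr (- s)"
        using *[of x "exp s"] x0 s 4 l0 unfolding us by auto
      have yq: "y < real q"
      proof -
        have "y = exp (ln y)" using y0 by simp
        also have "\<dots> \<le> exp s" using s by simp
        finally show ?thesis using q(1) by simp
      qed
      have "s powr (- s) \<le> exp (- 2 * ln y)"
      proof -
        have "exp 2 \<le> s" using exp_2_le_8 s 4 l0 by linarith
        then have "2 \<le> ln s" using s0 by (simp add: ln_ge_iff)
        then have "ln y * 2 \<le> s * ln s" using s s0 by (intro mult_mono) auto
        then show ?thesis using s0 by (simp add: powr_def)
      qed
      then have "C * s powr (- s) \<le> D * (u powr (- u) + 1 / y\<^sup>2)"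
        unfolding y2 using D C by (intro mult_mono add_increasing) auto
      then show ?thesis using q(2) yq by (intro exI[of _ q]) auto
    qed
  qed
  moreover have "D > 0" using D by linarith
  ultimately show ?thesis by blast
qed

section \<open>Poisson approximation\<close>

lemma pmf_nat_sums_1: "(\<lambda>n. pmf (p :: nat pmf) n) sums 1"
proof -
  have "integrable (count_space UNIV) (pmf p)" by (rule integrable_pmf)
  from sums_integral_count_space_nat[OF this] show ?thesis
    using integral_pmf[of UNIV p] by simp
qed

lemma expectation_nat_sums:
  fixes f :: "nat \<Rightarrow> real"
  assumes "integrable (measure_pmf p) f"
  shows "(\<lambda>n. pmf p n * f n) sums measure_pmf.expectation p f"
proof -
  have "integrable (count_space UNIV) (\<lambda>n. pmf p n * f n)"
    using assms unfolding measure_pmf_eq_density by (subst (asm) integrable_density) auto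
  from sums_integral_count_space_nat[OF this] show ?thesis
    by (simp add: measure_pmf_eq_density integral_density)
qed

section \<open>Stein's equation for the Poisson law\<close>

lemma poisson_pmf_Suc: "l > 0 \<Longrightarrow> real (Suc k) * pmf (poisson_pmf l) (Suc k) = l * pmf (poisson_pmf l) k"
  by (simp add: field_simps del: of_nat_Suc)

lemma poisson_log_concave:
  assumes l: "l > 0" and ij: "i \<le> j"
  shows "pmf (poisson_pmf l) i * pmf (poisson_pmf l) (Suc j) \<le> pmf (poisson_pmf l) (Suc i) * pmf (poisson_pmf l) j"
proof -
  let ?p = "pmf (poisson_pmf l)"
  have 1: "?p (Suc k) = l * ?p k / real (Suc k)" for k
    using poisson_pmf_Suc[OF l, of k] by (simp add: field_simps del: pmf_poisson)
  have "?p i * ?p j * l / real (Suc j) \<le> ?p i * ?p j * l / real (Suc i)"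
    using l ij by (intro divide_left_mono mult_nonneg_nonneg) auto
  then show ?thesis unfolding 1 by (simp only: mult_ac times_divide_eq_right times_divide_eq_left)
qed

text \<open>The value \<open>h k\<close> is the classical
  \<open>(P(A \<inter> {..k}) - P(A) * P({..k})) / (l * \<pi> k)\<close>, rewritten so that
  monotonicity becomes visible: log-concavity makes \<open>a\<close> decreasing and \<open>b\<close>
  increasing, so in \<open>h (Suc k) - h k\<close> only a possible atom of \<open>A\<close> at
  \<open>Suc k\<close> counts positively, by at most \<open>S\<close>. Finally
  \<open>l * S \<le> 1 - exp (- l)\<close> bounds both \<open>S\<close> and \<open>l * S\<close> by
  1.\<close>

lemma stein_solution:
  fixes l :: real and A :: "nat set"
  assumes l: "l > 0"
  shows "\<exists>g B. (\<forall>k. \<bar>g k\<bar> \<le> B) \<and> (\<forall>k. \<bar>g (Suc k) - g k\<bar> \<le> 2 / (1 + l)) \<and>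
    (\<forall>k. l * g (Suc k) - real k * g k = indicator A k - measure_pmf.prob (poisson_pmf l) A)"
proof -
  define \<pi> where "\<pi> = pmf (poisson_pmf l)"
  define F where "F k = (\<Sum>i\<le>k. \<pi> i)" for k
  define T where "T k = 1 - F k" for k
  define PA where "PA = measure_pmf.prob (poisson_pmf l) A"
  define G where "G k = measure_pmf.prob (poisson_pmf l) (A \<inter> {..k})" for k
  define Q where "Q k = measure_pmf.prob (poisson_pmf l) (A \<inter> {k<..})" for k
  define a where "a k = T k / (l * \<pi> k)" for k
  define b where "b k = F k / (l * \<pi> k)" for k
  define h where "h k = a k * G k - b k * Q k" for k
  \<comment> \<open>In Stein's equation \<open>g 0\<close> has coefficient 0; setting it equal to
    \<open>g 1\<close> makes the first difference vanish.\<close>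
  define g where "g k = (case k of 0 \<Rightarrow> h 0 | Suc j \<Rightarrow> h j)" for k
  have pos: "\<pi> k > 0" for k using l by (simp add: \<pi>_def)
  have nn: "l * \<pi> k > 0" for k using pos l by simp
  have Suc: "real (Suc k) * \<pi> (Suc k) = l * \<pi> k" for k unfolding \<pi>_def by (rule poisson_pmf_Suc[OF l])
  have Fprob: "F k = measure_pmf.prob (poisson_pmf l) {..k}" for k
    by (simp add: F_def \<pi>_def measure_measure_pmf_finite)
  have FSuc: "F (Suc k) = F k + \<pi> (Suc k)" for k by (simp add: F_def)
  have TSuc: "T k = T (Suc k) + \<pi> (Suc k)" for k by (simp add: T_def FSuc)
  have Tprob: "T k = measure_pmf.prob (poisson_pmf l) {k<..}" for k
  proof -
    have "UNIV - {..k} = {k<..}" by auto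
    then show ?thesis using measure_pmf.prob_compl[of "{..k}" "poisson_pmf l"] by (simp add: T_def Fprob)
  qed
  have GQ: "PA = G k + Q k" for k
  proof -
    have "A = (A \<inter> {..k}) \<union> (A \<inter> {k<..})" by auto
    then show ?thesis unfolding PA_def G_def Q_def
      by (metis (no_types, lifting) Int_assoc inf_commute measure_pmf.finite_measure_Union sets_measure_pmf UNIV_I Int_empty_right disjoint_iff atMost_iff greaterThan_iff not_le IntD2)
  qed
  define r where "r k = (if k \<in> A then \<pi> k else 0)" for k
  have GSuc: "G (Suc k) = G k + r (Suc k)" for k
  proof -
    have "A \<inter> {..Suc k} = (if Suc k \<in> A then insert (Suc k) (A \<inter> {..k}) else A \<inter> {..k})" by (auto simp: le_Suc_eq)
    then show ?thesis by (simp add: G_def r_def \<pi>_def measure_measure_pmf_finite)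
  qed
  have QSuc: "Q k = Q (Suc k) + r (Suc k)" for k using GQ[of k] GQ[of "Suc k"] GSuc[of k] by simp
  have rb: "0 \<le> r k" "r k \<le> \<pi> k" for k using pos[of k] by (auto simp: r_def)
  have GF: "0 \<le> G k" "G k \<le> F k" for k unfolding Fprob G_def by (auto intro!: measure_pmf.finite_measure_mono)
  have QT: "0 \<le> Q k" "Q k \<le> T k" for k unfolding Tprob Q_def by (auto intro!: measure_pmf.finite_measure_mono)
  have F0: "0 \<le> F k" "F k \<le> 1" for k unfolding Fprob by auto
  have T0: "0 \<le> T k" for k unfolding Tprob by auto
  have lc: "\<pi> i * \<pi> (Suc j) \<le> \<pi> (Suc i) * \<pi> j" if "i \<le> j" for i j
    unfolding \<pi>_def by (rule poisson_log_concave[OF l that])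
  have Tsums: "(\<lambda>i. \<pi> (i + Suc k)) sums T k" for k
  proof -
    have "(\<lambda>i. \<pi> i) sums 1" unfolding \<pi>_def by (rule pmf_nat_sums_1)
    then show ?thesis by (subst sums_iff_shift) (simp add: T_def F_def lessThan_Suc_atMost)
  qed
  have adec: "a (Suc k) \<le> a k" for k
  proof -
    have "\<pi> k * T (Suc k) \<le> \<pi> (Suc k) * T k"
    proof (rule sums_le)
      show "\<pi> k * \<pi> (i + Suc (Suc k)) \<le> \<pi> (Suc k) * \<pi> (i + Suc k)" for i
        using lc[of k "i + Suc k"] by simp
      show "(\<lambda>i. \<pi> k * \<pi> (i + Suc (Suc k))) sums (\<pi> k * T (Suc k))" by (rule sums_mult[OF Tsums])
      show "(\<lambda>i. \<pi> (Suc k) * \<pi> (i + Suc k)) sums (\<pi> (Suc k) * T k)" by (rule sums_mult[OF Tsums])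
    qed
    then show ?thesis unfolding a_def using pos[of k] pos[of "Suc k"] l by (simp add: field_simps)
  qed
  \<comment> \<open>Keeping \<open>- \<pi> 0\<close> turns the final bound 1 for
    \<open>l * S\<close> into \<open>1 - exp (- l)\<close>, which is what keeps \<open>S\<close>
    bounded for small \<open>l\<close>.\<close>
  have Fshift: "F k * \<pi> (Suc k) \<le> (F (Suc k) - \<pi> 0) * \<pi> k" for k
  proof -
    have "F k * \<pi> (Suc k) = (\<Sum>i\<le>k. \<pi> i * \<pi> (Suc k))" by (simp add: F_def sum_distrib_right)
    also have "\<dots> \<le> (\<Sum>i\<le>k. \<pi> (Suc i) * \<pi> k)" by (intro sum_mono lc) auto
    also have "\<dots> = (F (Suc k) - \<pi> 0) * \<pi> k"
      unfolding F_def by (subst sum.atMost_Suc_shift) (simp add: sum_distrib_right)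
    finally show ?thesis .
  qed
  have binc: "b k \<le> b (Suc k)" for k
  proof -
    have "F k * \<pi> (Suc k) \<le> F (Suc k) * \<pi> k"
      using Fshift[of k] mult_pos_pos[OF pos[of 0] pos[of k]] by (simp add: left_diff_distrib)
    then show ?thesis unfolding b_def using pos[of k] pos[of "Suc k"] l by (simp add: field_simps)
  qed
  have ab0: "a k \<ge> 0" "b k \<ge> 0" for k unfolding a_def b_def using T0[of k] F0[of k] nn[of k] by auto
  have a_le: "a k \<le> a 0" for k by (induction k) (auto intro: order_trans[OF adec])
  have hb: "\<bar>h k\<bar> \<le> a 0" for k
  proof -
    have "a k * G k \<le> a k * 1" using ab0 GF[of k] F0[of k] by (intro mult_left_mono) auto
    moreover have "b k * Q k \<le> b k * T k" using ab0 QT by (intro mult_left_mono) auto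
    moreover have "b k * T k = F k * a k" by (simp add: a_def b_def)
    moreover have "F k * a k \<le> 1 * a k" using ab0 F0 by (intro mult_right_mono) auto
    moreover have "0 \<le> a k * G k" "0 \<le> b k * Q k" using ab0 GF QT by auto
    ultimately show ?thesis unfolding h_def using a_le[of k] by linarith
  qed
  have hd: "\<bar>h (Suc k) - h k\<bar> \<le> 2 / (1 + l)" for k
  proof -
    define S where "S = (a (Suc k) + b k) * \<pi> (Suc k)"
    have eq: "h (Suc k) - h k = (a (Suc k) - a k) * G k + (b k - b (Suc k)) * Q (Suc k) + (a (Suc k) + b k) * r (Suc k)"
      unfolding h_def GSuc QSuc[of k] by (simp add: algebra_simps)
    have "(a (Suc k) - a k) * G k \<le> 0" using adec[of k] GF by (intro mult_nonpos_nonneg) auto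
    moreover have "(b k - b (Suc k)) * Q (Suc k) \<le> 0" using binc[of k] QT by (intro mult_nonpos_nonneg) auto
    moreover have "(a (Suc k) + b k) * r (Suc k) \<le> S" unfolding S_def using rb ab0 by (intro mult_left_mono) auto
    ultimately have up: "h (Suc k) - h k \<le> S" unfolding eq by linarith
    \<comment> \<open>The negative terms are extreme for \<open>A = UNIV\<close>, where
      \<open>G = F\<close> and \<open>Q = T\<close>. For that set \<open>h\<close> vanishes
      identically, so they then cancel \<open>S\<close> exactly.\<close>
    have "(a (Suc k) - a k) * F k \<le> (a (Suc k) - a k) * G k" using adec[of k] GF by (intro mult_left_mono_neg) auto
    moreover have "(b k - b (Suc k)) * T (Suc k) \<le> (b k - b (Suc k)) * Q (Suc k)"
      using binc[of k] QT by (intro mult_left_mono_neg) auto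
    moreover have "0 \<le> (a (Suc k) + b k) * r (Suc k)" using rb ab0 by (intro mult_nonneg_nonneg) auto
    moreover have "(a (Suc k) - a k) * F k + (b k - b (Suc k)) * T (Suc k) = - S"
    proof -
      have "a (Suc k) * F k - b (Suc k) * T (Suc k) = - (a (Suc k) * \<pi> (Suc k))"
        unfolding a_def b_def FSuc by (simp add: field_simps add_divide_distrib flip: diff_divide_distrib)
      moreover have "- (a k * F k) + b k * T (Suc k) = - (b k * \<pi> (Suc k))"
        unfolding a_def b_def TSuc[of k] by (simp add: field_simps add_divide_distrib flip: diff_divide_distrib)
      ultimately show ?thesis by (simp add: S_def algebra_simps)
    qed
    ultimately have low: "- S \<le> h (Suc k) - h k" unfolding eq by linarith
    have "l * S = T (Suc k) + F k * \<pi> (Suc k) / \<pi> k"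
      unfolding S_def a_def b_def using pos[of k] pos[of "Suc k"] l by (simp add: field_simps)
    also have "F k * \<pi> (Suc k) / \<pi> k \<le> F (Suc k) - \<pi> 0" using Fshift[of k] pos[of k] by (simp add: pos_divide_le_eq)
    also have "T (Suc k) + (F (Suc k) - \<pi> 0) = 1 - exp (- l)" using l by (simp add: T_def \<pi>_def)
    finally have lS: "l * S \<le> 1 - exp (- l)" by simp
    have "1 - exp (- l) \<le> 1" "1 - exp (- l) \<le> l" using exp_ge_add_one_self[of "- l"] by auto
    with lS have "l * S \<le> l" "l * S \<le> 1" by linarith+
    then have "S \<le> 1" "l * S \<le> 1" using l by auto
    then have "S * (1 + l) \<le> 2" by (simp add: algebra_simps)
    then have "S \<le> 2 / (1 + l)" using l by (simp add: pos_le_divide_eq)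
    with up low show ?thesis by linarith
  qed
  have hform: "l * \<pi> k * h k = G k - PA * F k" for k
  proof -
    have "l * \<pi> k * h k = T k * G k - F k * Q k" unfolding h_def a_def b_def using pos[of k] l by (simp add: right_diff_distrib)
    also have "\<dots> = G k - PA * F k" unfolding GQ[of k] T_def by (simp add: algebra_simps)
    finally show ?thesis .
  qed
  have eqn: "l * g (Suc k) - real k * g k = indicator A k - PA" for k
  proof (cases k)
    case 0
    have "A \<inter> {..0} = (if 0 \<in> A then {0} else {})" by auto
    then have "G 0 = (if 0 \<in> A then \<pi> 0 else 0)" by (simp add: G_def \<pi>_def measure_measure_pmf_finite)
    then have "\<pi> 0 * (l * h 0) = \<pi> 0 * (indicator A 0 - PA)"
      using hform[of 0] by (simp add: F_def algebra_simps)
    then show ?thesis using pos[of 0] by (simp add: 0 g_def)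
  next
    case (Suc j)
    have "\<pi> (Suc j) * (l * h (Suc j) - real (Suc j) * h j) = l * \<pi> (Suc j) * h (Suc j) - (real (Suc j) * \<pi> (Suc j)) * h j"
      by (simp only: right_diff_distrib mult_ac)
    also have "\<dots> = (G (Suc j) - PA * F (Suc j)) - (G j - PA * F j)" unfolding \<open>\<And>k. real (Suc k) * \<pi> (Suc k) = _\<close> hform ..
    also have "\<dots> = r (Suc j) - PA * \<pi> (Suc j)" unfolding GSuc FSuc by (simp add: algebra_simps)
    also have "\<dots> = \<pi> (Suc j) * (indicator A (Suc j) - PA)" by (simp add: r_def algebra_simps)
    finally show ?thesis using pos[of "Suc j"] by (simp add: Suc g_def)
  qed
  have "\<bar>g k\<bar> \<le> a 0" for k using hb by (auto simp: g_def split: nat.splits)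
  moreover have "\<bar>g (Suc k) - g k\<bar> \<le> 2 / (1 + l)" for k
    using hd l by (auto simp: g_def split: nat.splits)
  ultimately show ?thesis using eqn unfolding PA_def by blast
qed

text \<open>Stein's identity for a Poisson variable of mean \<open>l\<close>, up to an error
  proportional to the Lipschitz constant of the test function. Such errors add up over independent
  summands, so the factor \<open>2 / (1 + l)\<close> is applied once, with the mean of the whole
  sum. The bound \<open>B\<close> secures integrability.\<close>

definition stein_approx :: "nat pmf \<Rightarrow> real \<Rightarrow> real \<Rightarrow> bool" where
  "stein_approx \<mu> l e \<longleftrightarrow> integrable (measure_pmf \<mu>) real \<and>
    (\<forall>g B D. (\<forall>k. \<bar>g k\<bar> \<le> B) \<longrightarrow> (\<forall>k. \<bar>g (Suc k) - g k\<bar> \<le> D) \<longrightarrow>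
      \<bar>measure_pmf.expectation \<mu> (\<lambda>k. real k * g k) - l * measure_pmf.expectation \<mu> (\<lambda>k. g (Suc k))\<bar> \<le> e * D)"

lemma integrable_bounded_pmf:
  fixes f :: "'a \<Rightarrow> real"
  shows "(\<And>k. \<bar>f k\<bar> \<le> B) \<Longrightarrow> integrable (measure_pmf \<mu>) f"
  by (intro measure_pmf.integrable_const_bound[where B = B]) auto

lemma integrable_mult_bounded_pmf:
  fixes f g :: "'a \<Rightarrow> real"
  assumes "integrable (measure_pmf \<mu>) f" "\<And>k. \<bar>g k\<bar> \<le> B"
  shows "integrable (measure_pmf \<mu>) (\<lambda>k. f k * g k)"
proof (rule Bochner_Integration.integrable_bound)
  show "integrable (measure_pmf \<mu>) (\<lambda>k. B * f k)" using assms(1) by simp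
  show "AE k in measure_pmf \<mu>. norm (f k * g k) \<le> norm (B * f k)"
  proof (rule AE_I2)
    fix k
    have "\<bar>f k\<bar> * \<bar>g k\<bar> \<le> \<bar>f k\<bar> * B" using assms(2) by (intro mult_left_mono) auto
    also have "\<dots> \<le> \<bar>f k\<bar> * \<bar>B\<bar>" by (intro mult_left_mono) auto
    finally show "norm (f k * g k) \<le> norm (B * f k)" by (simp add: abs_mult mult.commute)
  qed
qed simp

theorem stein_poisson_bound:
  assumes "stein_approx \<mu> l e" and l: "l > 0"
  shows "dTV \<mu> (poisson_pmf l) \<le> e * (2 / (1 + l))"
proof (rule dTV_leI)
  fix A :: "nat set"
  obtain g B where g: "\<And>k. \<bar>g k\<bar> \<le> B" "\<And>k. \<bar>g (Suc k) - g k\<bar> \<le> 2 / (1 + l)"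
    "\<And>k. l * g (Suc k) - real k * g k = indicator A k - measure_pmf.prob (poisson_pmf l) A"
    using stein_solution[OF l, of A] by blast
  have int: "integrable (measure_pmf \<mu>) real" using assms by (simp add: stein_approx_def)
  have 1: "integrable (measure_pmf \<mu>) (\<lambda>k. real k * g k)"
    using g by (intro integrable_mult_bounded_pmf[OF int]) auto
  have 2: "integrable (measure_pmf \<mu>) (\<lambda>k. g (Suc k))" using g by (intro integrable_bounded_pmf[of _ B]) auto
  have "measure_pmf.prob \<mu> A - measure_pmf.prob (poisson_pmf l) A
      = measure_pmf.expectation \<mu> (\<lambda>k. indicator A k - measure_pmf.prob (poisson_pmf l) A)"
    by (subst Bochner_Integration.integral_diff) (auto intro!: integrable_bounded_pmf[of _ 1] split: split_indicator)
  also have "\<dots> = measure_pmf.expectation \<mu> (\<lambda>k. l * g (Suc k) - real k * g k)" by (simp add: g(3))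
  also have "\<dots> = l * measure_pmf.expectation \<mu> (\<lambda>k. g (Suc k)) - measure_pmf.expectation \<mu> (\<lambda>k. real k * g k)"
    using 1 2 by simp
  finally have "\<bar>measure_pmf.prob \<mu> A - measure_pmf.prob (poisson_pmf l) A\<bar>
      = \<bar>measure_pmf.expectation \<mu> (\<lambda>k. real k * g k) - l * measure_pmf.expectation \<mu> (\<lambda>k. g (Suc k))\<bar>"
    by (simp only: abs_minus_commute)
  also have "\<dots> \<le> e * (2 / (1 + l))"
    using assms(1) g(1,2) unfolding stein_approx_def by blast
  finally show "\<bar>measure_pmf.prob \<mu> A - measure_pmf.prob (poisson_pmf l) A\<bar> \<le> e * (2 / (1 + l))" .
qed

section \<open>Building blocks of the Stein approximation, and sums of independent variables\<close>

lemma stein_approx_0: "stein_approx (return_pmf 0) 0 0"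
  by (simp add: stein_approx_def integrable_measure_pmf_finite)

text \<open>The outcome \<open>True\<close> is mapped to 0 because the variable will arise from the
  first trial of a geometric one, where success means exponent 0.\<close>

lemma stein_approx_bernoulli:
  assumes "0 \<le> q" "q \<le> 1"
  shows "stein_approx (map_pmf (\<lambda>b. if b then 0 else 1) (bernoulli_pmf (1 - q))) q (q\<^sup>2)"
proof -
  have "\<bar>q * g 1 - q * ((1 - q) * g 1 + q * g 2)\<bar> \<le> q\<^sup>2 * D" if "\<And>k. \<bar>g (Suc k) - g k\<bar> \<le> D" for g :: "nat \<Rightarrow> real" and D
  proof -
    have "\<bar>q * g 1 - q * ((1 - q) * g 1 + q * g 2)\<bar> = \<bar>q\<^sup>2 * (g 2 - g 1)\<bar>"
      by (subst abs_minus_commute) (simp add: power2_eq_square algebra_simps)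
    also have "\<dots> = q\<^sup>2 * \<bar>g 2 - g 1\<bar>" by (simp add: abs_mult)
    also have "\<dots> \<le> q\<^sup>2 * D" using that[of 1] by (intro mult_left_mono) (auto simp: numeral_2_eq_2)
    finally show ?thesis .
  qed
  moreover have "measure_pmf.expectation (map_pmf (\<lambda>b. if b then 0 else 1) (bernoulli_pmf (1 - q))) (\<lambda>k. real k * g k) = q * g 1"
    for g :: "nat \<Rightarrow> real" using assms by (simp add: mult.commute)
  moreover have "measure_pmf.expectation (map_pmf (\<lambda>b. if b then 0 else 1) (bernoulli_pmf (1 - q))) (\<lambda>k. g (Suc k)) = (1 - q) * g 1 + q * g 2"
    for g :: "nat \<Rightarrow> real" using assms by (simp add: mult.commute numeral_2_eq_2)
  ultimately show ?thesis unfolding stein_approx_def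
    by (simp add: integrable_measure_pmf_finite)
qed

text \<open>Summation by parts leaves only differences of \<open>g\<close>, with weights
  \<open>(k + 1) * q ^ (k + 2)\<close> that add up to the square of the mean
  \<open>q / (1 - q)\<close>.\<close>

lemma stein_approx_geometric:
  assumes q: "0 < q" "q < 1"
  shows "stein_approx (geometric_pmf (1 - q)) (q / (1 - q)) ((q / (1 - q))\<^sup>2)"
  unfolding stein_approx_def
proof (intro conjI allI impI)
  let ?M = "geometric_pmf (1 - q)"
  show int: "integrable (measure_pmf ?M) real" using q by (intro integrable_real_geometric_pmf) auto
  fix g :: "nat \<Rightarrow> real" and B D :: real
  assume B: "\<forall>k. \<bar>g k\<bar> \<le> B" and D: "\<forall>k. \<bar>g (Suc k) - g k\<bar> \<le> D"
  let ?E1 = "measure_pmf.expectation ?M (\<lambda>k. real k * g k)" and ?E2 = "measure_pmf.expectation ?M (\<lambda>k. g (Suc k))"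
  have pm: "pmf ?M k = q ^ k * (1 - q)" for k using q by (subst pmf_geometric) auto
  have 1: "(\<lambda>k. q ^ k * (1 - q) * (real k * g k)) sums ?E1"
    using expectation_nat_sums[of ?M "\<lambda>k. real k * g k"] integrable_mult_bounded_pmf[OF int, of g B] B by (simp add: pm)
  have 2: "(\<lambda>k. q ^ k * (1 - q) * g (Suc k)) sums ?E2"
    using expectation_nat_sums[of ?M "\<lambda>k. g (Suc k)"] integrable_bounded_pmf[of "\<lambda>k. g (Suc k)" B ?M] B by (simp add: pm)
  have shifted: "(\<lambda>k. q ^ Suc k * (1 - q) * (real (Suc k) * g (Suc k))) sums ?E1"
    using 1 by (subst sums_Suc_iff) simp
  \<comment> \<open>The boundary term of the summation by parts: it vanishes at 0 and at infinity,
    so subtracting its telescoping series changes nothing.\<close>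
  define t where "t k = real k * q ^ Suc k * g (Suc k)" for k
  define h where "h k = real (Suc k) * q ^ (k + 2) * (g (Suc (Suc k)) - g (Suc k))" for k
  have t0: "t \<longlonglongrightarrow> 0"
  proof (rule Lim_null_comparison)
    have "(\<lambda>n. real n * q ^ n) \<longlonglongrightarrow> 0" using q by (intro powser_times_n_limit_0) auto
    then show "(\<lambda>n. B * (real n * q ^ n)) \<longlonglongrightarrow> 0" using tendsto_mult_right_zero by blast
    show "eventually (\<lambda>n. norm (t n) \<le> B * (real n * q ^ n)) sequentially"
    proof (intro always_eventually allI)
      fix n
      have "norm (t n) = \<bar>g (Suc n)\<bar> * (real n * q ^ Suc n)" using q by (simp add: t_def abs_mult)
      also have "\<dots> \<le> B * (real n * q ^ n)"
        using q B abs_ge_zero[of "g 0"] by (intro mult_mono) (auto intro: order_trans[OF abs_ge_zero] simp: mult_left_le_one_le)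
      finally show "norm (t n) \<le> B * (real n * q ^ n)" .
    qed
  qed
  have "(\<lambda>k. t k - t (Suc k)) sums (t 0 - 0)" by (rule telescope_sums'[OF t0])
  then have 3: "(\<lambda>k. t k - t (Suc k)) sums 0" by (simp add: t_def)
  have "(\<lambda>k. q ^ Suc k * (1 - q) * (real (Suc k) * g (Suc k)) - q / (1 - q) * (q ^ k * (1 - q) * g (Suc k)) - (t k - t (Suc k)))
      sums (?E1 - q / (1 - q) * ?E2 - 0)"
    by (intro sums_diff sums_mult shifted 2 3)
  moreover have "q ^ Suc k * (1 - q) * (real (Suc k) * g (Suc k)) - q / (1 - q) * (q ^ k * (1 - q) * g (Suc k)) - (t k - t (Suc k)) = h k" for k
  proof -
    have "q / (1 - q) * (q ^ k * (1 - q) * g (Suc k)) = q ^ Suc k * g (Suc k)" using q by simp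
    then have "q ^ Suc k * (1 - q) * (real (Suc k) * g (Suc k)) - q / (1 - q) * (q ^ k * (1 - q) * g (Suc k)) - (t k - t (Suc k))
      = q ^ Suc k * (1 - q) * (real (Suc k) * g (Suc k)) - q ^ Suc k * g (Suc k) - (t k - t (Suc k))" by (simp only:)
    also have "\<dots> = h k" by (simp add: t_def h_def algebra_simps)
    finally show ?thesis .
  qed
  ultimately have h: "h sums (?E1 - q / (1 - q) * ?E2)" by simp
  have "(\<lambda>k. real (Suc k) * q ^ k) sums (1 / (1 - q)\<^sup>2)" using q geometric_deriv_sums[of q] by simp
  then have "(\<lambda>k. D * q\<^sup>2 * (real (Suc k) * q ^ k)) sums (D * q\<^sup>2 * (1 / (1 - q)\<^sup>2))" by (rule sums_mult)
  then have G: "(\<lambda>k. D * q\<^sup>2 * (real (Suc k) * q ^ k)) sums ((q / (1 - q))\<^sup>2 * D)" by (simp add: power_divide mult_ac)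
  have hle: "norm (h k) \<le> D * q\<^sup>2 * (real (Suc k) * q ^ k)" for k
  proof -
    have "norm (h k) = real (Suc k) * q ^ (k + 2) * \<bar>g (Suc (Suc k)) - g (Suc k)\<bar>" using q by (simp add: h_def abs_mult)
    also have "\<dots> \<le> real (Suc k) * q ^ (k + 2) * D" using q D by (intro mult_left_mono) auto
    also have "\<dots> = D * q\<^sup>2 * (real (Suc k) * q ^ k)" by (simp only: power_add mult_ac)
    finally show ?thesis .
  qed
  have "norm (suminf h) \<le> (\<Sum>k. D * q\<^sup>2 * (real (Suc k) * q ^ k))"
    using G by (intro norm_suminf_le hle) (auto simp: sums_iff)
  then show "\<bar>?E1 - q / (1 - q) * ?E2\<bar> \<le> (q / (1 - q))\<^sup>2 * D" using h G by (simp add: sums_iff)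
qed

lemma expectation_pair_pmf_nat:
  fixes f :: "nat \<times> nat \<Rightarrow> real"
  assumes "integrable (measure_pmf (pair_pmf A B)) f"
  shows "measure_pmf.expectation (pair_pmf A B) f
    = measure_pmf.expectation A (\<lambda>x. measure_pmf.expectation B (\<lambda>y. f (x, y)))"
proof -
  have "Infinite_Set_Sum.abs_summable_on (\<lambda>z. pmf (pair_pmf A B) z * f z) (UNIV \<times> UNIV)"
    unfolding Infinite_Set_Sum.abs_summable_on_def
    using assms unfolding measure_pmf_eq_density by (subst (asm) integrable_density) auto
  then have "infsetsum (\<lambda>z. pmf (pair_pmf A B) z * f z) (UNIV \<times> UNIV)
      = infsetsum (\<lambda>x. infsetsum (\<lambda>y. pmf (pair_pmf A B) (x, y) * f (x, y)) UNIV) UNIV"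
    by (intro infsetsum_Times) auto
  also have "\<dots> = infsetsum (\<lambda>x. pmf A x * infsetsum (\<lambda>y. pmf B y * f (x, y)) UNIV) UNIV"
    by (simp add: pmf_pair mult.assoc infsetsum_def)
  finally show ?thesis by (simp add: pmf_expectation_eq_infsetsum)
qed

text \<open>Condition on the other summand \<open>x\<close>: the shifted function
  \<open>\<lambda>k. g (x + k)\<close> obeys the same bounds \<open>B\<close> and \<open>D\<close>,
  so the estimate for \<open>\<mu>\<close> holds uniformly in \<open>x\<close>.\<close>

lemma stein_approx_half_conv:
  fixes g :: "nat \<Rightarrow> real"
  assumes st: "stein_approx \<mu> l e" and B: "\<And>k. \<bar>g k\<bar> \<le> B" and D: "\<And>k. \<bar>g (Suc k) - g k\<bar> \<le> D"
  shows "integrable (measure_pmf (pair_pmf \<nu> \<mu>)) (\<lambda>z. real (snd z) * g (fst z + snd z))"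
    and "\<bar>measure_pmf.expectation (pair_pmf \<nu> \<mu>) (\<lambda>z. real (snd z) * g (fst z + snd z))
      - l * measure_pmf.expectation (pair_pmf \<nu> \<mu>) (\<lambda>z. g (Suc (fst z + snd z)))\<bar> \<le> e * D"
proof -
  have int: "integrable (measure_pmf \<mu>) real" using st by (simp add: stein_approx_def)
  have "integrable (measure_pmf (map_pmf snd (pair_pmf \<nu> \<mu>))) real" using int by (simp only: map_snd_pair_pmf)
  then have "integrable (measure_pmf (pair_pmf \<nu> \<mu>)) (\<lambda>z. real (snd z))" by (simp add: integrable_map_pmf_eq)
  then show 1: "integrable (measure_pmf (pair_pmf \<nu> \<mu>)) (\<lambda>z. real (snd z) * g (fst z + snd z))"
    using B by (rule integrable_mult_bounded_pmf)
  have 2: "integrable (measure_pmf (pair_pmf \<nu> \<mu>)) (\<lambda>z. g (Suc (fst z + snd z)))"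
    using B by (intro integrable_bounded_pmf[of _ B]) auto
  define h1 where "h1 x = measure_pmf.expectation \<mu> (\<lambda>y. real y * g (x + y))" for x
  define h2 where "h2 x = measure_pmf.expectation \<mu> (\<lambda>y. g (Suc (x + y)))" for x
  have E1: "measure_pmf.expectation (pair_pmf \<nu> \<mu>) (\<lambda>z. real (snd z) * g (fst z + snd z)) = measure_pmf.expectation \<nu> h1"
    using expectation_pair_pmf_nat[OF 1] by (simp add: h1_def[abs_def])
  have E2: "measure_pmf.expectation (pair_pmf \<nu> \<mu>) (\<lambda>z. g (Suc (fst z + snd z))) = measure_pmf.expectation \<nu> h2"
    using expectation_pair_pmf_nat[OF 2] by (simp add: h2_def[abs_def])
  have b2: "\<bar>h2 x\<bar> \<le> B" for x
  proof -
    have "\<bar>h2 x\<bar> \<le> measure_pmf.expectation \<mu> (\<lambda>y. \<bar>g (Suc (x + y))\<bar>)" unfolding h2_def by (rule integral_abs_bound)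
    also have "\<dots> \<le> B" using B by (intro measure_pmf.integral_le_const integrable_bounded_pmf[of _ B]) auto
    finally show ?thesis .
  qed
  have diff: "\<bar>h1 x - l * h2 x\<bar> \<le> e * D" for x
  proof -
    have "\<bar>measure_pmf.expectation \<mu> (\<lambda>k. real k * g (x + k)) - l * measure_pmf.expectation \<mu> (\<lambda>k. g (x + Suc k))\<bar> \<le> e * D"
      using st[unfolded stein_approx_def, THEN conjunct2, rule_format, of "\<lambda>k. g (x + k)" B D] B D by simp
    then show ?thesis by (simp add: h1_def h2_def)
  qed
  have i2: "integrable (measure_pmf \<nu>) h2" using b2 by (rule integrable_bounded_pmf)
  \<comment> \<open>Integrability of \<open>h1\<close> is obtained indirectly: it differs by a
    bounded amount from \<open>l * h2\<close>, which is bounded.\<close>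
  have i12: "integrable (measure_pmf \<nu>) (\<lambda>x. h1 x - l * h2 x)" using diff by (rule integrable_bounded_pmf)
  have "integrable (measure_pmf \<nu>) (\<lambda>x. (h1 x - l * h2 x) + l * h2 x)" using i12 i2 by (intro Bochner_Integration.integrable_add) auto
  then have i1: "integrable (measure_pmf \<nu>) h1" by simp
  have "measure_pmf.expectation \<nu> h1 - l * measure_pmf.expectation \<nu> h2 = measure_pmf.expectation \<nu> (\<lambda>x. h1 x - l * h2 x)"
    using i1 i2 by simp
  also have "\<bar>\<dots>\<bar> \<le> measure_pmf.expectation \<nu> (\<lambda>x. \<bar>h1 x - l * h2 x\<bar>)" by (rule integral_abs_bound)
  also have "\<dots> \<le> e * D" using diff i12 by (intro measure_pmf.integral_le_const) auto
  finally show "\<bar>measure_pmf.expectation (pair_pmf \<nu> \<mu>) (\<lambda>z. real (snd z) * g (fst z + snd z))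
      - l * measure_pmf.expectation (pair_pmf \<nu> \<mu>) (\<lambda>z. g (Suc (fst z + snd z)))\<bar> \<le> e * D"
    unfolding E1 E2 .
qed

lemma stein_approx_conv:
  assumes m: "stein_approx \<mu> l e" and n: "stein_approx \<nu> l' e'"
  shows "stein_approx (map_pmf (\<lambda>z. fst z + snd z) (pair_pmf \<mu> \<nu>)) (l + l') (e + e')"
  unfolding stein_approx_def
proof (intro conjI allI impI)
  let ?P = "pair_pmf \<mu> \<nu>"
  have "integrable (measure_pmf (map_pmf fst ?P)) real" "integrable (measure_pmf (map_pmf snd ?P)) real"
    using m n by (simp_all only: map_fst_pair_pmf map_snd_pair_pmf stein_approx_def)
  then show "integrable (measure_pmf (map_pmf (\<lambda>z. fst z + snd z) ?P)) real"
    by (simp add: integrable_map_pmf_eq)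
  fix g :: "nat \<Rightarrow> real" and B D :: real
  assume B: "\<forall>k. \<bar>g k\<bar> \<le> B" and D: "\<forall>k. \<bar>g (Suc k) - g k\<bar> \<le> D"
  note h = stein_approx_half_conv[OF n, of g B D \<mu>] and h' = stein_approx_half_conv[OF m, of g B D \<nu>]
  have swap: "measure_pmf (pair_pmf \<nu> \<mu>) = measure_pmf (map_pmf (\<lambda>(x, y). (y, x)) ?P)"
    by (subst pair_commute_pmf) simp
  have i1: "integrable (measure_pmf ?P) (\<lambda>z. real (snd z) * g (fst z + snd z))" using h B D by simp
  have i2: "integrable (measure_pmf ?P) (\<lambda>z. real (fst z) * g (fst z + snd z))"
    using h'(1) B D unfolding swap by (simp add: integrable_map_pmf_eq case_prod_beta add.commute)
  have d1: "\<bar>measure_pmf.expectation ?P (\<lambda>z. real (snd z) * g (fst z + snd z))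
      - l' * measure_pmf.expectation ?P (\<lambda>z. g (Suc (fst z + snd z)))\<bar> \<le> e' * D" using h B D by simp
  have d2: "\<bar>measure_pmf.expectation ?P (\<lambda>z. real (fst z) * g (fst z + snd z))
      - l * measure_pmf.expectation ?P (\<lambda>z. g (Suc (fst z + snd z)))\<bar> \<le> e * D"
    using h'(2) B D unfolding swap by (simp add: case_prod_beta add.commute)
  have "measure_pmf.expectation ?P (\<lambda>z. real (fst z + snd z) * g (fst z + snd z))
      = measure_pmf.expectation ?P (\<lambda>z. real (fst z) * g (fst z + snd z))
      + measure_pmf.expectation ?P (\<lambda>z. real (snd z) * g (fst z + snd z))"
    using i1 i2 by (subst Bochner_Integration.integral_add[symmetric]) (auto simp: distrib_right)
  then show "\<bar>measure_pmf.expectation (map_pmf (\<lambda>z. fst z + snd z) ?P) (\<lambda>k. real k * g k)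
      - (l + l') * measure_pmf.expectation (map_pmf (\<lambda>z. fst z + snd z) ?P) (\<lambda>k. g (Suc k))\<bar> \<le> (e + e') * D"
    using d1 d2 by (simp add: distrib_right del: of_nat_add)
qed

lemma stein_approx_sum:
  assumes "finite T" "\<And>p. p \<in> T \<Longrightarrow> stein_approx (map_pmf \<phi> (\<mu> p)) (l p) (e p)"
  shows "stein_approx (map_pmf (\<lambda>X. \<Sum>p\<in>T. \<phi> (X p)) (Pi_pmf T d \<mu>)) (\<Sum>p\<in>T. l p) (\<Sum>p\<in>T. e p)"
  using assms
proof (induction T rule: finite_induct)
  case empty
  then show ?case by (simp add: stein_approx_0)
next
  case (insert p T)
  have "map_pmf (\<lambda>X. \<Sum>r\<in>insert p T. \<phi> (X r)) (Pi_pmf (insert p T) d \<mu>)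
      = map_pmf (\<lambda>z. \<phi> (fst z) + (\<Sum>r\<in>T. \<phi> (snd z r))) (pair_pmf (\<mu> p) (Pi_pmf T d \<mu>))"
    unfolding Pi_pmf_insert[OF insert.hyps] map_pmf_comp
  proof (intro map_pmf_cong refl)
    fix z :: "'b \<times> ('a \<Rightarrow> 'b)"
    have "(\<Sum>r\<in>T. \<phi> (((snd z)(p := fst z)) r)) = (\<Sum>r\<in>T. \<phi> (snd z r))"
      using insert.hyps by (intro sum.cong) auto
    then show "(\<Sum>r\<in>insert p T. \<phi> ((case z of (y, f) \<Rightarrow> f(p := y)) r)) = \<phi> (fst z) + (\<Sum>r\<in>T. \<phi> (snd z r))"
      using insert.hyps by (simp add: case_prod_beta)
  qed
  also have "\<dots> = map_pmf (\<lambda>z. fst z + snd z) (map_pmf (\<lambda>(a, b). (\<phi> a, \<Sum>r\<in>T. \<phi> (b r))) (pair_pmf (\<mu> p) (Pi_pmf T d \<mu>)))"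
    by (simp add: map_pmf_comp case_prod_beta)
  also have "\<dots> = map_pmf (\<lambda>z. fst z + snd z) (pair_pmf (map_pmf \<phi> (\<mu> p)) (map_pmf (\<lambda>X. \<Sum>r\<in>T. \<phi> (X r)) (Pi_pmf T d \<mu>)))"
    by (simp only: map_pair)
  finally show ?case
    using stein_approx_conv[OF insert.prems[of p] insert.IH] insert by simp
qed

section \<open>Total variation under maps, mixtures and products\<close>

lemma dTV_triangle: "dTV P R \<le> dTV P Q + dTV Q R"
proof (rule dTV_leI)
  fix A
  show "\<bar>measure_pmf.prob P A - measure_pmf.prob R A\<bar> \<le> dTV P Q + dTV Q R"
    using dTV_upper[of P A Q] dTV_upper[of Q A R] by linarith
qed

lemma dTV_map: "dTV (map_pmf f P) (map_pmf f Q) \<le> dTV P Q"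
  by (rule dTV_leI) (simp add: dTV_upper)

lemma dTV_refl: "dTV P P = 0"
  by (simp add: dTV_def)

lemma prob_bind_pmf: "measure_pmf.prob (bind_pmf M N) A = measure_pmf.expectation M (\<lambda>x. measure_pmf.prob (N x) A)"
proof -
  have int: "integrable (measure_pmf M) (\<lambda>x. measure_pmf.prob (N x) A)"
    by (rule integrable_bounded_pmf[of _ 1]) auto
  have "ennreal (measure_pmf.prob (bind_pmf M N) A) = (\<integral>\<^sup>+x. ennreal (measure_pmf.prob (N x) A) \<partial>measure_pmf M)"
    using emeasure_bind_pmf[of M N A] by (simp add: measure_pmf.emeasure_eq_measure)
  also have "\<dots> = ennreal (measure_pmf.expectation M (\<lambda>x. measure_pmf.prob (N x) A))"
    using int by (intro nn_integral_eq_integral) auto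
  finally show ?thesis by (subst (asm) ennreal_inj) (auto intro: integral_nonneg)
qed

lemma dTV_bind:
  assumes "\<And>x. dTV (f x) (g x) \<le> d"
  shows "dTV (bind_pmf M f) (bind_pmf M g) \<le> d"
proof (rule dTV_leI)
  fix A
  have i: "integrable (measure_pmf M) (\<lambda>x. measure_pmf.prob (h x) A)" for h :: "'a \<Rightarrow> 'b pmf"
    by (rule integrable_bounded_pmf[of _ 1]) auto
  have "measure_pmf.prob (bind_pmf M f) A - measure_pmf.prob (bind_pmf M g) A
      = measure_pmf.expectation M (\<lambda>x. measure_pmf.prob (f x) A - measure_pmf.prob (g x) A)"
    unfolding prob_bind_pmf using i by simp
  also have "\<bar>\<dots>\<bar> \<le> measure_pmf.expectation M (\<lambda>x. \<bar>measure_pmf.prob (f x) A - measure_pmf.prob (g x) A\<bar>)"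
    by (rule integral_abs_bound)
  also have "\<dots> \<le> d"
    using i assms by (intro measure_pmf.integral_le_const) (auto intro: order_trans[OF dTV_upper])
  finally show "\<bar>measure_pmf.prob (bind_pmf M f) A - measure_pmf.prob (bind_pmf M g) A\<bar> \<le> d" .
qed

lemma dTV_pair_right: "dTV (pair_pmf A B) (pair_pmf A B') \<le> dTV B B'"
  unfolding pair_pmf_def by (intro dTV_bind) (simp add: dTV_map flip: map_pmf_def)

lemma dTV_pair: "dTV (pair_pmf A B) (pair_pmf A' B') \<le> dTV A A' + dTV B B'"
proof -
  have "dTV (pair_pmf A B) (pair_pmf A' B) \<le> dTV (pair_pmf B A) (pair_pmf B A')"
    by (subst (1 2) pair_commute_pmf) (rule dTV_map)
  also have "\<dots> \<le> dTV A A'" by (rule dTV_pair_right)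
  finally show ?thesis
    using dTV_triangle[of "pair_pmf A B" "pair_pmf A' B'" "pair_pmf A' B"] dTV_pair_right[of A' B B'] by linarith
qed

lemma dTV_Pi_pmf:
  assumes "finite I"
  shows "dTV (Pi_pmf I d P) (Pi_pmf I d Q) \<le> (\<Sum>i\<in>I. dTV (P i) (Q i))"
  using assms
proof (induction I rule: finite_induct)
  case (insert i I)
  have "dTV (Pi_pmf (insert i I) d P) (Pi_pmf (insert i I) d Q)
      \<le> dTV (pair_pmf (P i) (Pi_pmf I d P)) (pair_pmf (Q i) (Pi_pmf I d Q))"
    unfolding Pi_pmf_insert[OF insert.hyps] by (rule dTV_map)
  also have "\<dots> \<le> dTV (P i) (Q i) + dTV (Pi_pmf I d P) (Pi_pmf I d Q)" by (rule dTV_pair)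
  finally show ?case using insert by simp
qed (simp add: dTV_refl)

text \<open>Functions of disjoint blocks of independent coordinates are independent. The induction
  splits the block \<open>T m\<close> off \<open>S\<close>, so \<open>S\<close> has to vary.\<close>

lemma Pi_pmf_group_sums:
  fixes \<phi> :: "nat \<Rightarrow> 'b \<Rightarrow> nat" and T :: "nat \<Rightarrow> 'a set"
  assumes "finite S" "\<And>i. i < m \<Longrightarrow> T i \<subseteq> S" "\<And>i j. i < m \<Longrightarrow> j < m \<Longrightarrow> i \<noteq> j \<Longrightarrow> T i \<inter> T j = {}"
  shows "map_pmf (\<lambda>X i. if i < m then \<Sum>p\<in>T i. \<phi> i (X p) else 0) (Pi_pmf S d \<mu>)
    = Pi_pmf {..<m} 0 (\<lambda>i. map_pmf (\<lambda>X. \<Sum>p\<in>T i. \<phi> i (X p)) (Pi_pmf (T i) d \<mu>))"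
  using assms
proof (induction m arbitrary: S)
  case 0
  then show ?case by (simp add: map_pmf_const)
next
  case (Suc m)
  let ?A = "T m" and ?B = "S - T m"
  have AB: "finite ?A" "finite ?B" "?A \<inter> ?B = {}" "S = ?A \<union> ?B"
    using Suc.prems(1) Suc.prems(2)[of m] by (auto intro: finite_subset)
  have sub: "T i \<subseteq> ?B" if "i < m" for i
    using Suc.prems(2)[of i] Suc.prems(3)[of i m] that by auto
  define H where "H = (\<lambda>g :: 'a \<Rightarrow> 'b. \<lambda>i. if i < m then \<Sum>p\<in>T i. \<phi> i (g p) else 0)"
  define K where "K = (\<lambda>f :: 'a \<Rightarrow> 'b. \<Sum>p\<in>T m. \<phi> m (f p))"
  have "map_pmf (\<lambda>X i. if i < Suc m then \<Sum>p\<in>T i. \<phi> i (X p) else 0) (Pi_pmf S d \<mu>)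
      = map_pmf (\<lambda>z. (H (snd z))(m := K (fst z))) (pair_pmf (Pi_pmf ?A d \<mu>) (Pi_pmf ?B d \<mu>))"
    unfolding AB(4)[THEN arg_cong, of "\<lambda>S. Pi_pmf S d \<mu>"] Pi_pmf_union[OF AB(1-3)] map_pmf_comp
  proof (intro map_pmf_cong refl ext)
    fix z :: "('a \<Rightarrow> 'b) \<times> ('a \<Rightarrow> 'b)" and i
    have "(\<Sum>p\<in>T i. \<phi> i (if p \<in> T m then fst z p else snd z p)) = (\<Sum>p\<in>T i. \<phi> i (snd z p))" if "i < m"
      using sub[OF that] by (intro sum.cong) auto
    then show "(if i < Suc m then \<Sum>p\<in>T i. \<phi> i ((case z of (f, g) \<Rightarrow> \<lambda>x. if x \<in> T m then f x else g x) p) else 0)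
        = ((H (snd z))(m := K (fst z))) i"
      by (auto simp: H_def K_def case_prod_beta less_Suc_eq)
  qed
  also have "\<dots> = map_pmf (\<lambda>(a, h). h(m := a)) (map_pmf (\<lambda>(f, g). (K f, H g)) (pair_pmf (Pi_pmf ?A d \<mu>) (Pi_pmf ?B d \<mu>)))"
    by (simp add: map_pmf_comp case_prod_beta)
  also have "\<dots> = map_pmf (\<lambda>(a, h). h(m := a)) (pair_pmf (map_pmf K (Pi_pmf ?A d \<mu>)) (map_pmf H (Pi_pmf ?B d \<mu>)))"
    by (simp only: map_pair)
  also have "map_pmf H (Pi_pmf ?B d \<mu>) = Pi_pmf {..<m} 0 (\<lambda>i. map_pmf (\<lambda>X. \<Sum>p\<in>T i. \<phi> i (X p)) (Pi_pmf (T i) d \<mu>))"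
    unfolding H_def using AB sub Suc.prems(3) by (intro Suc.IH) auto
  also have "map_pmf (\<lambda>(a, h). h(m := a)) (pair_pmf (map_pmf K (Pi_pmf ?A d \<mu>)) \<dots>)
      = Pi_pmf (insert m {..<m}) 0 (\<lambda>i. map_pmf (\<lambda>X. \<Sum>p\<in>T i. \<phi> i (X p)) (Pi_pmf (T i) d \<mu>))"
    unfolding K_def by (subst Pi_pmf_insert) auto
  finally show ?case by (simp add: lessThan_Suc)
qed

section \<open>Exponents (for \<open>OmegaT\<close>) or indicators (for \<open>omegaT\<close>)
  against Poisson variables\<close>

definition prime_statistic :: "bool \<Rightarrow> nat \<Rightarrow> nat" where
  "prime_statistic b k = (if b then k else if k = 0 then 0 else 1)"

lemma stein_approx_prime_statistic:
  assumes p: "prime p"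
  shows "stein_approx (map_pmf (prime_statistic b) (geometric_pmf (1 - 1 / real p)))
    (if b then 1 / (real p - 1) else 1 / real p) ((if b then 1 / (real p - 1) else 1 / real p)\<^sup>2)"
proof -
  have p2: "real p \<ge> 2" using prime_ge_2_nat[OF p] by simp
  show ?thesis
  proof (cases b)
    case True
    have "1 / real p / (1 - 1 / real p) = 1 / (real p - 1)" using p2 by (simp add: field_simps)
    moreover have "prime_statistic b = id" using True by (auto simp: prime_statistic_def)
    ultimately show ?thesis using stein_approx_geometric[of "1 / real p"] p2 True by simp
  next
    case False
    have "map_pmf (prime_statistic b) (geometric_pmf (1 - 1 / real p))
        = map_pmf (\<lambda>b. if b then 0 else 1) (bernoulli_pmf (1 - 1 / real p))"
    proof -
      \<comment> \<open>Only the first trial matters: success is exponent 0, and after a failure the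
        exponent is positive, so the statistic is 1 whatever follows.\<close>
      have "map_pmf (prime_statistic b) (geometric_pmf (1 - 1 / real p))
          = bernoulli_pmf (1 - 1 / real p) \<bind> (\<lambda>c. map_pmf (prime_statistic b)
              (if c then return_pmf 0 else map_pmf Suc (geometric_pmf (1 - 1 / real p))))"
        using p2 by (subst geometric_bind_pmf_unfold) (auto simp: map_bind_pmf)
      also have "(\<lambda>c. map_pmf (prime_statistic b) (if c then return_pmf 0 else map_pmf Suc (geometric_pmf (1 - 1 / real p))))
          = (\<lambda>c. return_pmf (if c then 0 else 1))"
        using False by (auto simp: map_pmf_comp prime_statistic_def map_pmf_const)
      finally show ?thesis by (simp add: map_pmf_def)
    qed
    then show ?thesis using stein_approx_bernoulli[of "1 / real p"] p2 False by simp
  qed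
qed

text \<open>In both cases each prime contributes the square of its mean, and that mean is at most
  \<open>1 / (p - 1) \<le> 2 / p\<close>; the resulting 4 times Stein's 2 is the 8. The mean of the
  sum is at least \<open>HT T\<close>.\<close>

lemma dTV_statistic_poisson:
  assumes T: "finite T" "T \<noteq> {}" "\<And>p. p \<in> T \<Longrightarrow> prime p"
  shows "dTV (map_pmf (\<lambda>X. \<Sum>p\<in>T. prime_statistic b (X p)) (Pi_pmf T 0 (\<lambda>p. geometric_pmf (1 - 1 / real p))))
    (poisson_pmf (if b then H1T T else HT T)) \<le> 8 * (H2T T / (1 + HT T))"
proof -
  define l where "l p = (if b then 1 / (real p - 1) else 1 / real p)" for p :: nat
  define lam where "lam = (if b then H1T T else HT T)"
  have p2: "real p \<ge> 2" if "p \<in> T" for p using prime_ge_2_nat[OF T(3)[OF that]] by simp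
  have lsum: "lam = (\<Sum>p\<in>T. l p)" by (simp add: lam_def l_def H1T_def HT_def)
  have Hpos: "HT T > 0" unfolding HT_def using T p2 by (intro sum_pos) force+
  have H2: "H2T T \<ge> 0" unfolding H2T_def by (intro sum_nonneg) auto
  have ll: "1 / real p \<le> l p" if "p \<in> T" for p
    unfolding l_def using p2[OF that] by (auto intro!: divide_left_mono)
  have lamH: "HT T \<le> lam" unfolding lsum HT_def by (intro sum_mono ll)
  have l2: "(l p)\<^sup>2 \<le> 4 * (1 / (real p)\<^sup>2)" if "p \<in> T" for p
  proof -
    have "l p \<le> 2 / real p" unfolding l_def using p2[OF that] by (auto simp: field_simps)
    then have "(l p)\<^sup>2 \<le> (2 / real p)\<^sup>2" using ll[OF that] by (intro power_mono) (auto intro: order_trans[rotated])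
    then show ?thesis by (simp add: power_divide)
  qed
  have "stein_approx (map_pmf (\<lambda>X. \<Sum>p\<in>T. prime_statistic b (X p)) (Pi_pmf T 0 (\<lambda>p. geometric_pmf (1 - 1 / real p))))
      (\<Sum>p\<in>T. l p) (\<Sum>p\<in>T. (l p)\<^sup>2)"
    using T by (intro stein_approx_sum) (auto simp: l_def intro!: stein_approx_prime_statistic[where b = True, simplified] stein_approx_prime_statistic[where b = False, simplified])
  then have "dTV (map_pmf (\<lambda>X. \<Sum>p\<in>T. prime_statistic b (X p)) (Pi_pmf T 0 (\<lambda>p. geometric_pmf (1 - 1 / real p))))
    (poisson_pmf lam) \<le> (\<Sum>p\<in>T. (l p)\<^sup>2) * (2 / (1 + lam))"
    unfolding lsum[symmetric] using Hpos lamH by (intro stein_poisson_bound) auto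
  also have "\<dots> \<le> (4 * H2T T) * (2 / (1 + HT T))"
  proof (intro mult_mono divide_left_mono)
    show "(\<Sum>p\<in>T. (l p)\<^sup>2) \<le> 4 * H2T T" unfolding H2T_def sum_distrib_left by (intro sum_mono l2)
  qed (use Hpos lamH H2 in auto)
  finally show ?thesis unfolding lam_def by simp
qed

text \<open>As \<open>p \<le> y\<close>, \<open>H2T T \<ge> HT T / y\<close>; and
  \<open>HT T \<ge> 1 / y\<close> with \<open>y \<ge> 2\<close> gives
  \<open>HT T / (1 + HT T) \<ge> 1 / (2 * y)\<close>.\<close>

lemma H2T_ratio_lower:
  assumes "finite T" "T \<noteq> {}" "\<And>p. p \<in> T \<Longrightarrow> prime p \<and> real p \<le> y" "y \<ge> 2"
  shows "1 / y\<^sup>2 \<le> 2 * (H2T T / (1 + HT T))"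
proof -
  have p0: "real p > 0" if "p \<in> T" for p using assms(3)[OF that] prime_gt_0_nat by simp
  obtain p where p: "p \<in> T" using assms by auto
  have "1 / y \<le> 1 / real p" using assms p p0[OF p] by (intro divide_left_mono) auto
  also have "\<dots> \<le> HT T" unfolding HT_def using assms(1) p by (intro member_le_sum) auto
  finally have H: "1 / y \<le> HT T" .
  then have H0: "HT T > 0" using assms(4) by (simp add: less_le_trans[of 0 "1 / y"])
  have "HT T * (1 / y) \<le> H2T T"
    unfolding HT_def H2T_def sum_distrib_right
  proof (rule sum_mono)
    fix r assume r: "r \<in> T"
    have "1 / real r * (1 / y) \<le> 1 / real r * (1 / real r)"
      using assms(3)[OF r] p0[OF r] assms(4) by (intro mult_left_mono divide_left_mono) auto
    then show "1 / real r * (1 / y) \<le> 1 / (real r)\<^sup>2" by (simp add: power2_eq_square)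
  qed
  then have "HT T * (1 / y) / (1 + HT T) \<le> H2T T / (1 + HT T)" using H0 by (intro divide_right_mono) auto
  moreover have "1 / (2 * y) \<le> HT T / (1 + HT T)"
  proof -
    have "1 \<le> y * HT T" using H assms(4) by (simp add: field_simps)
    moreover have "2 * HT T \<le> y * HT T" using assms(4) H0 by (intro mult_right_mono) auto
    ultimately have "1 + HT T \<le> 2 * y * HT T" by linarith
    then show ?thesis using H0 assms(4) by (simp add: field_simps)
  qed
  then have "1 / (2 * y) * (1 / y) \<le> HT T / (1 + HT T) * (1 / y)" using assms(4) by (intro mult_right_mono) auto
  moreover have "HT T / (1 + HT T) * (1 / y) = HT T * (1 / y) / (1 + HT T)" by simp
  ultimately have "1 / (2 * y) * (1 / y) \<le> H2T T / (1 + HT T)" by linarith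
  then show ?thesis by (simp add: power2_eq_square)
qed

lemma statistic_valuation:
  assumes "finite T" "\<And>p. p \<in> T \<Longrightarrow> prime p" "T \<subseteq> S" "n > 0"
  shows "(\<Sum>p\<in>T. prime_statistic b (valuation_vector S n p)) = (if b then OmegaT n T else omegaT n T)"
proof -
  have "(\<Sum>p\<in>T. prime_statistic b (valuation_vector S n p)) = (\<Sum>p\<in>T. prime_statistic b (multiplicity p n))"
    using assms(3) by (intro sum.cong) (auto simp: valuation_vector_def)
  also have "\<dots> = (if b then OmegaT n T else omegaT n T)"
  proof (cases b)
    case False
    have "(\<Sum>p\<in>T. prime_statistic b (multiplicity p n)) = (\<Sum>p\<in>T. if p dvd n then 1 else 0)"
    proof (intro sum.cong refl)
      fix p assume p: "p \<in> T"
      have "multiplicity p n = 0 \<longleftrightarrow> \<not> p dvd n"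
        using assms(2)[OF p] assms(4) by (simp add: prime_elem_multiplicity_eq_zero_iff)
      then show "prime_statistic b (multiplicity p n) = (if p dvd n then 1 else 0)"
        using False by (simp add: prime_statistic_def)
    qed
    also have "\<dots> = card {p \<in> T. p dvd n}" using assms(1) by (simp add: sum.If_cases Int_def)
    finally show ?thesis using False by (simp add: omegaT_def)
  qed (simp add: OmegaT_def prime_statistic_def)
  finally show ?thesis .
qed

theorem theorem1:
  "\<exists>C::real. \<forall>(x::real) (y::real) (m::nat) (T::nat \<Rightarrow> nat set) (useOmega::nat \<Rightarrow> bool).
     2 \<le> y \<longrightarrow> y \<le> x \<longrightarrow>
     (\<forall>i<m. T i \<noteq> {} \<and> T i \<subseteq> {p. prime p \<and> real p \<le> y}) \<longrightarrow>
     (\<forall>i<m. \<forall>j<m. i \<noteq> j \<longrightarrow> T i \<inter> T j = {}) \<longrightarrow>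
     (let f = (\<lambda>i n. if useOmega i then OmegaT n (T i) else omegaT n (T i));
          lam = (\<lambda>i. if useOmega i then H1T (T i) else HT (T i));
          u = ln x / ln y;
          Pn = map_pmf (\<lambda>n. \<lambda>i. if i < m then f i n else 0)
                 (pmf_of_set {1..nat \<lfloor>x\<rfloor>});
          PZ = Pi_pmf {..<m} 0 (\<lambda>i. poisson_pmf (lam i))
      in dTV Pn PZ \<le> C * ((\<Sum>j<m. H2T (T j) / (1 + HT (T j))) + u powr (-u)))"
proof -
  obtain C where C: "C > 0" and kub: "\<And>x y::real. 2 \<le> y \<Longrightarrow> y \<le> x \<Longrightarrow>
    (\<exists>q. y < real q \<and> dTV (map_pmf (valuation_vector {p. prime p \<and> p < q}) (pmf_of_set {1..nat \<lfloor>x\<rfloor>})) (prime_model q)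
      \<le> C * ((ln x / ln y) powr (- (ln x / ln y)) + 1 / y\<^sup>2))"
    using kubilius by blast
  have "dTV (map_pmf (\<lambda>n i. if i < m then if useOmega i then OmegaT n (T i) else omegaT n (T i) else 0) (pmf_of_set {1..nat \<lfloor>x\<rfloor>}))
      (Pi_pmf {..<m} 0 (\<lambda>i. poisson_pmf (if useOmega i then H1T (T i) else HT (T i))))
      \<le> (2 * C + 8) * ((\<Sum>j<m. H2T (T j) / (1 + HT (T j))) + u powr (- u))"
    if y: "2 \<le> y" and xy: "y \<le> x" and ne: "\<forall>i<m. T i \<noteq> {} \<and> T i \<subseteq> {p. prime p \<and> real p \<le> y}"
      and disj: "\<forall>i<m. \<forall>j<m. i \<noteq> j \<longrightarrow> T i \<inter> T j = {}" and u: "u = ln x / ln y"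
    for x y u :: real and m and T :: "nat \<Rightarrow> nat set" and useOmega
  proof (cases "m = 0")
    \<comment> \<open>Without any set nothing could absorb \<open>1 / y\<^sup>2\<close>, but then
      both laws are the same point mass.\<close>
    case True
    then show ?thesis using C by (simp add: map_pmf_const dTV_refl)
  next
    case False
    obtain q where q: "y < real q" and dq: "dTV (map_pmf (valuation_vector {p. prime p \<and> p < q}) (pmf_of_set {1..nat \<lfloor>x\<rfloor>})) (prime_model q)
      \<le> C * (u powr (- u) + 1 / y\<^sup>2)" using kub[OF y xy] u by auto
    define S where "S = {p. prime p \<and> p < q}"
    define N where "N = nat \<lfloor>x\<rfloor>"
    \<comment> \<open>One map sends the true valuations to the given vector and the model to
      independent sums, so the Kubilius bound passes through it.\<close>
    define \<Phi> where "\<Phi> = (\<lambda>X i. if i < m then \<Sum>p\<in>T i. prime_statistic (useOmega i) (X p) else 0)"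
    define Sg where "Sg = (\<Sum>j<m. H2T (T j) / (1 + HT (T j)))"
    define PZ where "PZ = Pi_pmf {..<m} 0 (\<lambda>i. poisson_pmf (if useOmega i then H1T (T i) else HT (T i)))"
    have N: "N \<ge> 1" using y xy unfolding N_def by linarith
    have TS: "T i \<subseteq> S" if "i < m" for i
    proof
      fix p assume "p \<in> T i"
      then have "prime p" "real p \<le> y" using ne that by auto
      then show "p \<in> S" using q unfolding S_def by simp
    qed
    have fS: "finite S" by (simp add: S_def)
    have fT: "finite (T i)" if "i < m" for i using TS[OF that] fS by (rule finite_subset)
    have pT: "prime p" if "i < m" "p \<in> T i" for i p using ne that by auto
    have Pn: "map_pmf (\<lambda>n i. if i < m then if useOmega i then OmegaT n (T i) else omegaT n (T i) else 0) (pmf_of_set {1..N})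
        = map_pmf \<Phi> (map_pmf (valuation_vector S) (pmf_of_set {1..N}))"
      unfolding map_pmf_comp
    proof (intro map_pmf_cong refl ext)
      fix n i assume "n \<in> set_pmf (pmf_of_set {1..N})"
      then have "n > 0" using N by (subst (asm) set_pmf_of_set) auto
      then show "(if i < m then if useOmega i then OmegaT n (T i) else omegaT n (T i) else 0) = \<Phi> (valuation_vector S n) i"
        unfolding \<Phi>_def using statistic_valuation[of "T i" S n "useOmega i"] fT[of i] pT[of i] TS[of i] by auto
    qed
    have mid: "map_pmf \<Phi> (prime_model q) = Pi_pmf {..<m} 0 (\<lambda>i. map_pmf (\<lambda>X. \<Sum>p\<in>T i. prime_statistic (useOmega i) (X p))
        (Pi_pmf (T i) 0 (\<lambda>p. geometric_pmf (1 - 1 / real p))))"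
      unfolding \<Phi>_def prime_model_def S_def[symmetric] using fS TS disj by (intro Pi_pmf_group_sums) auto
    have terms: "0 \<le> H2T (T j) / (1 + HT (T j))" for j
      unfolding H2T_def HT_def by (intro divide_nonneg_nonneg sum_nonneg add_nonneg_nonneg) auto
    have Sg0: "Sg \<ge> 0" unfolding Sg_def by (intro sum_nonneg terms)
    have "dTV (map_pmf \<Phi> (map_pmf (valuation_vector S) (pmf_of_set {1..N}))) PZ
        \<le> dTV (map_pmf \<Phi> (map_pmf (valuation_vector S) (pmf_of_set {1..N}))) (map_pmf \<Phi> (prime_model q)) + dTV (map_pmf \<Phi> (prime_model q)) PZ"
      by (rule dTV_triangle)
    also have "dTV (map_pmf \<Phi> (map_pmf (valuation_vector S) (pmf_of_set {1..N}))) (map_pmf \<Phi> (prime_model q)) \<le> C * (u powr (- u) + 1 / y\<^sup>2)"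
      using order_trans[OF dTV_map dq] unfolding S_def N_def .
    also have "dTV (map_pmf \<Phi> (prime_model q)) PZ \<le> 8 * Sg"
    proof -
      have "dTV (map_pmf \<Phi> (prime_model q)) PZ \<le> (\<Sum>i<m. dTV (map_pmf (\<lambda>X. \<Sum>p\<in>T i. prime_statistic (useOmega i) (X p))
        (Pi_pmf (T i) 0 (\<lambda>p. geometric_pmf (1 - 1 / real p)))) (poisson_pmf (if useOmega i then H1T (T i) else HT (T i))))"
        unfolding mid PZ_def by (rule dTV_Pi_pmf) simp
      also have "\<dots> \<le> (\<Sum>i<m. 8 * (H2T (T i) / (1 + HT (T i))))"
        using fT pT ne by (intro sum_mono dTV_statistic_poisson) auto
      finally show ?thesis by (simp add: Sg_def sum_distrib_left)
    qed
    also have "1 / y\<^sup>2 \<le> 2 * Sg"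
    proof -
      have "1 / y\<^sup>2 \<le> 2 * (H2T (T 0) / (1 + HT (T 0)))"
        using ne y False fT[of 0] by (intro H2T_ratio_lower) auto
      also have "H2T (T 0) / (1 + HT (T 0)) \<le> Sg"
        unfolding Sg_def using False terms by (intro member_le_sum) auto
      finally show ?thesis by simp
    qed
    finally have "dTV (map_pmf \<Phi> (map_pmf (valuation_vector S) (pmf_of_set {1..N}))) PZ
        \<le> C * (u powr (- u) + 2 * Sg) + 8 * Sg" using C by simp
    also have "\<dots> \<le> (2 * C + 8) * (Sg + u powr (- u))"
      using C Sg0 by (simp add: algebra_simps)
    finally show ?thesis using Pn unfolding N_def Sg_def PZ_def by simp
  qed
  then show ?thesis unfolding Let_def by blast
qed

end
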